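(* Let $\omega$ be a Kähler form with constant coefficients on $\mathbb{C}^n$. Let $p,q,m$ be integers with $0\le p,q\le p+q\le m\le n$. Let $\alpha_1,\dots,\alpha_{m-p-q+1}$ be real $(1,1)$-forms with constant coefficients on $\mathbb{C}^n$, each semipositive and $m$-positive with respect to $\omega$. Put $\Omega=\omega^{n-m}\wedge\alpha_1\wedge\cdots\wedge\alpha_{m-p-q}$, let $\Lambda^{p,q}$ be the space of complex $(p,q)$-forms with constant coefficients on $\mathbb{C}^n$, and $$P^{p,q}=\{\Phi\in\Lambda^{p,q} : \Omega\wedge\alpha_{m-p-q+1}\wedge\Phi=0\}.$$ Let $\Gamma$ be a fixed positive volume form (constant coefficients) on $\mathbb{C}^n$ and define $Q(\Phi,\Psi)=i^{q-p}(-1)^{(p+q)(p+q+1)/2}\,\Omega\wedge\Phi\wedge\overline{\Psi}/\Gamma$ for $\Phi,\Psi\in\Lambda^{p,q}$. Then $Q$ is positive definite on $P^{p,q}$.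
   Context: A real $(1,1)$-form $\alpha$ with constant coefficients is $m$-positive with respect to $\omega$ if $\alpha^k\wedge\omega^{n-k}>0$ (a positive multiple of the standard volume form) for every $1\le k\le m$. Semipositive means positive semidefinite. For a top-degree form $\Theta$, $\Theta/\Gamma$ denotes the complex number $c$ with $\Theta=c\Gamma$. *)

theory Defs
  imports Complex_Main
begin

text \<open>Constant-coefficient complex differential forms on C^n.
  The generators dz_j and d(bar z)_j (j < n) are encoded as the natural numbers
  2j and 2j+1 respectively; this fixes a total order on the generators.
  A form is given by its coefficient function on finite sets S of generators,
  where the coefficient at S is the coefficient of the basis element e_S =
  e_{s1} wedge ... wedge e_{sk} with s1 < ... < sk.\<close>

type_synonym cform = "nat set \<Rightarrow> complex"

definition is_form :: "nat \<Rightarrow> cform \<Rightarrow> bool" where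
  "is_form n \<Phi> \<longleftrightarrow> (\<forall>S. \<Phi> S \<noteq> 0 \<longrightarrow> S \<subseteq> {..<2*n})"

definition hol_deg :: "nat set \<Rightarrow> nat" where
  "hol_deg S = card {x\<in>S. even x}"
definition antihol_deg :: "nat set \<Rightarrow> nat" where
  "antihol_deg S = card {x\<in>S. odd x}"

definition is_pq_form :: "nat \<Rightarrow> nat \<Rightarrow> nat \<Rightarrow> cform \<Rightarrow> bool" where
  "is_pq_form n p q \<Phi> \<longleftrightarrow> is_form n \<Phi> \<and>
     (\<forall>S. \<Phi> S \<noteq> 0 \<longrightarrow> hol_deg S = p \<and> antihol_deg S = q)"

definition zero_form :: cform where "zero_form = (\<lambda>S. 0)"
definition one_form :: cform where "one_form = (\<lambda>S. if S = {} then 1 else 0)"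

text \<open>Sign of e_A wedge e_B relative to e_(A union B), for disjoint A, B.\<close>
definition shuffle_sign :: "nat set \<Rightarrow> nat set \<Rightarrow> complex" where
  "shuffle_sign A B = (-1) ^ card {(x,y). x \<in> A \<and> y \<in> B \<and> y < x}"

definition wedge :: "cform \<Rightarrow> cform \<Rightarrow> cform" where
  "wedge \<Phi> \<Psi> = (\<lambda>S. \<Sum>A\<in>Pow S. shuffle_sign A (S - A) * \<Phi> A * \<Psi> (S - A))"

fun wedge_seq :: "(nat \<Rightarrow> cform) \<Rightarrow> nat \<Rightarrow> cform" where
  "wedge_seq a 0 = one_form"
| "wedge_seq a (Suc k) = wedge (wedge_seq a k) (a (Suc k))"

definition wedge_pow :: "cform \<Rightarrow> nat \<Rightarrow> cform" where
  "wedge_pow \<alpha> k = wedge_seq (\<lambda>_. \<alpha>) k"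

definition gswap :: "nat \<Rightarrow> nat" where
  "gswap x = (if even x then x + 1 else x - 1)"

definition conj_form :: "cform \<Rightarrow> cform" where
  "conj_form \<Phi> = (\<lambda>S. let A = gswap ` S in
      (-1) ^ card {(x,y). x \<in> A \<and> y \<in> A \<and> x < y \<and> gswap y < gswap x} * cnj (\<Phi> A))"

definition coef2 :: "cform \<Rightarrow> nat \<Rightarrow> nat \<Rightarrow> complex" where
  "coef2 \<alpha> x y = (if x < y then \<alpha> {x,y} else if y < x then - \<alpha> {x,y} else 0)"

text \<open>For a (1,1)-form alpha = i * sum_{j,k} h_jk dz_j wedge d(bar z)_k, the matrix h.\<close>
definition herm_mat :: "cform \<Rightarrow> nat \<Rightarrow> nat \<Rightarrow> complex" where
  "herm_mat \<alpha> j k = - \<i> * coef2 \<alpha> (2*j) (2*k+1)"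

definition herm_quad :: "nat \<Rightarrow> cform \<Rightarrow> (nat \<Rightarrow> complex) \<Rightarrow> complex" where
  "herm_quad n \<alpha> v = (\<Sum>j<n. \<Sum>k<n. herm_mat \<alpha> j k * v j * cnj (v k))"

definition real_11_form :: "nat \<Rightarrow> cform \<Rightarrow> bool" where
  "real_11_form n \<alpha> \<longleftrightarrow> is_pq_form n 1 1 \<alpha> \<and> conj_form \<alpha> = \<alpha>"

definition semipositive :: "nat \<Rightarrow> cform \<Rightarrow> bool" where
  "semipositive n \<alpha> \<longleftrightarrow> (\<forall>v. Im (herm_quad n \<alpha> v) = 0 \<and> Re (herm_quad n \<alpha> v) \<ge> 0)"

definition kaehler_form :: "nat \<Rightarrow> cform \<Rightarrow> bool" where
  "kaehler_form n \<omega> \<longleftrightarrow> real_11_form n \<omega> \<and>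
     (\<forall>v. Im (herm_quad n \<omega> v) = 0 \<and>
          ((\<exists>j<n. v j \<noteq> 0) \<longrightarrow> Re (herm_quad n \<omega> v) > 0))"

text \<open>Standard volume form (i/2)^n dz_1 wedge d(bar z)_1 wedge ... wedge dz_n wedge d(bar z)_n
  = dx_1 wedge dy_1 wedge ... wedge dx_n wedge dy_n; the ratio Theta / Gamma of top-degree forms.\<close>
definition std_vol :: "nat \<Rightarrow> cform" where
  "std_vol n = (\<lambda>S. if S = {..<2*n} then (\<i>/2)^n else 0)"

definition top_ratio :: "nat \<Rightarrow> cform \<Rightarrow> cform \<Rightarrow> complex" where
  "top_ratio n \<Theta> \<Gamma> = \<Theta> {..<2*n} / \<Gamma> {..<2*n}"

definition top_positive :: "nat \<Rightarrow> cform \<Rightarrow> bool" where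
  "top_positive n \<Theta> \<longleftrightarrow> is_form n \<Theta> \<and> (\<forall>S. \<Theta> S \<noteq> 0 \<longrightarrow> S = {..<2*n}) \<and>
     Im (top_ratio n \<Theta> (std_vol n)) = 0 \<and> Re (top_ratio n \<Theta> (std_vol n)) > 0"

definition m_positive :: "nat \<Rightarrow> nat \<Rightarrow> cform \<Rightarrow> cform \<Rightarrow> bool" where
  "m_positive n m \<omega> \<alpha> \<longleftrightarrow>
     (\<forall>k\<in>{1..m}. top_positive n (wedge (wedge_pow \<alpha> k) (wedge_pow \<omega> (n - k))))"

end

theory Submission
  imports Defs "HOL-Analysis.Topology_Euclidean_Space"
begin

text \<open>Following Timorin, the theorem is proved by induction on the dimension, simultaneously for all
  bidegrees. A semipositive form is \<open>m\<close>-positive iff its rank is at least \<open>m\<close>, and restriction to a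
  hyperplane lowers dimension and \<open>m\<close> by one. In dimension \<open>n - 1\<close> the Hodge--Riemann relations imply
  hard Lefschetz in dimension \<open>n\<close>: diagonalise one factor \<open>a = \<Sum> \<lambda>\<^sub>j \<i> dz\<^sub>j \<and> d\<bar>z\<^sub>j\<close> of \<open>\<Omega> = W \<and> a\<close>; if
  \<open>\<Omega> \<and> \<Phi> = 0\<close> then \<open>\<Phi>\<close> is primitive on each hyperplane \<open>z\<^sub>j = 0\<close>, and the weighted sum of
  the Hodge--Riemann forms of these restrictions is \<open>\<Omega> \<and> \<Phi> \<and> \<bar>\<Phi> = 0\<close>, so they all vanish. Hard Lefschetz
  shows that the Hodge--Riemann form stays nondegenerate on primitive forms while all factors are deformed
  linearly to the standard form, so positivity can be checked there; in that case the form is a positive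
  multiple of \<open>\<Sum>\<^sub>S \<bar>\<Phi>\<^sub>S\<bar>\<^sup>2\<close> by inclusion--exclusion.

  Forms are never restricted explicitly: for an index set \<open>I\<close> only the coefficients at subsets of
  \<open>gens I\<close> are considered, and these form an algebra on their own.\<close>

subsection \<open>The wedge product\<close>

text \<open>The primitive space itself moves during the deformation, since \<open>b\<close> is
  deformed together with the factors of \<Omega>; so nondegeneracy alone does not carry positivity
  from one time to another. What ties the spaces together is the Lefschetz decomposition: \<Omega>
  \<and> b \<and> b is again a product to which hard Lefschetz applies, in bidegree (p-1,q-1),
  because lowering p + q by two makes room for two more factors of rank m. Hence every (p,q)-form is
  a primitive form plus some b \<and> \<Psi>, and a form primitive at one time is a limit of forms
  primitive at nearby times. Positivity at later times thus leaves semidefiniteness at the limit,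
  where a null vector would be orthogonal to all primitive forms and, by its own primitivity, to all
  b \<and> \<Psi>, against hard Lefschetz for \<Omega>.

  The rank matters as follows: diagonalised, a factor has at least m > p + q positive coefficients,
  while a coefficient of a (p,q)-form involves at most p + q indices. Some hyperplane of positive
  weight therefore detects it.\<close>

definition sg :: "nat \<Rightarrow> nat \<Rightarrow> complex" where
  "sg x y = (if y < x then -1 else 1)"

text \<open>Written as a product over \<open>A \<times> B\<close> instead of an inversion count, the
  sign is visibly multiplicative in each argument; the sign rules below all come from this.\<close>

lemma shuffle_sign_prod:
  assumes "finite A" "finite B"
  shows "shuffle_sign A B = (\<Prod>x\<in>A. \<Prod>y\<in>B. sg x y)"
proof -
  have "(\<Prod>x\<in>A. \<Prod>y\<in>B. sg x y) = (\<Prod>z\<in>A\<times>B. sg (fst z) (snd z))"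
    by (simp add: prod.cartesian_product case_prod_beta)
  also have "\<dots> = (\<Prod>z\<in>{z\<in>A\<times>B. snd z < fst z}. -1)"
    unfolding sg_def by (subst prod.inter_filter[symmetric]) (use assms in auto)
  also have "\<dots> = (-1) ^ card {z\<in>A\<times>B. snd z < fst z}"
    by simp
  also have "{z\<in>A\<times>B. snd z < fst z} = {(x,y). x \<in> A \<and> y \<in> B \<and> y < x}"
    by auto
  finally show ?thesis by (simp add: shuffle_sign_def)
qed

lemma shuffle_sign_empty [simp]: "shuffle_sign {} B = 1" "shuffle_sign A {} = 1"
  by (simp_all add: shuffle_sign_def)

lemma shuffle_sign_sing: "shuffle_sign {x} {y} = sg x y"
  by (simp add: shuffle_sign_prod)

lemma shuffle_sign_Un_left:
  assumes "finite A" "finite B" "finite C" "A \<inter> B = {}"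
  shows "shuffle_sign (A \<union> B) C = shuffle_sign A C * shuffle_sign B C"
  using assms by (simp add: shuffle_sign_prod prod.union_disjoint)

lemma shuffle_sign_Un_right:
  assumes "finite A" "finite B" "finite C" "B \<inter> C = {}"
  shows "shuffle_sign A (B \<union> C) = shuffle_sign A B * shuffle_sign A C"
  using assms by (simp add: shuffle_sign_prod prod.union_disjoint prod.distrib)

lemma shuffle_sign_square [simp]: "shuffle_sign A B * shuffle_sign A B = 1"
  by (simp add: shuffle_sign_def flip: power_mult_distrib)

lemma shuffle_sign_square' [simp]: "shuffle_sign A B * (shuffle_sign A B * z) = z"
  by (simp flip: mult.assoc)

text \<open>For disjoint sets every pair is an inversion in exactly one of the two orders, so each
  of the \<open>card A * card B\<close> factors changes sign.\<close>

lemma shuffle_sign_swap: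
  assumes "finite A" "finite B" "A \<inter> B = {}"
  shows "shuffle_sign B A = (-1) ^ (card A * card B) * shuffle_sign A B"
proof -
  have sw: "sg y x = - sg x y" if "x \<in> A" "y \<in> B" for x y
    using that assms(3) by (auto simp: sg_def)
  have "shuffle_sign B A = (\<Prod>x\<in>A. \<Prod>y\<in>B. sg y x)"
    using assms by (simp add: shuffle_sign_prod) (rule prod.swap)
  also have "\<dots> = (\<Prod>x\<in>A. \<Prod>y\<in>B. - sg x y)"
    by (intro prod.cong refl) (use sw in auto)
  also have "\<dots> = (\<Prod>x\<in>A. (-1) ^ card B * (\<Prod>y\<in>B. sg x y))"
    by (simp add: prod_uminus)
  also have "\<dots> = (-1) ^ (card A * card B) * shuffle_sign A B"
    using assms by (simp add: shuffle_sign_prod prod.distrib flip: power_mult)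
      (simp add: mult.commute)
  finally show ?thesis .
qed

lemma wedge_infinite: "infinite S \<Longrightarrow> wedge a b S = 0"
  by (simp add: wedge_def finite_Pow_iff)

text \<open>Both sides are sums over ordered partitions of \<open>S\<close> into three blocks,
  indexed by \<open>(D, A)\<close> or by \<open>(A, D - A)\<close>; in either case the sign is the
  product of the shuffle signs of the three pairs of blocks.\<close>

lemma wedge_assoc: "wedge (wedge a b) c = wedge a (wedge b c)"
proof
  fix S :: "nat set"
  show "wedge (wedge a b) c S = wedge a (wedge b c) S"
  proof (cases "finite S")
    case True
    have fin: "finite X" if "X \<subseteq> S" for X using that True finite_subset by blast
    define L where "L = (\<lambda>(D,A). shuffle_sign D (S - D) * (shuffle_sign A (D - A) * a A * b (D - A)) * c (S - D))"
    define R where "R = (\<lambda>(A,B). shuffle_sign A (S - A) * a A *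
       (shuffle_sign B (S - A - B) * b B * c (S - A - B)))"
    have "wedge (wedge a b) c S = (\<Sum>D\<in>Pow S. \<Sum>A\<in>Pow D. L (D,A))"
      unfolding wedge_def L_def by (simp add: sum_distrib_left sum_distrib_right mult.assoc)
    also have "\<dots> = sum L (Sigma (Pow S) Pow)"
      by (subst sum.Sigma) (use True fin in auto)
    also have "\<dots> = sum R (Sigma (Pow S) (\<lambda>A. Pow (S - A)))"
    proof (rule sum.reindex_bij_witness[of _ "\<lambda>(A,B). (A \<union> B, A)" "\<lambda>(D,A). (A, D - A)"])
      fix z assume "z \<in> Sigma (Pow S) Pow"
      then obtain D A where z: "z = (D,A)" "D \<subseteq> S" "A \<subseteq> D" by auto
      have e1: "S - A - (D - A) = S - D" using z by auto
      have e2: "S - A = (D - A) \<union> (S - D)" using z by auto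
      have e3: "D = A \<union> (D - A)" using z by auto
      have "shuffle_sign D (S - D) = shuffle_sign A (S - D) * shuffle_sign (D - A) (S - D)"
        by (subst e3, rule shuffle_sign_Un_left) (use z in \<open>auto intro!: fin\<close>)
      moreover have "shuffle_sign A (S - A) = shuffle_sign A (D - A) * shuffle_sign A (S - D)"
        by (subst e2, rule shuffle_sign_Un_right) (use z in \<open>auto intro!: fin\<close>)
      ultimately show "R (case z of (D,A) \<Rightarrow> (A, D - A)) = L z"
        unfolding L_def R_def z by (simp add: e1 mult_ac)
    qed auto
    also have "\<dots> = (\<Sum>A\<in>Pow S. \<Sum>B\<in>Pow (S - A). R (A,B))"
      by (subst sum.Sigma) (use True fin in auto)
    also have "\<dots> = wedge a (wedge b c) S"
      unfolding wedge_def R_def by (simp add: sum_distrib_left mult.assoc)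
    finally show ?thesis .
  qed (simp add: wedge_infinite)
qed

text \<open>Reindexing by complements. No degrees are assumed yet, so the sign stays inside the sum;
  both commutation rules are read off from it.\<close>

lemma wedge_swap_terms:
  assumes "finite S"
  shows "wedge a b S = (\<Sum>A\<in>Pow S. (-1) ^ (card A * card (S - A)) * shuffle_sign A (S - A) * b A * a (S - A))"
  unfolding wedge_def
proof (rule sum.reindex_bij_witness[of _ "\<lambda>A. S - A" "\<lambda>A. S - A"])
  fix A assume "A \<in> Pow S"
  then have A: "A \<subseteq> S" by simp
  have f: "finite A" "finite (S - A)" using A assms finite_subset by blast+
  have "S - (S - A) = A" using A by auto
  moreover have "shuffle_sign A (S - A) = (-1) ^ (card (S - A) * card A) * shuffle_sign (S - A) A"
    by (rule shuffle_sign_swap) (use f in auto)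
  ultimately show "(-1) ^ (card (S - A) * card (S - (S - A))) * shuffle_sign (S - A) (S - (S - A)) * b (S - A) * a (S - (S - A))
      = shuffle_sign A (S - A) * a A * b (S - A)"
    by simp
qed auto

definition has_deg :: "nat \<Rightarrow> cform \<Rightarrow> bool" where
  "has_deg k a \<longleftrightarrow> (\<forall>S. a S \<noteq> 0 \<longrightarrow> card S = k)"

lemma wedge_graded_comm:
  assumes "has_deg k a" "has_deg l b"
  shows "wedge a b = (\<lambda>S. (-1) ^ (k * l) * wedge b a S)"
proof
  fix S :: "nat set"
  show "wedge a b S = (-1) ^ (k * l) * wedge b a S"
  proof (cases "finite S")
    case True
    have "(-1) ^ (card A * card (S - A)) * shuffle_sign A (S - A) * b A * a (S - A)
       = (-1) ^ (k * l) * (shuffle_sign A (S - A) * b A * a (S - A))" for A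
      using assms by (cases "b A = 0"; cases "a (S - A) = 0") (auto simp: has_deg_def mult.commute)
    then show ?thesis
      unfolding wedge_swap_terms[OF True] wedge_def[of b a] sum_distrib_left by (intro sum.cong refl)
  qed (simp add: wedge_infinite)
qed

text \<open>One even degree makes every sign trivial, so \<open>b\<close> may be
  inhomogeneous.\<close>

lemma wedge_comm_deg2:
  assumes "has_deg 2 a"
  shows "wedge a b = wedge b a"
proof
  fix S :: "nat set"
  show "wedge a b S = wedge b a S"
  proof (cases "finite S")
    case True
    have "(-1) ^ (card A * card (S - A)) * shuffle_sign A (S - A) * b A * a (S - A)
       = shuffle_sign A (S - A) * b A * a (S - A)" for A
      using assms by (cases "a (S - A) = 0") (auto simp: has_deg_def)
    then show ?thesis
      unfolding wedge_swap_terms[OF True] wedge_def[of b a] by (intro sum.cong refl)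
  qed (simp add: wedge_infinite)
qed

lemma wedge_cong:
  assumes "\<And>A. A \<subseteq> S \<Longrightarrow> a A = a' A" "\<And>A. A \<subseteq> S \<Longrightarrow> b A = b' A"
  shows "wedge a b S = wedge a' b' S"
  unfolding wedge_def by (rule sum.cong) (use assms in auto)

lemma wedge_add_left: "wedge (\<lambda>S. a S + b S) c = (\<lambda>S. wedge a c S + wedge b c S)"
  and wedge_add_right: "wedge c (\<lambda>S. a S + b S) = (\<lambda>S. wedge c a S + wedge c b S)"
  and wedge_diff_right: "wedge c (\<lambda>S. a S - b S) = (\<lambda>S. wedge c a S - wedge c b S)"
  and wedge_scale_left: "wedge (\<lambda>S. z * a S) c = (\<lambda>S. z * wedge a c S)"
  and wedge_scale_right: "wedge c (\<lambda>S. z * a S) = (\<lambda>S. z * wedge c a S)"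
  by (auto simp: wedge_def fun_eq_iff algebra_simps sum.distrib sum_subtractf sum_distrib_left
      intro!: sum.cong)

lemma wedge_sum_left: "wedge (\<lambda>S. \<Sum>j\<in>J. a j S) c = (\<lambda>S. \<Sum>j\<in>J. wedge (a j) c S)"
  by (rule ext) (simp add: wedge_def sum_distrib_left sum_distrib_right sum.swap[of _ J])

lemma wedge_zero_left_on:
  assumes "\<And>A. A \<subseteq> S \<Longrightarrow> a A = 0" shows "wedge a b S = 0"
  unfolding wedge_def by (rule sum.neutral) (use assms in auto)

lemma wedge_zero_right_on:
  assumes "\<And>A. A \<subseteq> S \<Longrightarrow> b A = 0" shows "wedge a b S = 0"
  unfolding wedge_def by (rule sum.neutral) (use assms in auto)

text \<open>Coefficient functions live on all sets of naturals, but a wedge product vanishes on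
  infinite ones (\<open>wedge_infinite\<close>); \<open>one_form\<close> is neutral exactly for
  forms that do the same.\<close>

definition fin_form :: "cform \<Rightarrow> bool" where
  "fin_form a \<longleftrightarrow> (\<forall>S. infinite S \<longrightarrow> a S = 0)"

lemma fin_form_wedge [simp]: "fin_form (wedge a b)"
  by (simp add: fin_form_def wedge_infinite)

lemma wedge_one_left: assumes "fin_form a" shows "wedge one_form a = a"
proof
  fix S show "wedge one_form a S = a S"
  proof (cases "finite S")
    case True
    have "wedge one_form a S = (\<Sum>A\<in>Pow S. if A = {} then a S else 0)"
      unfolding wedge_def one_form_def by (rule sum.cong) auto
    then show ?thesis using True by simp
  qed (use assms in \<open>simp add: wedge_infinite fin_form_def\<close>)
qed

lemma wedge_one_right: assumes "fin_form a" shows "wedge a one_form = a"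
proof
  fix S show "wedge a one_form S = a S"
  proof (cases "finite S")
    case True
    have "wedge a one_form S = (\<Sum>A\<in>Pow S. if A = S then a S else 0)"
      unfolding wedge_def one_form_def by (rule sum.cong) auto
    then show ?thesis using True by simp
  qed (use assms in \<open>simp add: wedge_infinite fin_form_def\<close>)
qed

lemma fin_form_one [simp]: "fin_form one_form"
  by (auto simp: fin_form_def one_form_def)

subsection \<open>Bidegree\<close>

text \<open>Unlike \<open>is_pq_form\<close> this mentions no ambient dimension, so the same form
  can be considered over any index set.\<close>

definition has_type :: "nat \<Rightarrow> nat \<Rightarrow> cform \<Rightarrow> bool" where
  "has_type p q a \<longleftrightarrow> (\<forall>S. a S \<noteq> 0 \<longrightarrow> finite S \<and> hol_deg S = p \<and> antihol_deg S = q)"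

lemma card_hol_antihol: "finite S \<Longrightarrow> card S = hol_deg S + antihol_deg S"
  unfolding hol_deg_def antihol_deg_def
  by (subst card_Un_disjoint[symmetric]) (auto intro!: arg_cong[where f = card])

lemma has_type_fin: "has_type p q a \<Longrightarrow> fin_form a"
  by (auto simp: has_type_def fin_form_def)

lemma has_type_deg: "has_type p q a \<Longrightarrow> has_deg (p + q) a"
  by (auto simp: has_type_def has_deg_def card_hol_antihol)

lemma hol_deg_Diff: "finite S \<Longrightarrow> A \<subseteq> S \<Longrightarrow> hol_deg S = hol_deg A + hol_deg (S - A)"
  unfolding hol_deg_def
  by (subst card_Un_disjoint[symmetric])
     (auto intro!: arg_cong[where f = card] elim: finite_subset[rotated])

lemma antihol_deg_Diff: "finite S \<Longrightarrow> A \<subseteq> S \<Longrightarrow> antihol_deg S = antihol_deg A + antihol_deg (S - A)"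
  unfolding antihol_deg_def
  by (subst card_Un_disjoint[symmetric])
     (auto intro!: arg_cong[where f = card] elim: finite_subset[rotated])

lemma wedge_nonzeroE:
  assumes "wedge a b S \<noteq> 0"
  obtains A where "A \<subseteq> S" "a A \<noteq> 0" "b (S - A) \<noteq> 0"
  using assms unfolding wedge_def by (metis (no_types, lifting) PowD mult_eq_0_iff sum.neutral)

lemma has_type_wedge:
  assumes "has_type p q a" "has_type p' q' b"
  shows "has_type (p + p') (q + q') (wedge a b)"
  unfolding has_type_def
proof (intro allI impI)
  fix S assume nz: "wedge a b S \<noteq> 0"
  then have f: "finite S" using wedge_infinite by blast
  from nz obtain A where "A \<subseteq> S" "a A \<noteq> 0" "b (S - A) \<noteq> 0" by (rule wedge_nonzeroE)
  then show "finite S \<and> hol_deg S = p + p' \<and> antihol_deg S = q + q'"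
    using assms f hol_deg_Diff[of S A] antihol_deg_Diff[of S A] by (simp add: has_type_def)
qed

lemma has_type_one: "has_type 0 0 one_form"
  by (auto simp: has_type_def one_form_def hol_deg_def antihol_deg_def)

lemma has_type_lin:
  assumes "has_type p q a" "has_type p q b"
  shows "has_type p q (\<lambda>S. x * a S + y * b S)"
  unfolding has_type_def
proof (intro allI impI)
  fix S assume "x * a S + y * b S \<noteq> 0"
  then have "a S \<noteq> 0 \<or> b S \<noteq> 0" by auto
  then show "finite S \<and> hol_deg S = p \<and> antihol_deg S = q"
    using assms by (auto simp: has_type_def)
qed

lemma wedge_comm11: "has_type 1 1 a \<Longrightarrow> wedge a b = wedge b a"
  by (rule wedge_comm_deg2) (use has_type_deg[of 1 1 a] in \<open>simp add: numeral_2_eq_2\<close>)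

subsection \<open>Conjugation\<close>

lemma gswap_gswap [simp]: "gswap (gswap x) = x"
  by (auto simp: gswap_def)

lemma gswap_eq_iff [simp]: "gswap x = gswap y \<longleftrightarrow> x = y"
  by (metis gswap_gswap)

lemma gswap_neq [simp]: "gswap x \<noteq> x" "x \<noteq> gswap x"
  by (auto simp: gswap_def elim!: oddE)

lemma even_gswap [simp]: "even (gswap x) \<longleftrightarrow> odd x"
  by (auto simp: gswap_def)

lemma gswap_div2 [simp]: "gswap x div 2 = x div 2"
  by (auto simp: gswap_def elim!: oddE)

lemma gswap_less: "x \<noteq> y \<Longrightarrow> y \<noteq> gswap x \<Longrightarrow> gswap y < gswap x \<longleftrightarrow> y < x"
  by (auto simp: gswap_def elim!: oddE evenE)

lemma inj_gswap [simp]: "inj_on gswap A"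
  by (auto simp: inj_on_def)

lemma gswap_image_image [simp]: "gswap ` gswap ` A = A"
  by (auto simp: image_image)

lemma mem_gswap_image: "x \<in> gswap ` A \<longleftrightarrow> gswap x \<in> A"
  by (metis gswap_gswap image_iff)

definition npairs :: "nat set \<Rightarrow> nat" where
  "npairs A = card {x\<in>A. even x \<and> gswap x \<in> A}"

lemma npairs_gswap [simp]: "npairs (gswap ` A) = npairs A"
  unfolding npairs_def
  by (rule arg_cong[where f = card]) (auto simp: mem_gswap_image)

text \<open>Exchanging \<open>2*j\<close> and \<open>2*j+1\<close> alters the order only within such
  a pair, so the inversions in \<open>conj_form\<close> correspond to the even members of complete
  pairs.\<close>

lemma conj_form_altdef: "conj_form \<Phi> S = (-1) ^ npairs S * cnj (\<Phi> (gswap ` S))"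
proof -
  define A where "A = gswap ` S"
  have "{(x,y). x \<in> A \<and> y \<in> A \<and> x < y \<and> gswap y < gswap x}
      = (\<lambda>x. (x, gswap x)) ` {x\<in>A. even x \<and> gswap x \<in> A}"
  proof (intro equalityI subsetI)
    fix z assume "z \<in> {(x,y). x \<in> A \<and> y \<in> A \<and> x < y \<and> gswap y < gswap x}"
    then obtain x y where z: "z = (x,y)" "x \<in> A" "y \<in> A" "x < y" "gswap y < gswap x" by auto
    have y: "y = gswap x" using gswap_less[of x y] z by auto
    moreover have "even x" using y z by (auto simp: gswap_def split: if_splits)
    ultimately show "z \<in> (\<lambda>x. (x, gswap x)) ` {x\<in>A. even x \<and> gswap x \<in> A}" using z by auto
  qed (auto simp: gswap_def)
  then have "card {(x,y). x \<in> A \<and> y \<in> A \<and> x < y \<and> gswap y < gswap x} = npairs A"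
    unfolding npairs_def by (simp add: card_image inj_on_def)
  then show ?thesis
    by (simp add: conj_form_def A_def[symmetric] Let_def) (simp add: A_def)
qed

lemma conj_conj [simp]: "conj_form (conj_form a) = a"
  by (rule ext) (simp add: conj_form_altdef flip: power_mult_distrib mult.assoc)

text \<open>A pair split between \<open>A\<close> and \<open>B\<close> has its even member in
  \<open>A\<close> or in \<open>B\<close>; in the second case its odd member lies in
  \<open>A\<close>. So split pairs are counted by their members in \<open>A\<close>, of either
  parity.\<close>

lemma npairs_Un:
  assumes "finite A" "finite B" "A \<inter> B = {}"
  shows "npairs (A \<union> B) = npairs A + npairs B + card {x\<in>A. gswap x \<in> B}"
proof -
  have 1: "{x\<in>A \<union> B. even x \<and> gswap x \<in> A \<union> B} =
     ({x\<in>A. even x \<and> gswap x \<in> A} \<union> {x\<in>B. even x \<and> gswap x \<in> B})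
     \<union> ({x\<in>A. even x \<and> gswap x \<in> B} \<union> {x\<in>B. even x \<and> gswap x \<in> A})" by auto
  have "card {x\<in>B. even x \<and> gswap x \<in> A} = card {x\<in>A. odd x \<and> gswap x \<in> B}"
    by (rule bij_betw_same_card[of gswap], rule bij_betw_byWitness[of _ gswap]) auto
  moreover have "card {x\<in>A. gswap x \<in> B} = card {x\<in>A. even x \<and> gswap x \<in> B} + card {x\<in>A. odd x \<and> gswap x \<in> B}"
    by (subst card_Un_disjoint[symmetric]) (use assms in \<open>auto intro!: arg_cong[where f = card]\<close>)
  moreover have "npairs (A \<union> B) = npairs A + npairs B + (card {x\<in>A. even x \<and> gswap x \<in> B} + card {x\<in>B. even x \<and> gswap x \<in> A})"
    unfolding npairs_def 1 using assms
    by (subst card_Un_disjoint, simp, simp, blast, subst card_Un_disjoint, simp, simp, blast,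
        subst card_Un_disjoint) auto
  ultimately show ?thesis by simp
qed

text \<open>Only conjugate generators change their relative order. The resulting sign is the one by
  which \<open>npairs\<close> fails to be additive in \<open>npairs_Un\<close>; their cancellation
  makes conjugation multiplicative.\<close>

lemma shuffle_sign_gswap:
  assumes "finite A" "finite B" "A \<inter> B = {}"
  shows "shuffle_sign (gswap ` A) (gswap ` B) = (-1) ^ card {x\<in>A. gswap x \<in> B} * shuffle_sign A B"
proof -
  have sw: "sg (gswap x) (gswap y) = sg x y * (if y = gswap x then -1 else 1)" if "x \<in> A" "y \<in> B" for x y
  proof -
    have "x \<noteq> y" using that assms by auto
    then show ?thesis
      using gswap_less[of x y] by (cases "y = gswap x") (auto simp: sg_def)
  qed
  have "shuffle_sign (gswap ` A) (gswap ` B) = (\<Prod>x\<in>A. \<Prod>y\<in>B. sg (gswap x) (gswap y))"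
    using assms by (simp add: shuffle_sign_prod prod.reindex)
  also have "\<dots> = (\<Prod>x\<in>A. \<Prod>y\<in>B. sg x y * (if y = gswap x then -1 else 1))"
    by (intro prod.cong refl) (use sw in auto)
  also have "\<dots> = shuffle_sign A B * (\<Prod>x\<in>A. \<Prod>y\<in>B. (if y = gswap x then -1 else 1))"
    using assms by (simp add: shuffle_sign_prod prod.distrib)
  also have "(\<Prod>x\<in>A. \<Prod>y\<in>B. (if y = gswap x then -1 else 1 :: complex)) = (\<Prod>x\<in>A. if gswap x \<in> B then -1 else 1)"
    using assms by (simp add: prod.delta)
  also have "\<dots> = (-1) ^ card {x\<in>A. gswap x \<in> B}"
    by (subst prod.inter_filter[symmetric]) (use assms in auto)
  finally show ?thesis by simp
qed

lemma cnj_shuffle_sign [simp]: "cnj (shuffle_sign A B) = shuffle_sign A B"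
  by (simp add: shuffle_sign_def)

lemma conj_wedge: "conj_form (wedge a b) = wedge (conj_form a) (conj_form b)"
proof
  fix S :: "nat set"
  show "conj_form (wedge a b) S = wedge (conj_form a) (conj_form b) S"
  proof (cases "finite S")
    case True
    have "conj_form (wedge a b) S = (\<Sum>A\<in>Pow (gswap ` S). (-1) ^ npairs S *
        (shuffle_sign A (gswap ` S - A) * cnj (a A) * cnj (b (gswap ` S - A))))"
      by (simp add: conj_form_altdef wedge_def sum_distrib_left)
    also have "\<dots> = wedge (conj_form a) (conj_form b) S"
      unfolding wedge_def
    proof (rule sum.reindex_bij_witness[of _ "\<lambda>A. gswap ` A" "\<lambda>A. gswap ` A"])
      fix A assume "A \<in> Pow (gswap ` S)"
      then have A: "A \<subseteq> gswap ` S" by simp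
      define D where "D = gswap ` A"
      have DA: "A = gswap ` D" by (simp add: D_def)
      have DS: "D \<subseteq> S" using A by (auto simp: D_def)
      have fD: "finite D" "finite (S - D)" using DS True finite_subset by blast+
      have e1: "gswap ` S - A = gswap ` (S - D)" by (auto simp: DA mem_gswap_image)
      have "D \<union> (S - D) = S" using DS by auto
      then have "npairs S = npairs D + npairs (S - D) + card {x\<in>D. gswap x \<in> S - D}"
        using npairs_Un[of D "S - D"] fD by auto
      moreover have "shuffle_sign A (gswap ` S - A) = (-1) ^ card {x\<in>D. gswap x \<in> S - D} * shuffle_sign D (S - D)"
        unfolding e1 unfolding DA by (rule shuffle_sign_gswap) (use fD in auto)
      ultimately show "shuffle_sign (gswap ` A) (S - gswap ` A) * conj_form a (gswap ` A) * conj_form b (S - gswap ` A) =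
         (-1) ^ npairs S * (shuffle_sign A (gswap ` S - A) * cnj (a A) * cnj (b (gswap ` S - A)))"
        unfolding D_def[symmetric] conj_form_altdef DA[symmetric] e1[symmetric]
        by (simp add: power_add)
    qed auto
    finally show ?thesis .
  qed (simp add: wedge_infinite conj_form_altdef finite_image_iff)
qed

lemma conj_lin: "conj_form (\<lambda>S. x * a S + y * b S) = (\<lambda>S. cnj x * conj_form a S + cnj y * conj_form b S)"
  by (rule ext) (simp add: conj_form_altdef algebra_simps)

lemma conj_one [simp]: "conj_form one_form = one_form"
  by (rule ext) (simp add: conj_form_altdef one_form_def npairs_def)

lemma hol_deg_gswap [simp]: "hol_deg (gswap ` S) = antihol_deg S"
  unfolding hol_deg_def antihol_deg_def
  by (rule bij_betw_same_card[of gswap], rule bij_betw_byWitness[of _ gswap]) auto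

lemma antihol_deg_gswap [simp]: "antihol_deg (gswap ` S) = hol_deg S"
  unfolding hol_deg_def antihol_deg_def
  by (rule bij_betw_same_card[of gswap], rule bij_betw_byWitness[of _ gswap]) auto

lemma has_type_conj: "has_type p q a \<Longrightarrow> has_type q p (conj_form a)"
  by (auto simp: has_type_def conj_form_altdef finite_image_iff)

section \<open>Complete pairs of conjugate generators\<close>

definition gens :: "nat set \<Rightarrow> nat set" where
  "gens K = {x. x div 2 \<in> K}"

lemma gens_eq: "gens K = (\<lambda>j. 2 * j) ` K \<union> (\<lambda>j. 2 * j + 1) ` K"
proof (intro equalityI subsetI)
  fix x assume "x \<in> gens K"
  moreover have "x = 2 * (x div 2) \<or> x = 2 * (x div 2) + 1" by presburger
  ultimately show "x \<in> (\<lambda>j. 2 * j) ` K \<union> (\<lambda>j. 2 * j + 1) ` K" by (auto simp: gens_def)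
qed (auto simp: gens_def)

lemma finite_gens [simp]: "finite K \<Longrightarrow> finite (gens K)"
  by (simp add: gens_eq)

lemma gens_sing: "gens {j} = {2 * j, 2 * j + 1}"
  by (auto simp: gens_eq)

lemma gswap_gens [simp]: "gswap ` gens K = gens K"
  by (auto simp: gens_def mem_gswap_image)

lemma hol_deg_gens: "hol_deg (gens K) = card K"
  unfolding hol_deg_def
  by (rule bij_betw_same_card[of "\<lambda>x. x div 2"], rule bij_betw_byWitness[of _ "\<lambda>j. 2 * j"]) (auto simp: gens_def)

lemma antihol_deg_gens: "antihol_deg (gens K) = card K"
  using hol_deg_gswap[of "gens K"] by (simp add: hol_deg_gens)

lemma npairs_gens: "npairs (gens K) = card K"
proof -
  have "{x\<in>gens K. even x \<and> gswap x \<in> gens K} = {x\<in>gens K. even x}" by (auto simp: gens_def)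
  then show ?thesis using hol_deg_gens[of K] by (simp add: npairs_def hol_deg_def)
qed

lemma gens_mono: "J \<subseteq> K \<Longrightarrow> gens J \<subseteq> gens K" by (auto simp: gens_def)
lemma gens_Diff: "gens (J - K) = gens J - gens K" by (auto simp: gens_def)
lemma gens_Un: "gens (J \<union> K) = gens J \<union> gens K" by (auto simp: gens_def)
lemma gens_subset_iff: "gens J \<subseteq> gens K \<longleftrightarrow> J \<subseteq> K"
proof
  assume *: "gens J \<subseteq> gens K"
  show "J \<subseteq> K"
  proof
    fix j assume "j \<in> J"
    then have "2 * j \<in> gens J" by (simp add: gens_def)
    with * have "2 * j \<in> gens K" by blast
    then show "j \<in> K" by (simp add: gens_def)
  qed
qed (rule gens_mono)
lemma gens_inject [simp]: "gens J = gens K \<longleftrightarrow> J = K"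
  using gens_subset_iff by (metis subset_antisym order_refl)

text \<open>A generator outside the pair lies on the same side of \<open>2*j\<close> and
  \<open>2*j+1\<close>, so the two signs agree and cancel.\<close>

lemma shuffle_sign_gens_left:
  assumes "finite B" "gens {j} \<inter> B = {}"
  shows "shuffle_sign (gens {j}) B = 1"
proof -
  have "sg (2 * j) y * sg (2 * j + 1) y = 1" if "y \<in> B" for y
  proof -
    have "y \<noteq> 2 * j" using that assms by (auto simp: gens_sing)
    then show ?thesis by (auto simp: sg_def)
  qed
  then have "(\<Prod>y\<in>B. sg (2 * j) y) * (\<Prod>y\<in>B. sg (2 * j + 1) y) = 1"
    by (simp flip: prod.distrib)
  then show ?thesis
    using assms by (simp add: shuffle_sign_prod gens_sing)
qed

text \<open>Multiplying \<open>shuffle_sign (gens I - U) U\<close> by the sign of all inversions inside \<open>U\<close> gives a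
  product over \<open>gens I \<times> U\<close>, in which all indices but that of \<open>y \<in> U\<close> contribute in pairs.\<close>

lemma shuffle_sign_compl:
  assumes "finite I" "U \<subseteq> gens I"
  shows "shuffle_sign (gens I - U) U = (-1) ^ (hol_deg U + (card U choose 2))"
proof -
  have fU: "finite U" and fD: "finite (gens I - U)" using assms finite_gens finite_subset by blast+
  \<comment> \<open>Equal elements form no inversion for \<open>sg\<close>, so every unordered pair
    of distinct elements counts exactly once.\<close>
  have UU: "shuffle_sign V V = (-1) ^ (card V choose 2)" if "finite V" for V
    using that
  proof (induction V rule: finite_linorder_max_induct)
    case (insert b V)
    have nb: "b \<notin> V" using insert by auto
    have 1: "(\<Prod>y\<in>V. sg b y) = (-1) ^ card V"
      using insert by (simp add: sg_def)
    have "(\<Prod>x\<in>V. sg x b) = 1" by (rule prod.neutral) (use insert in \<open>auto simp: sg_def\<close>)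
    then have "shuffle_sign (insert b V) (insert b V) = (-1) ^ card V * shuffle_sign V V"
      using insert nb by (simp add: shuffle_sign_prod prod.distrib 1) (simp add: sg_def)
    then show ?case using insert nb
      by (simp add: power_add numeral_2_eq_2)
  qed (simp add: numeral_2_eq_2)
  have row: "(\<Prod>x\<in>gens I. sg x y) = (if even y then -1 else 1)" if "y \<in> U" for y
  proof -
    have y: "y div 2 \<in> I" using that assms by (auto simp: gens_def)
    have "(\<Prod>x\<in>gens I. sg x y) = (\<Prod>x\<in>(\<lambda>j. 2 * j) ` I. sg x y) * (\<Prod>x\<in>(\<lambda>j. 2 * j + 1) ` I. sg x y)"
      unfolding gens_eq by (rule prod.union_disjoint) (use assms in \<open>auto, presburger\<close>)
    also have "\<dots> = (\<Prod>j\<in>I. sg (2 * j) y) * (\<Prod>j\<in>I. sg (2 * j + 1) y)"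
      by (simp add: prod.reindex inj_on_def)
    also have "\<dots> = (\<Prod>j\<in>I. sg (2 * j) y * sg (2 * j + 1) y)"
      by (simp add: prod.distrib)
    \<comment> \<open>In its own pair an even \<open>y\<close> has one larger element and an odd
      \<open>y\<close> has none; this is where \<open>hol_deg U\<close> comes from.\<close>
    also have "\<dots> = (\<Prod>j\<in>I. if j = y div 2 then (if even y then -1 else 1) else 1)"
    proof (rule prod.cong[OF refl])
      fix j
      show "sg (2 * j) y * sg (2 * j + 1) y = (if j = y div 2 then (if even y then -1 else 1) else 1)"
      proof (cases "j = y div 2")
        case True
        then show ?thesis by (cases "even y") (auto simp: sg_def elim!: evenE oddE)
      next
        case False
        then have "y < 2 * j \<longleftrightarrow> y < 2 * j + 1" by (auto elim!: evenE oddE)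
        then show ?thesis using False by (simp add: sg_def)
      qed
    qed
    also have "\<dots> = (if even y then -1 else 1)"
      using y assms by (simp add: prod.delta)
    finally show ?thesis .
  qed
  have "shuffle_sign (gens I) U = (\<Prod>y\<in>U. \<Prod>x\<in>gens I. sg x y)"
    using assms fU by (simp add: shuffle_sign_prod) (rule prod.swap)
  also have "\<dots> = (\<Prod>y\<in>U. if even y then -1 else 1)"
    by (rule prod.cong) (use row in auto)
  also have "\<dots> = (-1) ^ hol_deg U"
    unfolding hol_deg_def by (subst prod.inter_filter[symmetric]) (use fU in auto)
  finally have tot: "shuffle_sign (gens I) U = (-1) ^ hol_deg U" .
  have "gens I = (gens I - U) \<union> U" using assms by auto
  then have "shuffle_sign (gens I) U = shuffle_sign (gens I - U) U * shuffle_sign U U"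
    using shuffle_sign_Un_left[of "gens I - U" U U] fU fD by auto
  with tot UU[OF fU] have "shuffle_sign (gens I - U) U * (-1) ^ (card U choose 2) = (-1) ^ hol_deg U"
    by simp
  then have "(-1) ^ hol_deg U * (-1) ^ (card U choose 2)
      = shuffle_sign (gens I - U) U * ((-1) ^ (card U choose 2) * (-1) ^ (card U choose 2))"
    by (metis mult.assoc)
  also have "(-1) ^ (card U choose 2) * (-1) ^ (card U choose 2) = (1 :: complex)"
    by (simp flip: power_mult_distrib)
  finally show ?thesis by (simp add: power_add)
qed

subsection \<open>Elementary changes of coordinates\<close>

text \<open>The even derivation \<open>e\<^sub>y \<and> \<iota>\<^sub>x\<close>, which replaces the generator \<open>x\<close> by \<open>y\<close>.\<close>

definition dv :: "nat \<Rightarrow> nat \<Rightarrow> cform \<Rightarrow> cform" where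
  "dv x y a = (\<lambda>S. if y \<in> S \<and> x \<notin> S
     then shuffle_sign {x} (S - {y}) * shuffle_sign {y} (S - {y}) * a (insert x (S - {y})) else 0)"

lemma sum_Pow_insert:
  assumes "finite R" "x \<notin> R"
  shows "sum f (Pow (insert x R)) = (\<Sum>B\<in>Pow R. f B + f (insert x B))"
proof -
  have "sum f (Pow (insert x R)) = sum f (Pow R) + sum f (insert x ` Pow R)"
    unfolding Pow_insert by (rule sum.union_disjoint) (use assms in auto)
  also have "sum f (insert x ` Pow R) = (\<Sum>B\<in>Pow R. f (insert x B))"
    by (rule sum.reindex[unfolded o_def]) (use assms in \<open>auto simp: inj_on_def\<close>)
  finally show ?thesis by (simp add: sum.distrib)
qed

lemma shuffle_sign_insert_left:
  assumes "finite A" "finite C" "x \<notin> A"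
  shows "shuffle_sign (insert x A) C = shuffle_sign {x} C * shuffle_sign A C"
  using shuffle_sign_Un_left[of "{x}" A C] assms by simp

lemma shuffle_sign_insert_right:
  assumes "finite A" "finite C" "x \<notin> C"
  shows "shuffle_sign A (insert x C) = shuffle_sign A {x} * shuffle_sign A C"
  using shuffle_sign_Un_right[of A "{x}" C] assms by simp

text \<open>The Leibniz rule. If \<open>S\<close> contains \<open>y\<close> but not
  \<open>x\<close>, the two summands record which factor receives \<open>y\<close>. If
  \<open>S\<close> contains both, the left side is zero by definition and the summands on the right
  must cancel.\<close>

lemma dv_wedge:
  assumes xy: "x \<noteq> y"
  shows "dv x y (wedge a b) = (\<lambda>S. wedge (dv x y a) b S + wedge a (dv x y b) S)"
proof
  fix S :: "nat set"
  consider "infinite S" | "finite S" "y \<notin> S" | "finite S" "y \<in> S" "x \<notin> S" | "finite S" "y \<in> S" "x \<in> S"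
    by blast
  then show "dv x y (wedge a b) S = wedge (dv x y a) b S + wedge a (dv x y b) S"
  proof cases
    case 1
    then show ?thesis by (simp add: wedge_infinite dv_def)
  next
    case 2
    have "wedge (dv x y a) b S = 0" by (rule wedge_zero_left_on) (use 2 in \<open>auto simp: dv_def\<close>)
    moreover have "wedge a (dv x y b) S = 0" by (rule wedge_zero_right_on) (use 2 in \<open>auto simp: dv_def\<close>)
    ultimately show ?thesis using 2 by (simp add: dv_def)
  next
    case 3
    define R where "R = S - {y}"
    have S: "S = insert y R" and R: "finite R" "y \<notin> R" "x \<notin> R" using 3 by (auto simp: R_def)
    have SR: "S - {y} = R" by (simp add: R_def)
    have PS: "sum f (Pow S) = (\<Sum>B\<in>Pow R. f B + f (insert y B))" for f :: "nat set \<Rightarrow> complex"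
      using sum_Pow_insert[of R y f] R by (simp add: S)
    have "dv x y (wedge a b) S = (\<Sum>B\<in>Pow R. shuffle_sign {x} R * shuffle_sign {y} R *
         (shuffle_sign B (insert x R - B) * a B * b (insert x R - B)
          + shuffle_sign (insert x B) (insert x R - insert x B) * a (insert x B) * b (insert x R - insert x B)))"
      unfolding dv_def SR using 3 R by (simp add: wedge_def sum_Pow_insert sum_distrib_left)
    also have "\<dots> = (\<Sum>B\<in>Pow R. shuffle_sign (insert y B) (S - insert y B) * dv x y a (insert y B) * b (S - insert y B)
          + shuffle_sign B (S - B) * a B * dv x y b (S - B))"
    proof (rule sum.cong[OF refl])
      fix B assume "B \<in> Pow R"
      then have B: "B \<subseteq> R" by simp
      define C where "C = R - B"
      have RBC: "R = B \<union> C" "B \<inter> C = {}" "finite B" "finite C" "x \<notin> B" "x \<notin> C" "y \<notin> B" "y \<notin> C"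
        using B R finite_subset by (auto simp: C_def)
      have e: "insert x R - B = insert x C" "insert x R - insert x B = C" "S - insert y B = C" "S - B = insert y C"
        using RBC xy by (auto simp: S)
      have d: "dv x y a (insert y B) = shuffle_sign {x} B * shuffle_sign {y} B * a (insert x B)"
        "dv x y b (insert y C) = shuffle_sign {x} C * shuffle_sign {y} C * b (insert x C)"
        using RBC xy by (auto simp: dv_def)
      have r: "shuffle_sign {z} R = shuffle_sign {z} B * shuffle_sign {z} C" for z
        using shuffle_sign_Un_right[of "{z}" B C] RBC by simp
      have i: "shuffle_sign B (insert x C) = shuffle_sign B {x} * shuffle_sign B C"
        "shuffle_sign B (insert y C) = shuffle_sign B {y} * shuffle_sign B C"
        "shuffle_sign (insert x B) C = shuffle_sign {x} C * shuffle_sign B C"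
        "shuffle_sign (insert y B) C = shuffle_sign {y} C * shuffle_sign B C"
        using RBC by (auto intro!: shuffle_sign_insert_left shuffle_sign_insert_right)
      have sw: "shuffle_sign B {x} = (-1) ^ card B * shuffle_sign {x} B"
        "shuffle_sign B {y} = (-1) ^ card B * shuffle_sign {y} B"
        using shuffle_sign_swap[of "{x}" B] shuffle_sign_swap[of "{y}" B] RBC by simp_all
      show "shuffle_sign {x} R * shuffle_sign {y} R *
         (shuffle_sign B (insert x R - B) * a B * b (insert x R - B)
          + shuffle_sign (insert x B) (insert x R - insert x B) * a (insert x B) * b (insert x R - insert x B))
        = shuffle_sign (insert y B) (S - insert y B) * dv x y a (insert y B) * b (S - insert y B)
          + shuffle_sign B (S - B) * a B * dv x y b (S - B)"
        unfolding e d r i sw by (simp add: algebra_simps)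
    qed
    also have "\<dots> = wedge (dv x y a) b S + wedge a (dv x y b) S"
    proof -
      have "wedge (dv x y a) b S = (\<Sum>B\<in>Pow R. shuffle_sign (insert y B) (S - insert y B) * dv x y a (insert y B) * b (S - insert y B))"
        unfolding wedge_def PS by (intro sum.cong refl) (use R in \<open>auto simp: dv_def\<close>)
      moreover have "wedge a (dv x y b) S = (\<Sum>B\<in>Pow R. shuffle_sign B (S - B) * a B * dv x y b (S - B))"
        unfolding wedge_def PS by (intro sum.cong refl) (use R in \<open>auto simp: dv_def\<close>)
      ultimately show ?thesis by (simp add: sum.distrib)
    qed
    finally show ?thesis .
  next
    case 4
    define R where "R = S - {x,y}"
    have S: "S = insert x (insert y R)" and R: "finite R" "y \<notin> R" "x \<notin> R" using 4 by (auto simp: R_def)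
    have xR: "x \<notin> insert y R" using R xy by auto
    have PS: "sum f (Pow S) = (\<Sum>B\<in>Pow (insert y R). f B + f (insert x B))" for f :: "nat set \<Rightarrow> complex"
      using sum_Pow_insert[of "insert y R" x f] R xR by (simp add: S)
    have PR: "sum f (Pow (insert y R)) = (\<Sum>B\<in>Pow R. f B + f (insert y B))" for f :: "nat set \<Rightarrow> complex"
      using sum_Pow_insert[of R y f] R by simp
    have L: "wedge (dv x y a) b S = (\<Sum>B\<in>Pow R. shuffle_sign (insert y B) (S - insert y B) * dv x y a (insert y B) * b (S - insert y B))"
    proof -
      have "wedge (dv x y a) b S = (\<Sum>B\<in>Pow (insert y R). shuffle_sign B (S - B) * dv x y a B * b (S - B))"
        unfolding wedge_def PS by (intro sum.cong refl) (auto simp: dv_def)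
      also have "\<dots> = (\<Sum>B\<in>Pow R. shuffle_sign (insert y B) (S - insert y B) * dv x y a (insert y B) * b (S - insert y B))"
        unfolding PR by (intro sum.cong refl) (use R in \<open>auto simp: dv_def\<close>)
      finally show ?thesis .
    qed
    have M: "wedge a (dv x y b) S = (\<Sum>B\<in>Pow R. shuffle_sign (insert x B) (S - insert x B) * a (insert x B) * dv x y b (S - insert x B))"
    proof -
      have z: "dv x y b (S - B) = 0" if "x \<notin> B" for B using that 4 by (auto simp: dv_def)
      have z': "dv x y b (S - insert x (insert y B)) = 0" for B using 4 by (auto simp: dv_def)
      have "wedge a (dv x y b) S = (\<Sum>B\<in>Pow (insert y R). shuffle_sign (insert x B) (S - insert x B) * a (insert x B) * dv x y b (S - insert x B))"
        unfolding wedge_def PS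
      proof (intro sum.cong refl)
        fix B assume "B \<in> Pow (insert y R)"
        then have "x \<notin> B" using xR by auto
        then show "shuffle_sign B (S - B) * a B * dv x y b (S - B) +
            shuffle_sign (insert x B) (S - insert x B) * a (insert x B) * dv x y b (S - insert x B) =
            shuffle_sign (insert x B) (S - insert x B) * a (insert x B) * dv x y b (S - insert x B)"
          by (simp add: z)
      qed
      also have "\<dots> = (\<Sum>B\<in>Pow R. shuffle_sign (insert x B) (S - insert x B) * a (insert x B) * dv x y b (S - insert x B))"
        unfolding PR by (intro sum.cong refl) (auto simp: z')
      finally show ?thesis .
    qed
    have "wedge (dv x y a) b S + wedge a (dv x y b) S = 0"
      unfolding L M sum.distrib[symmetric]
    proof (rule sum.neutral, rule ballI)
      fix B assume "B \<in> Pow R"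
      then have B: "B \<subseteq> R" by simp
      define C where "C = R - B"
      have RBC: "R = B \<union> C" "B \<inter> C = {}" "finite B" "finite C" "x \<notin> B" "x \<notin> C" "y \<notin> B" "y \<notin> C"
        using B R finite_subset by (auto simp: C_def)
      have e: "S - insert y B = insert x C" "S - insert x B = insert y C"
        using RBC xy by (auto simp: S)
      have d: "dv x y a (insert y B) = shuffle_sign {x} B * shuffle_sign {y} B * a (insert x B)"
        "dv x y b (insert y C) = shuffle_sign {x} C * shuffle_sign {y} C * b (insert x C)"
        using RBC xy by (auto simp: dv_def)
      have i: "shuffle_sign (insert y B) (insert x C) = sg y x * shuffle_sign {y} C * (shuffle_sign B {x} * shuffle_sign B C)"
        "shuffle_sign (insert x B) (insert y C) = sg x y * shuffle_sign {x} C * (shuffle_sign B {y} * shuffle_sign B C)"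
        using RBC xy shuffle_sign_insert_left[of B "insert x C" y] shuffle_sign_insert_left[of B "insert y C" x]
          shuffle_sign_insert_right[of "{y}" C x] shuffle_sign_insert_right[of "{x}" C y]
          shuffle_sign_insert_right[of B C x] shuffle_sign_insert_right[of B C y]
        by (simp_all add: shuffle_sign_sing)
      have sw: "shuffle_sign B {x} = (-1) ^ card B * shuffle_sign {x} B"
        "shuffle_sign B {y} = (-1) ^ card B * shuffle_sign {y} B"
        using shuffle_sign_swap[of "{x}" B] shuffle_sign_swap[of "{y}" B] RBC by simp_all
      \<comment> \<open>The two terms differ only in the order in which \<open>x\<close> and
        \<open>y\<close> are distributed; this sign makes them cancel.\<close>
      have sgs: "sg y x = - sg x y" using xy by (auto simp: sg_def)
      show "shuffle_sign (insert y B) (S - insert y B) * dv x y a (insert y B) * b (S - insert y B)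
        + shuffle_sign (insert x B) (S - insert x B) * a (insert x B) * dv x y b (S - insert x B) = 0"
        unfolding e d i sw sgs by (simp add: algebra_simps)
    qed
    then show ?thesis using 4 by (simp add: dv_def)
  qed
qed

lemma dv_lin: "dv x y (\<lambda>S. u * a S + v * b S) = (\<lambda>S. u * dv x y a S + v * dv x y b S)"
  by (rule ext) (simp add: dv_def algebra_simps)

lemma wedge_dv_dv: "wedge (dv x y a) (dv x y b) = (\<lambda>S. 0)"
  by (rule ext) (auto simp: wedge_def dv_def intro!: sum.neutral)

lemma dv_dv: "x \<noteq> y \<Longrightarrow> dv x y (dv x y a) = (\<lambda>S. 0)"
  by (rule ext) (auto simp: dv_def)

lemma dv_fin: "fin_form a \<Longrightarrow> fin_form (dv x y a)"
  by (auto simp: fin_form_def dv_def)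

lemma dv_commute:
  assumes d: "distinct [x, y, x', y']" and f: "fin_form a"
  shows "dv x y (dv x' y' a) = dv x' y' (dv x y a)"
proof
  fix S :: "nat set"
  show "dv x y (dv x' y' a) S = dv x' y' (dv x y a) S"
  proof (cases "finite S \<and> y \<in> S \<and> x \<notin> S \<and> y' \<in> S \<and> x' \<notin> S")
    case True
    define R where "R = S - {y,y'}"
    have R: "finite R" "x \<notin> R" "y \<notin> R" "x' \<notin> R" "y' \<notin> R" using True by (auto simp: R_def)
    have e: "S - {y} = insert y' R" "S - {y'} = insert y R" "insert x (insert y' R) - {y'} = insert x R"
      "insert x' (insert y R) - {y} = insert x' R"
      using d R True by (auto simp: R_def)
    \<comment> \<open>Each side contains one product \<open>sg u v * sg v u = -1\<close>; the
      remaining two factors are both reversed between the sides, so these signs cancel.\<close>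
    have m: "sg x y' * sg y y' * (sg x' x * sg y' x) = sg x' y * sg y' y * (sg x x' * sg y x')"
      using d by (auto simp: sg_def)
    have ss: "shuffle_sign {z} (insert w R) = sg z w * shuffle_sign {z} R" if "w \<notin> R" for z w
      using that R shuffle_sign_insert_right[of "{z}" R w] by (simp add: shuffle_sign_sing)
    have "dv x y (dv x' y' a) S = sg x y' * sg y y' * (sg x' x * sg y' x) *
      (shuffle_sign {x} R * shuffle_sign {y} R * shuffle_sign {x'} R * shuffle_sign {y'} R * a (insert x' (insert x R)))"
      using True d R by (simp add: dv_def e ss)
    moreover have "dv x' y' (dv x y a) S = sg x' y * sg y' y * (sg x x' * sg y x') *
      (shuffle_sign {x} R * shuffle_sign {y} R * shuffle_sign {x'} R * shuffle_sign {y'} R * a (insert x (insert x' R)))"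
      using True d R by (simp add: dv_def e ss)
    ultimately show ?thesis using m by (simp add: insert_commute)
  next
    case False
    then show ?thesis using d f by (auto simp: dv_def fin_form_def)
  qed
qed

lemma conj_dv:
  assumes xy: "x \<noteq> y" and f: "fin_form a"
  shows "conj_form (dv x y a) = dv (gswap x) (gswap y) (conj_form a)"
proof
  fix S :: "nat set"
  show "conj_form (dv x y a) S = dv (gswap x) (gswap y) (conj_form a) S"
  proof (cases "finite S \<and> gswap y \<in> S \<and> gswap x \<notin> S")
    case True
    define X Y R where "X = gswap x" and "Y = gswap y" and "R = S - {Y}"
    have x: "x = gswap X" "y = gswap Y" "X \<noteq> Y" using xy by (auto simp: X_def Y_def)
    have R: "finite R" "Y \<notin> R" "X \<notin> R" "S = insert Y R" using True by (auto simp: R_def X_def Y_def)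
    have np: "npairs (insert z R) = npairs R + card {w\<in>{z}. gswap w \<in> R}" if "z \<notin> R" for z
      using npairs_Un[of "{z}" R] R that by (simp add: npairs_def)
    have sh: "shuffle_sign {gswap z} (gswap ` R) = (-1) ^ card {w\<in>{z}. gswap w \<in> R} * shuffle_sign {z} R" if "z \<notin> R" for z
      using shuffle_sign_gswap[of "{z}" R] R that by simp
    have e: "gswap ` S - {y} = gswap ` R" using R by (auto simp: x)
    have "y \<in> gswap ` S" "x \<notin> gswap ` S" using True by (auto simp: mem_gswap_image)
    then have "dv x y a (gswap ` S) = shuffle_sign {x} (gswap ` R) * shuffle_sign {y} (gswap ` R) * a (insert x (gswap ` R))"
      by (simp add: dv_def e)
    then have "conj_form (dv x y a) S = (-1) ^ npairs (insert Y R) *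
       (shuffle_sign {gswap X} (gswap ` R) * shuffle_sign {gswap Y} (gswap ` R) * cnj (a (insert x (gswap ` R))))"
      by (simp add: conj_form_altdef R(4)[symmetric] x[symmetric])
    moreover have "dv X Y (conj_form a) S = shuffle_sign {X} R * shuffle_sign {Y} R * ((-1) ^ npairs (insert X R) * cnj (a (insert x (gswap ` R))))"
      using True by (simp add: dv_def R_def[symmetric] X_def[symmetric] Y_def[symmetric] conj_form_altdef x)
    ultimately show ?thesis
      using R by (simp add: np sh X_def[symmetric] Y_def[symmetric] power_add)
  next
    case False
    then have "infinite S \<or> y \<notin> gswap ` S \<or> x \<in> gswap ` S" by (auto simp: mem_gswap_image)
    then show ?thesis using False f by (auto simp: dv_def conj_form_altdef fin_form_def finite_image_iff)
  qed
qed

lemma has_type_dv: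
  assumes "has_type p q a" "even x \<longleftrightarrow> even y" "x \<noteq> y"
  shows "has_type p q (dv x y a)"
  unfolding has_type_def
proof (intro allI impI)
  fix S assume "dv x y a S \<noteq> 0"
  then have S: "y \<in> S" "x \<notin> S" "a (insert x (S - {y})) \<noteq> 0" by (auto simp: dv_def split: if_splits)
  then have t: "finite S" "hol_deg (insert x (S - {y})) = p" "antihol_deg (insert x (S - {y})) = q"
    using assms by (auto simp: has_type_def)
  have "hol_deg (insert x (S - {y})) = hol_deg S" "antihol_deg (insert x (S - {y})) = antihol_deg S"
    unfolding hol_deg_def antihol_deg_def
    by (rule bij_betw_same_card[of "\<lambda>z. if z = x then y else z"],
        rule bij_betw_byWitness[of _ "\<lambda>z. if z = y then x else z"], use S assms in \<open>auto split: if_splits\<close>)+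
  then show "finite S \<and> hol_deg S = p \<and> antihol_deg S = q" using t by simp
qed

text \<open>The exponential of \<open>c * dv x y\<close>: this derivation squares to zero
  (\<open>dv_dv\<close>), so the series stops after the linear term.\<close>

definition tv :: "nat \<Rightarrow> nat \<Rightarrow> complex \<Rightarrow> cform \<Rightarrow> cform" where
  "tv x y c a = (\<lambda>S. a S + c * dv x y a S)"

text \<open>Leibniz rule plus the absence of a quadratic term: in \<open>wedge_dv_dv\<close> both
  factors would have to contain \<open>y\<close>.\<close>

lemma tv_wedge: "x \<noteq> y \<Longrightarrow> tv x y c (wedge a b) = wedge (tv x y c a) (tv x y c b)"
  unfolding tv_def
  by (simp add: dv_wedge wedge_add_left wedge_add_right wedge_scale_left wedge_scale_right wedge_dv_dv algebra_simps)

lemma tv_inverse: "x \<noteq> y \<Longrightarrow> tv x y (- c) (tv x y c a) = a"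
  using dv_lin[of x y 1 a c "dv x y a"] by (simp add: tv_def dv_dv)

lemma tv_top: "x \<in> G \<Longrightarrow> tv x y c a G = a G"
  by (simp add: tv_def dv_def)

lemma tv_zero_on: "x \<in> G \<Longrightarrow> (\<And>S. S \<subseteq> G \<Longrightarrow> a S = 0) \<Longrightarrow> S \<subseteq> G \<Longrightarrow> tv x y c a S = 0"
proof -
  assume *: "x \<in> G" "\<And>S. S \<subseteq> G \<Longrightarrow> a S = 0" "S \<subseteq> G"
  have "a S = 0" "a (insert x (S - {y})) = 0" by (rule *(2); use * in auto)+
  then show ?thesis by (simp add: tv_def dv_def)
qed

text \<open>Pullback under the change of coordinates replacing \<open>z_j\<close> by
  \<open>z_j + c z_k\<close>. The conjugate constant on the barred generators makes it commute with
  conjugation.\<close>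

definition shear :: "nat \<Rightarrow> nat \<Rightarrow> complex \<Rightarrow> cform \<Rightarrow> cform" where
  "shear j k c a = tv (2*j) (2*k) c (tv (2*j+1) (2*k+1) (cnj c) a)"

lemma shear_wedge: "j \<noteq> k \<Longrightarrow> shear j k c (wedge a b) = wedge (shear j k c a) (shear j k c b)"
  by (simp add: shear_def tv_wedge)

text \<open>The change of coordinates has determinant one; concretely, \<open>dv x y\<close>
  vanishes on sets that already contain \<open>x\<close>.\<close>

lemma shear_top: "j \<in> I \<Longrightarrow> shear j k c a (gens I) = a (gens I)"
  by (simp add: shear_def tv_top gens_def)

lemma shear_zero_on:
  "j \<in> I \<Longrightarrow> (\<And>S. S \<subseteq> gens I \<Longrightarrow> a S = 0) \<Longrightarrow> S \<subseteq> gens I \<Longrightarrow> shear j k c a S = 0"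
  unfolding shear_def by (intro tv_zero_on[of _ "gens I"]) (auto simp: gens_def)

lemma tv_commute:
  assumes "distinct [x, y, x', y']" "fin_form a"
  shows "tv x y c (tv x' y' c' a) = tv x' y' c' (tv x y c a)"
  using dv_lin[of x y 1 a c' "dv x' y' a"] dv_lin[of x' y' 1 a c "dv x y a"] dv_commute[OF assms]
  by (simp add: tv_def algebra_simps)

lemma tv_fin: "fin_form a \<Longrightarrow> fin_form (tv x y c a)"
  using dv_fin[of a x y] by (auto simp: tv_def fin_form_def)

lemma distinct_shear: "j \<noteq> k \<Longrightarrow> distinct [2*j+1, 2*k+1, 2*j, 2*k :: nat]"
  by simp

lemma shear_inverse:
  assumes "j \<noteq> k" "fin_form a"
  shows "shear j k (- c) (shear j k c a) = a"
proof -
  have "tv (2*j+1) (2*k+1) (cnj (-c)) (tv (2*j) (2*k) c (tv (2*j+1) (2*k+1) (cnj c) a))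
    = tv (2*j) (2*k) c (tv (2*j+1) (2*k+1) (- cnj c) (tv (2*j+1) (2*k+1) (cnj c) a))"
    using tv_commute[OF distinct_shear[OF assms(1)] tv_fin[OF assms(2)]] by simp
  then show ?thesis using assms by (simp add: shear_def tv_inverse)
qed

lemma conj_tv:
  assumes "x \<noteq> y" "fin_form a"
  shows "conj_form (tv x y c a) = tv (gswap x) (gswap y) (cnj c) (conj_form a)"
  using conj_lin[of 1 a c "dv x y a"] by (simp add: tv_def conj_dv[OF assms])

lemma conj_fin: "fin_form a \<Longrightarrow> fin_form (conj_form a)"
  by (auto simp: fin_form_def conj_form_altdef finite_image_iff)

lemma conj_shear:
  assumes "j \<noteq> k" "fin_form a"
  shows "conj_form (shear j k c a) = shear j k c (conj_form a)"
proof -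
  have g: "gswap (2*i) = 2*i+1" "gswap (2*i+1) = 2*i" for i by (auto simp: gswap_def)
  have "conj_form (shear j k c a) = tv (2*j+1) (2*k+1) (cnj c) (tv (2*j) (2*k) c (conj_form a))"
    unfolding shear_def using assms by (subst conj_tv) (simp_all only: tv_fin g, simp_all add: conj_tv[unfolded g] tv_fin g[simplified])
  also have "\<dots> = shear j k c (conj_form a)"
    unfolding shear_def using tv_commute[OF distinct_shear[OF assms(1)] conj_fin[OF assms(2)]] by simp
  finally show ?thesis .
qed

lemma has_type_tv:
  assumes "has_type p q a" "even x \<longleftrightarrow> even y" "x \<noteq> y"
  shows "has_type p q (tv x y c a)"
  using has_type_lin[OF assms(1) has_type_dv[OF assms], of 1 c] by (simp add: tv_def)

lemma has_type_shear: "has_type p q a \<Longrightarrow> j \<noteq> k \<Longrightarrow> has_type p q (shear j k c a)"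
  unfolding shear_def by (intro has_type_tv) auto

lemma coef2_shuffle: "x \<noteq> y \<Longrightarrow> coef2 a x y = shuffle_sign {x} {y} * a {x,y}"
  by (auto simp: coef2_def shuffle_sign_sing sg_def)

lemma herm_mat_altdef: "herm_mat a j k = - \<i> * sg (2*j) (2*k+1) * a {2*j, 2*k+1}"
proof -
  have "2*j \<noteq> 2*k+1" by presburger
  then show ?thesis by (simp add: herm_mat_def coef2_shuffle shuffle_sign_sing)
qed

lemma herm_mat_tv_even:
  assumes "has_type 1 1 a" "j \<noteq> k"
  shows "herm_mat (tv (2*j) (2*k) c a) r s = herm_mat a r s + (if r = k then c * herm_mat a j s else 0)"
proof -
  have ne: "2*i \<noteq> 2 * s+1" "2 * s+1 \<noteq> 2*i" for i by presburger+
  show ?thesis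
  proof (cases "r = k")
    case True
    have e: "{2*k, 2 * s+1} - {2*k} = {2 * s+1}" using ne by auto
    have "dv (2*j) (2*k) a {2*r, 2 * s+1} = sg (2*j) (2 * s+1) * sg (2*k) (2 * s+1) * a {2*j, 2 * s+1}"
      using True assms ne unfolding dv_def True e by (simp add: shuffle_sign_sing)
    then show ?thesis using True
      by (simp add: herm_mat_altdef tv_def algebra_simps) (simp add: sg_def)
  next
    case False
    then have "dv (2*j) (2*k) a {2*r, 2 * s+1} = 0" using ne[of k] by (auto simp: dv_def)
    then show ?thesis using False by (simp add: herm_mat_altdef tv_def)
  qed
qed

lemma herm_mat_tv_odd:
  assumes "has_type 1 1 a" "j \<noteq> k"
  shows "herm_mat (tv (2*j+1) (2*k+1) c a) r s = herm_mat a r s + (if s = k then c * herm_mat a r j else 0)"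
proof -
  have ne: "2*i+1 \<noteq> 2*r" "2*r \<noteq> 2*i+1" for i by presburger+
  show ?thesis
  proof (cases "s = k")
    case True
    have e: "{2*r, 2*k+1} - {2*k+1} = {2*r}" using ne by auto
    have "dv (2*j+1) (2*k+1) a {2*r, 2 * s+1} = sg (2*j+1) (2*r) * sg (2*k+1) (2*r) * a {2*r, 2*j+1}"
      using True assms ne unfolding dv_def True e by (simp add: shuffle_sign_sing insert_commute)
    moreover have "sg (2*i+1) (2*r) = - sg (2*r) (2*i+1)" for i using ne by (auto simp: sg_def)
    ultimately show ?thesis using True
      by (simp add: herm_mat_altdef tv_def algebra_simps) (simp add: sg_def)
  next
    case False
    then have "dv (2*j+1) (2*k+1) a {2*r, 2 * s+1} = 0" using ne[of k] by (auto simp: dv_def)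
    then show ?thesis using False by (simp add: herm_mat_altdef tv_def)
  qed
qed

text \<open>Congruence by an elementary matrix: a row operation with \<open>c\<close> together with
  the column operation with \<open>cnj c\<close>, both meeting in the entry
  \<open>k, k\<close>.\<close>

lemma herm_mat_shear:
  assumes "has_type 1 1 a" "j \<noteq> k"
  shows "herm_mat (shear j k c a) r s = herm_mat a r s + (if r = k then c * herm_mat a j s else 0)
     + (if s = k then cnj c * (herm_mat a r j + (if r = k then c * herm_mat a j j else 0)) else 0)"
proof -
  have t: "has_type 1 1 (tv (2*j+1) (2*k+1) (cnj c) a)" by (rule has_type_tv) (use assms in auto)
  show ?thesis
    unfolding shear_def herm_mat_tv_even[OF t assms(2)] herm_mat_tv_odd[OF assms]
    by (simp add: algebra_simps)
qed

definition hquad :: "nat set \<Rightarrow> cform \<Rightarrow> (nat \<Rightarrow> complex) \<Rightarrow> complex" where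
  "hquad I a v = (\<Sum>j\<in>I. \<Sum>k\<in>I. herm_mat a j k * v j * cnj (v k))"

lemma hquad_shear:
  assumes "finite I" "j \<in> I" "k \<in> I" "has_type 1 1 a" "j \<noteq> k"
  shows "hquad I (shear j k c a) v = hquad I a (v(j := v j + c * v k))"
proof -
  define h where "h = herm_mat a"
  define w where "w = v(j := v j + c * v k)"
  have w: "w r = v r + (if r = j then c * v k else 0)" for r by (simp add: w_def)
  have sw: "(\<Sum>r\<in>I. if r = i then f r else (0::complex)) = f i" if "i \<in> I" for i f
    using that assms by simp
  have sw': "(\<Sum>s\<in>I. if P then f s else (0::complex)) = (if P then sum f I else 0)" for f P by simp
  have "hquad I a w = (\<Sum>r\<in>I. \<Sum>s\<in>I. h r s * v r * cnj (v s) + (if s = j then h r s * v r * cnj (c * v k) else 0)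
      + (if r = j then h r s * (c * v k) * cnj (v s) else 0)
      + (if r = j then if s = j then h r s * (c * v k) * cnj (c * v k) else 0 else 0))"
    unfolding hquad_def h_def[symmetric] w by (intro sum.cong refl) (auto simp: algebra_simps)
  also have "\<dots> = (\<Sum>r\<in>I. \<Sum>s\<in>I. h r s * v r * cnj (v s)) + (\<Sum>r\<in>I. h r j * v r * cnj (c * v k))
      + (\<Sum>s\<in>I. h j s * (c * v k) * cnj (v s)) + h j j * (c * v k) * cnj (c * v k)"
    using assms by (simp only: sum.distrib sw sw')
  finally have 1: "hquad I a w = \<dots>" .
  have "hquad I (shear j k c a) v = (\<Sum>r\<in>I. \<Sum>s\<in>I. h r s * v r * cnj (v s) + (if s = k then h r j * v r * cnj (c * v s) else 0)
      + (if r = k then h j s * (c * v r) * cnj (v s) else 0)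
      + (if r = k then if s = k then h j j * (c * v r) * cnj (c * v s) else 0 else 0))"
    unfolding hquad_def herm_mat_shear[OF assms(4,5)] h_def[symmetric]
    by (intro sum.cong refl) (auto simp: algebra_simps)
  also have "\<dots> = (\<Sum>r\<in>I. \<Sum>s\<in>I. h r s * v r * cnj (v s)) + (\<Sum>r\<in>I. h r j * v r * cnj (c * v k))
      + (\<Sum>s\<in>I. h j s * (c * v k) * cnj (v s)) + h j j * (c * v k) * cnj (c * v k)"
    using assms by (simp only: sum.distrib sw sw')
  finally show ?thesis using 1 by (simp add: w_def)
qed

subsection \<open>Semipositive forms and their rank\<close>

text \<open>Elimination of one unknown by the last nontrivial equation. The index type of the
  unknowns is left open because the lemma is applied both to vectors and to coefficients of
  forms.\<close>

lemma underdetermined_system: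
  fixes \<phi> :: "nat \<Rightarrow> 'a \<Rightarrow> 'b::field"
  assumes "finite I" "s < card I"
  shows "\<exists>v. (\<forall>i<s. (\<Sum>j\<in>I. \<phi> i j * v j) = 0) \<and> (\<exists>j\<in>I. v j \<noteq> 0)"
  using assms
proof (induction s arbitrary: I \<phi>)
  case 0
  then have "I \<noteq> {}" by auto
  then show ?case by (intro exI[of _ "\<lambda>_. 1"]) auto
next
  case (Suc s)
  show ?case
  proof (cases "\<forall>j\<in>I. \<phi> s j = 0")
    case True
    from Suc.IH[of I \<phi>] Suc.prems obtain v where "\<forall>i<s. (\<Sum>j\<in>I. \<phi> i j * v j) = 0" "\<exists>j\<in>I. v j \<noteq> 0" by auto
    then show ?thesis using True by (intro exI[of _ v]) (auto simp: less_Suc_eq)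
  next
    case False
    then obtain j0 where j0: "j0 \<in> I" "\<phi> s j0 \<noteq> 0" by auto
    define J where "J = I - {j0}"
    have J: "finite J" "s < card J" "j0 \<notin> J" "I = insert j0 J" using Suc.prems j0 by (auto simp: J_def)
    from Suc.IH[OF J(1,2), of "\<lambda>i j. \<phi> i j - \<phi> i j0 * \<phi> s j / \<phi> s j0"] obtain v where
      v: "\<And>i. i < s \<Longrightarrow> (\<Sum>j\<in>J. (\<phi> i j - \<phi> i j0 * \<phi> s j / \<phi> s j0) * v j) = 0" "\<exists>j\<in>J. v j \<noteq> 0" by auto
    define c where "c = - (\<Sum>j\<in>J. \<phi> s j * v j) / \<phi> s j0"
    have e: "(\<Sum>j\<in>I. \<phi> i j * (v(j0 := c)) j) = \<phi> i j0 * c + (\<Sum>j\<in>J. \<phi> i j * v j)" for i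
    proof -
      have "(\<Sum>j\<in>J. \<phi> i j * (v(j0 := c)) j) = (\<Sum>j\<in>J. \<phi> i j * v j)"
        by (rule sum.cong) (use J in auto)
      then show ?thesis using J by simp
    qed
    have "(\<Sum>j\<in>I. \<phi> i j * (v(j0 := c)) j) = 0" if "i < Suc s" for i
    proof (cases "i = s")
      case True
      then show ?thesis using j0 unfolding e by (simp add: c_def)
    next
      case False
      then have "i < s" using that by simp
      then have "(\<Sum>j\<in>J. \<phi> i j * v j) = (\<Sum>j\<in>J. \<phi> i j0 / \<phi> s j0 * (\<phi> s j * v j))"
        using v(1)[of i] by (simp add: algebra_simps sum_subtractf)
      also have "\<dots> = \<phi> i j0 / \<phi> s j0 * (\<Sum>j\<in>J. \<phi> s j * v j)" by (simp add: sum_distrib_left)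
      finally show ?thesis unfolding e by (simp add: c_def)
    qed
    moreover have "\<exists>j\<in>I. (v(j0 := c)) j \<noteq> 0" using v(2) J by auto
    ultimately show ?thesis by blast
  qed
qed

text \<open>Rank at least \<open>r\<close>, stated dually: fewer than \<open>r\<close> linear conditions
  never force a vector into the null cone.\<close>

definition rank_ge :: "nat set \<Rightarrow> nat \<Rightarrow> cform \<Rightarrow> bool" where
  "rank_ge I r a \<longleftrightarrow> (\<forall>\<phi> s. s < r \<longrightarrow> (\<exists>v. (\<forall>i<s. (\<Sum>j\<in>I. \<phi> i j * v j) = 0) \<and> Re (hquad I a v) > 0))"

text \<open>Type and reality concern the whole form, semipositivity and rank only its restriction to
  \<open>I\<close>; restricting to a hyperplane therefore changes \<open>I\<close> and leaves
  \<open>a\<close> alone.\<close>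

definition psd :: "nat set \<Rightarrow> nat \<Rightarrow> cform \<Rightarrow> bool" where
  "psd I r a \<longleftrightarrow> has_type 1 1 a \<and> conj_form a = a \<and>
     (\<forall>v. Im (hquad I a v) = 0 \<and> Re (hquad I a v) \<ge> 0) \<and> rank_ge I r a"

lemma rank_geD:
  assumes "rank_ge I r a" "s < r"
  shows "\<exists>v. (\<forall>i<s. (\<Sum>j\<in>I. \<phi> i j * v j) = 0) \<and> Re (hquad I a v) > 0"
  using assms by (simp add: rank_ge_def)

lemma rank_ge_mono: "rank_ge I r a \<Longrightarrow> s \<le> r \<Longrightarrow> rank_ge I s a"
  by (simp add: rank_ge_def)

lemma psd_mono: "psd I r a \<Longrightarrow> s \<le> r \<Longrightarrow> psd I s a"
  using rank_ge_mono by (auto simp: psd_def)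

lemma hquad_remove:
  assumes "finite I" "v j = 0"
  shows "hquad I a v = hquad (I - {j}) a v"
proof -
  have "(\<Sum>k\<in>I. herm_mat a i k * v i * cnj (v k)) = (\<Sum>k\<in>I - {j}. herm_mat a i k * v i * cnj (v k))" for i
    by (rule sum.mono_neutral_right) (use assms in auto)
  then show ?thesis unfolding hquad_def
    by (simp, intro sum.mono_neutral_right) (use assms in auto)
qed

lemma hquad_cong: "(\<And>j. j \<in> I \<Longrightarrow> v j = w j) \<Longrightarrow> hquad I a v = hquad I a w"
  unfolding hquad_def by (intro sum.cong) auto

text \<open>The equation \<open>v j = 0\<close> is one further linear condition, appended as row
  \<open>s\<close> of \<open>\<psi>\<close>; this is the reason why the rank drops by at most
  one.\<close>

lemma psd_restrict:
  assumes "finite I" "j \<in> I" "psd I r a"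
  shows "psd (I - {j}) (r - 1) a"
proof -
  have hq: "hquad (I - {j}) a v = hquad I a (v(j := 0))" for v
    using hquad_remove[of I "v(j := 0)" j a] assms(1) hquad_cong[of "I - {j}" v "v(j:=0)" a] by simp
  have "rank_ge (I - {j}) (r - 1) a"
    unfolding rank_ge_def
  proof (intro allI impI)
    fix \<phi> :: "nat \<Rightarrow> nat \<Rightarrow> complex" and s assume s: "s < r - 1"
    define \<psi> where "\<psi> = (\<lambda>i k. if i < s then \<phi> i k else if k = j then 1 else 0)"
    have "Suc s < r" using s by simp
    then obtain v where v: "\<forall>i<Suc s. (\<Sum>k\<in>I. \<psi> i k * v k) = 0" "Re (hquad I a v) > 0"
      using assms(3) rank_geD[of I r a "Suc s" \<psi>] unfolding psd_def by blast
    have "(\<Sum>k\<in>I. \<psi> s k * v k) = (\<Sum>k\<in>I. if k = j then v k else 0)"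
      unfolding \<psi>_def by (rule sum.cong) auto
    then have vj: "v j = 0" using v(1) assms by simp
    have "(\<Sum>k\<in>I - {j}. \<phi> i k * v k) = 0" if "i < s" for i
    proof -
      have "(\<Sum>k\<in>I - {j}. \<phi> i k * v k) = (\<Sum>k\<in>I. \<phi> i k * v k)"
        by (rule sum.mono_neutral_left) (use assms vj in auto)
      also have "\<dots> = 0" using v(1)[rule_format, of i] that by (simp add: \<psi>_def)
      finally show ?thesis .
    qed
    moreover have "Re (hquad (I - {j}) a v) > 0" using v(2) hquad_remove[of I v j a] assms(1) vj by simp
    ultimately show "\<exists>v. (\<forall>i<s. (\<Sum>k\<in>I - {j}. \<phi> i k * v k) = 0) \<and> Re (hquad (I - {j}) a v) > 0"
      by blast
  qed
  then show ?thesis using assms(3) by (simp add: psd_def hq)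
qed

text \<open>By \<open>hquad_shear\<close> the sheared form at \<open>v\<close> is the old form at a
  transformed vector \<open>w\<close>; the conditions on \<open>v\<close> are rewritten as
  conditions on \<open>w\<close> before the rank of \<open>a\<close> is used.\<close>

lemma rank_ge_shear:
  assumes I: "finite I" "j \<in> I" "k \<in> I" "j \<noteq> k" and a: "has_type 1 1 a" "rank_ge I r a"
  shows "rank_ge I r (shear j k c a)"
  unfolding rank_ge_def
proof (intro allI impI)
  fix \<phi> :: "nat \<Rightarrow> nat \<Rightarrow> complex" and s assume s: "s < r"
  obtain w where w: "\<forall>i<s. (\<Sum>l\<in>I. (\<phi> i l - (if l = k then c * \<phi> i j else 0)) * w l) = 0" "Re (hquad I a w) > 0"
    using rank_geD[OF a(2) s, of "\<lambda>i l. \<phi> i l - (if l = k then c * \<phi> i j else 0)"] by blast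
  define v where "v = w(j := w j - c * w k)"
  have "v(j := v j + c * v k) = w" using I by (auto simp: v_def)
  then have "Re (hquad I (shear j k c a) v) > 0" using w(2) I a by (simp add: hquad_shear)
  moreover have "(\<Sum>l\<in>I. \<phi> i l * v l) = 0" if "i < s" for i
  proof -
    have "(\<Sum>l\<in>I. \<phi> i l * v l) = (\<Sum>l\<in>I. \<phi> i l * w l - (if l = j then \<phi> i j * c * w k else 0))"
      by (rule sum.cong) (auto simp: v_def algebra_simps)
    also have "\<dots> = (\<Sum>l\<in>I. \<phi> i l * w l) - \<phi> i j * c * w k"
      using I by (simp add: sum_subtractf)
    also have "\<dots> = (\<Sum>l\<in>I. \<phi> i l * w l) - (\<Sum>l\<in>I. if l = k then c * \<phi> i j * w l else 0)"
      using I by simp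
    also have "\<dots> = (\<Sum>l\<in>I. (\<phi> i l - (if l = k then c * \<phi> i j else 0)) * w l)"
      unfolding sum_subtractf[symmetric] by (rule sum.cong) (auto simp: algebra_simps)
    finally show ?thesis using w(1) that by simp
  qed
  ultimately show "\<exists>v. (\<forall>i<s. (\<Sum>l\<in>I. \<phi> i l * v l) = 0) \<and> Re (hquad I (shear j k c a) v) > 0" by blast
qed

lemma psd_shear:
  assumes I: "finite I" "j \<in> I" "k \<in> I" "j \<noteq> k" and a: "psd I r a"
  shows "psd I r (shear j k c a)"
  using assms rank_ge_shear[OF I, of a r c] has_type_fin[of 1 1 a]
  by (auto simp: psd_def has_type_shear[simplified] conj_shear hquad_shear)

lemma herm_mat_cnj:
  assumes "conj_form a = a"
  shows "herm_mat a k j = cnj (herm_mat a j k)"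
proof -
  have g: "gswap ` {2*j, 2*k+1} = {2*k, 2*j+1}" by (auto simp: gswap_def)
  have "a {2*j, 2*k+1} = (-1) ^ npairs {2*j, 2*k+1} * cnj (a {2*k, 2*j+1})"
    using conj_form_altdef[of a "{2*j, 2*k+1}"] assms g by simp
  moreover have "{x\<in>{2*j, 2*k+1}. even x \<and> gswap x \<in> {2*j, 2*k+1}} = (if j = k then {2*j} else {})"
    by (auto simp: gswap_def)
  then have "npairs {2*j, 2*k+1} = (if j = k then 1 else 0)" by (simp add: npairs_def)
  ultimately show ?thesis
    unfolding herm_mat_altdef by (auto simp: sg_def)
qed

lemma hquad_two:
  assumes I: "finite I" "j \<in> I" "k \<in> I" "j \<noteq> k"
  shows "hquad I a (\<lambda>i. if i = j then x else if i = k then y else 0) =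
    herm_mat a j j * x * cnj x + herm_mat a j k * x * cnj y + herm_mat a k j * y * cnj x + herm_mat a k k * y * cnj y"
proof -
  define v where "v = (\<lambda>i. if i = j then x else if i = k then y else 0)"
  have s: "(\<Sum>i\<in>I. f i) = f j + f k" if "\<And>i. i \<noteq> j \<Longrightarrow> i \<noteq> k \<Longrightarrow> f i = (0::complex)" for f
  proof -
    have "(\<Sum>i\<in>I. f i) = (\<Sum>i\<in>{j,k}. f i)" by (rule sum.mono_neutral_right) (use I that in auto)
    then show ?thesis using I by simp
  qed
  have "(\<Sum>l\<in>I. herm_mat a i l * v i * cnj (v l)) = herm_mat a i j * v i * cnj x + herm_mat a i k * v i * cnj y" for i
    by (subst s) (use I in \<open>auto simp: v_def\<close>)
  then have "hquad I a v = (\<Sum>i\<in>I. herm_mat a i j * v i * cnj x + herm_mat a i k * v i * cnj y)"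
    by (simp add: hquad_def)
  also have "\<dots> = herm_mat a j j * x * cnj x + herm_mat a j k * x * cnj y + (herm_mat a k j * y * cnj x + herm_mat a k k * y * cnj y)"
    by (subst s) (use I in \<open>auto simp: v_def\<close>)
  finally show ?thesis by (simp add: v_def)
qed

lemma hquad_single:
  assumes I: "finite I" "j \<in> I"
  shows "hquad I a (\<lambda>i. if i = j then 1 else 0) = herm_mat a j j"
proof -
  have "hquad I a (\<lambda>i. if i = j then 1 else 0) = (\<Sum>r\<in>I. \<Sum>s\<in>I. if s = j then if r = j then herm_mat a j j else 0 else 0)"
    unfolding hquad_def by (intro sum.cong refl) auto
  then show ?thesis using I by simp
qed

lemma psd_diag_nonneg:
  assumes "finite I" "psd I r a" "j \<in> I"
  shows "herm_mat a j j = of_real (Re (herm_mat a j j))" "Re (herm_mat a j j) \<ge> 0"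
  using hquad_single[OF assms(1,3), of a] assms(2) by (auto simp: psd_def complex_eq_iff) metis+

text \<open>Put 1 in place \<open>k\<close> and \<open>- x * cnj h\<close> in place
  \<open>j\<close>: with zero diagonal entry the quadratic form is affine in \<open>x\<close> with
  nonzero slope, and the value of \<open>x\<close> chosen at the end makes it -1.\<close>

lemma psd_zero_row:
  assumes I: "finite I" "j \<in> I" "k \<in> I" "j \<noteq> k" and a: "psd I r a" and z: "herm_mat a j j = 0"
  shows "herm_mat a j k = 0"
proof (rule ccontr)
  assume nz: "herm_mat a j k \<noteq> 0"
  define h where "h = herm_mat a j k"
  define u where "u = Re (herm_mat a k k)"
  have hk: "herm_mat a k k = of_real u" using psd_diag_nonneg[OF I(1) a I(3)] by (simp add: u_def)
  have hkj: "herm_mat a k j = cnj h" using a herm_mat_cnj[of a k j] by (simp add: psd_def h_def)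
  have ge: "u - 2 * x * (cmod h)\<^sup>2 \<ge> 0" for x :: real
  proof -
    have "hquad I a (\<lambda>i. if i = j then - of_real x * cnj h else if i = k then 1 else 0)
      = of_real u - of_real (2 * x) * (h * cnj h)"
      unfolding hquad_two[OF I] z hkj hk h_def[symmetric] by (simp add: algebra_simps)
    also have "\<dots> = of_real (u - 2 * x * (cmod h)\<^sup>2)"
      by (simp only: complex_norm_square of_real_diff of_real_mult)
    finally have "hquad I a (\<lambda>i. if i = j then - of_real x * cnj h else if i = k then 1 else 0)
      = of_real (u - 2 * x * (cmod h)\<^sup>2)" .
    then show ?thesis using a unfolding psd_def by (metis Re_complex_of_real)
  qed
  have "(cmod h)\<^sup>2 > 0" using nz by (simp add: h_def)
  then show False using ge[of "(u + 1) / (2 * (cmod h)\<^sup>2)"] by (simp add: field_simps)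
qed

text \<open>\<open>D\<close> records the rows already cleared, against all columns in
  \<open>I\<close>; elimination proceeds by enlarging \<open>D\<close>.\<close>

definition diag_on :: "nat set \<Rightarrow> nat set \<Rightarrow> cform \<Rightarrow> bool" where
  "diag_on D I a \<longleftrightarrow> (\<forall>j\<in>D. \<forall>k\<in>I. k \<noteq> j \<longrightarrow> herm_mat a j k = 0)"

text \<open>Completing squares one entry at a time diagonalises a semipositive form.\<close>

lemma psd_shear_induct:
  assumes I: "finite I" and a: "psd I r a"
    and diag: "\<And>a. psd I r a \<Longrightarrow> diag_on I I a \<Longrightarrow> P a"
    and shear: "\<And>a j k c. psd I r a \<Longrightarrow> j \<in> I \<Longrightarrow> k \<in> I \<Longrightarrow> j \<noteq> k \<Longrightarrow> P (shear j k c a) \<Longrightarrow> P a"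
  shows "P a"
proof -
  have "D \<subseteq> I \<Longrightarrow> psd I r a \<Longrightarrow> diag_on D I a \<Longrightarrow> P a" for D a
  proof (induction "card (I - D)" arbitrary: D a rule: less_induct)
    case (less D)
    show ?case
    proof (cases "D = I")
      case True
      then show ?thesis using less.prems diag by simp
    next
      case False
      then obtain j where j: "j \<in> I" "j \<notin> D" using less.prems(1) by auto
      have next_step: "P b" if "psd I r b" "diag_on (insert j D) I b" for b
      proof (rule less.hyps[OF _ _ that])
        have "I - insert j D \<subset> I - D" using j by auto
        then show "card (I - insert j D) < card (I - D)" using I by (simp add: psubset_card_mono)
      qed (use j less.prems in auto)
      show ?thesis
      proof (cases "herm_mat a j j = 0")
        case True
        then have "diag_on (insert j D) I a"
          using less.prems psd_zero_row[OF I j(1) _ _ less.prems(2) True] by (auto simp: diag_on_def)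
        then show ?thesis using next_step less.prems by blast
      next
        case False
        define U where "U = I - D - {j}"
        \<comment> \<open>With a nonzero pivot, \<open>K\<close> holds the columns in which row
          \<open>j\<close> may still be nonzero; each shear removes one of them.\<close>
        have inner: "K \<subseteq> U \<Longrightarrow> psd I r b \<Longrightarrow> diag_on D I b \<Longrightarrow> herm_mat b j j \<noteq> 0 \<Longrightarrow>
            (\<forall>k\<in>U - K. herm_mat b j k = 0) \<Longrightarrow> P b" if "finite K" for K b
          using that
        proof (induction K arbitrary: b rule: finite_induct)
          case empty
          have cj: "conj_form b = b" using empty by (simp add: psd_def)
          have "diag_on (insert j D) I b"
            unfolding diag_on_def
          proof (intro ballI impI)
            fix i k assume ik: "i \<in> insert j D" "k \<in> I" "k \<noteq> i"
            show "herm_mat b i k = 0"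
            proof (cases "i = j \<and> k \<in> D")
              case True
              then have "herm_mat b k i = 0" using empty.prems(3) j by (auto simp: diag_on_def)
              then show ?thesis using herm_mat_cnj[OF cj, of i k] by simp
            qed (use ik empty.prems in \<open>auto simp: diag_on_def U_def\<close>)
          qed
          then show ?case using next_step empty by blast
        next
          case (insert k K)
          have k: "k \<in> I" "j \<noteq> k" "k \<notin> D" using insert.prems(1) by (auto simp: U_def)
          \<comment> \<open>The shear adds \<open>cnj c\<close> times the pivot to the entry
            \<open>j, k\<close>, so \<open>c\<close> is the conjugate of the usual elimination
            factor.\<close>
          define c where "c = - herm_mat b k j / herm_mat b j j"
          have t: "has_type 1 1 b" and cj: "conj_form b = b" using insert.prems(2) by (auto simp: psd_def)
          note hs = herm_mat_shear[OF t k(2)]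
          have "P (shear j k c b)"
          proof (rule insert.IH)
            show "psd I r (shear j k c b)" by (rule psd_shear) (use I j k insert.prems in auto)
            show "diag_on D I (shear j k c b)"
              using insert.prems(3) k j unfolding diag_on_def hs by auto
            show "herm_mat (shear j k c b) j j \<noteq> 0" using insert.prems k unfolding hs by auto
            have "herm_mat (shear j k c b) j k = 0"
            proof -
              have "cnj (herm_mat b j j) = herm_mat b j j" "cnj (herm_mat b k j) = herm_mat b j k"
                using herm_mat_cnj[OF cj] by metis+
              then have "cnj c * herm_mat b j j = - herm_mat b j k"
                using insert.prems(4) by (simp add: c_def)
              then show ?thesis using k unfolding hs by simp
            qed
            moreover have "herm_mat (shear j k c b) j l = herm_mat b j l" if "l \<noteq> k" for l
              using that k unfolding hs by simp
            ultimately show "\<forall>l\<in>U - K. herm_mat (shear j k c b) j l = 0"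
              using insert.prems(5) by (metis DiffE DiffI insertE)
          qed (use insert.prems in auto)
          then show ?case using shear[of b j k c] insert.prems k j by blast
        qed
        have "finite U" using I by (simp add: U_def)
        then show ?thesis by (rule inner[of U]) (use less.prems False in auto)
      qed
    qed
  qed
  from this[of "{}" a] a show ?thesis by (simp add: diag_on_def)
qed

section \<open>Diagonal forms and reading off the rank\<close>

definition diag_form :: "nat set \<Rightarrow> (nat \<Rightarrow> real) \<Rightarrow> cform" where
  "diag_form I d = (\<lambda>S. \<Sum>j\<in>I. if S = gens {j} then \<i> * of_real (d j) else 0)"

lemma type11_cases:
  assumes "has_type 1 1 a" "a S \<noteq> 0"
  obtains j k where "S = {2*j, 2*k+1}"
proof -
  have "card {x\<in>S. even x} = 1" "card {x\<in>S. odd x} = 1"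
    using assms by (auto simp: has_type_def hol_deg_def antihol_deg_def)
  then obtain x y where xy: "{x\<in>S. even x} = {x}" "{x\<in>S. odd x} = {y}"
    by (auto simp: card_1_singleton_iff)
  then have "S = {x, y}" "even x" "odd y" by (auto 4 3)
  then show ?thesis using that by (metis oddE evenE)
qed

lemma diag_on_form:
  assumes I: "finite I" and a: "psd I r a" "diag_on I I a" and S: "S \<subseteq> gens I"
  shows "a S = diag_form I (\<lambda>j. Re (herm_mat a j j)) S"
proof (cases "\<exists>j\<in>I. S = gens {j}")
  case True
  then obtain j where j: "j \<in> I" "S = gens {j}" by auto
  have "diag_form I (\<lambda>j. Re (herm_mat a j j)) S = (\<Sum>i\<in>I. if i = j then \<i> * of_real (Re (herm_mat a i i)) else 0)"
    unfolding diag_form_def j by (intro sum.cong) auto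
  also have "\<dots> = \<i> * herm_mat a j j" using I j psd_diag_nonneg(1)[OF I a(1) j(1)] by simp
  also have "\<dots> = a {2*j, 2*j+1}" by (simp add: herm_mat_altdef sg_def)
  finally show ?thesis by (simp add: j gens_sing)
next
  case False
  have "a S = 0"
  proof (rule ccontr)
    assume "a S \<noteq> 0"
    moreover have "has_type 1 1 a" using a by (simp add: psd_def)
    ultimately obtain j k where jk: "S = {2*j, 2*k+1}" using type11_cases by blast
    then have "j \<in> I" "k \<in> I" using S by (auto simp: gens_def)
    moreover have "j \<noteq> k" using False jk calculation by (auto simp: gens_sing)
    ultimately have "herm_mat a j k = 0" using a(2) by (auto simp: diag_on_def)
    then show False using \<open>a S \<noteq> 0\<close> by (auto simp: herm_mat_altdef jk sg_def split: if_splits)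
  qed
  then show ?thesis using False by (auto simp: diag_form_def intro!: sum.neutral)
qed

lemma hquad_diag:
  assumes I: "finite I" and a: "psd I r a" "diag_on I I a"
  shows "hquad I a v = of_real (\<Sum>j\<in>I. Re (herm_mat a j j) * (cmod (v j))\<^sup>2)"
proof -
  have "(\<Sum>k\<in>I. herm_mat a j k * v j * cnj (v k)) = of_real (Re (herm_mat a j j) * (cmod (v j))\<^sup>2)" if "j \<in> I" for j
  proof -
    have "(\<Sum>k\<in>I. herm_mat a j k * v j * cnj (v k)) = (\<Sum>k\<in>I. if k = j then herm_mat a j j * (v j * cnj (v j)) else 0)"
      by (rule sum.cong) (use a that in \<open>auto simp: diag_on_def\<close>)
    also have "\<dots> = herm_mat a j j * (v j * cnj (v j))" using I that by simp
    also have "\<dots> = of_real (Re (herm_mat a j j)) * (v j * cnj (v j))" using psd_diag_nonneg(1)[OF I a(1) that] by simp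
    also have "\<dots> = of_real (Re (herm_mat a j j) * (cmod (v j))\<^sup>2)" by (simp only: complex_norm_square of_real_mult)
    finally show ?thesis .
  qed
  then show ?thesis by (simp add: hquad_def)
qed

lemma ex_vanishing_on:
  assumes "finite J" "J \<subseteq> I" "finite I" "card J < r" "rank_ge I r a"
  obtains v where "\<And>j. j \<in> J \<Longrightarrow> v j = 0" "Re (hquad I a v) > 0"
proof -
  obtain f where f: "bij_betw f {..<card J} J"
    using assms(1) by (metis bij_betw_from_nat_into_finite)
  obtain v where v: "\<forall>i<card J. (\<Sum>k\<in>I. (if k = f i then 1 else 0) * v k) = 0" "Re (hquad I a v) > 0"
    using rank_geD[OF assms(5,4), of "\<lambda>i k. if k = f i then 1 else 0"] by blast
  have "v j = 0" if "j \<in> J" for j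
  proof -
    have "j \<in> f ` {..<card J}" using bij_betw_imp_surj_on[OF f] that by simp
    then obtain i where i: "i < card J" "f i = j" by auto
    have "(\<Sum>k\<in>I. (if k = f i then 1 else 0) * v k) = (\<Sum>k\<in>I. if k = j then v k else 0)"
      by (rule sum.cong) (auto simp: i)
    also have "\<dots> = v j" using assms that by auto
    finally show ?thesis using v(1)[rule_format, OF i(1)] by simp
  qed
  then show ?thesis using v that by blast
qed

text \<open>Setting the coordinates of all positive entries to zero costs that many linear
  conditions and leaves no vector of positive value, so a rank above their number is
  impossible.\<close>

lemma rank_diag:
  assumes I: "finite I" and a: "psd I r a" "diag_on I I a"
  shows "r \<le> card {j\<in>I. Re (herm_mat a j j) > 0}"
proof (rule ccontr)
  define J where "J = {j\<in>I. Re (herm_mat a j j) > 0}"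
  assume "\<not> ?thesis"
  then have lt: "card J < r" by (simp add: J_def)
  have "rank_ge I r a" using a by (simp add: psd_def)
  moreover have "finite J" "J \<subseteq> I" using I by (auto simp: J_def)
  ultimately obtain v where v: "\<And>j. j \<in> J \<Longrightarrow> v j = 0" "Re (hquad I a v) > 0"
    using ex_vanishing_on I lt by metis
  have "(\<Sum>j\<in>I. Re (herm_mat a j j) * (cmod (v j))\<^sup>2) \<le> 0"
  proof (rule sum_nonpos)
    fix j assume "j \<in> I"
    then show "Re (herm_mat a j j) * (cmod (v j))\<^sup>2 \<le> 0"
      using v(1)[of j] by (cases "j \<in> J") (auto simp: J_def not_less mult_nonpos_nonneg)
  qed
  then show False using v(2) hquad_diag[OF I a, of v] by simp
qed

text \<open>Fewer linear conditions than positive entries leave a nonzero solution supported on the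
  positive coordinates, where the form is positive.\<close>

lemma diag_rank:
  assumes I: "finite I" and a: "psd I s a" "diag_on I I a" and r: "r \<le> card {j\<in>I. Re (herm_mat a j j) > 0}"
  shows "rank_ge I r a"
  unfolding rank_ge_def
proof (intro allI impI)
  fix \<phi> :: "nat \<Rightarrow> nat \<Rightarrow> complex" and s assume s: "s < r"
  define J where "J = {j\<in>I. Re (herm_mat a j j) > 0}"
  have J: "finite J" "J \<subseteq> I" "s < card J" using I r s by (auto simp: J_def)
  obtain v where v: "\<forall>i<s. (\<Sum>j\<in>J. \<phi> i j * v j) = 0" "\<exists>j\<in>J. v j \<noteq> 0"
    using underdetermined_system[OF J(1,3), of \<phi>] by blast
  define w where "w = (\<lambda>j. if j \<in> J then v j else 0)"
  have "(\<Sum>j\<in>I. \<phi> i j * w j) = (\<Sum>j\<in>J. \<phi> i j * w j)" for i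
    by (rule sum.mono_neutral_right) (use I J in \<open>auto simp: w_def\<close>)
  then have "\<forall>i<s. (\<Sum>j\<in>I. \<phi> i j * w j) = 0" using v(1) by (simp add: w_def)
  moreover have "Re (hquad I a w) > 0"
  proof -
    obtain j where j: "j \<in> J" "v j \<noteq> 0" using v(2) by blast
    have "(\<Sum>j\<in>I. Re (herm_mat a j j) * (cmod (w j))\<^sup>2) > 0"
    proof (rule sum_pos2[of _ j])
      show "0 < Re (herm_mat a j j) * (cmod (w j))\<^sup>2" using j by (simp add: w_def J_def)
    qed (use I j psd_diag_nonneg(2)[OF I a(1)] in \<open>auto simp: J_def\<close>)
    then show ?thesis using hquad_diag[OF I a, of w] by simp
  qed
  ultimately show "\<exists>v. (\<forall>i<s. (\<Sum>j\<in>I. \<phi> i j * v j) = 0) \<and> Re (hquad I a v) > 0" by blast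
qed

lemma rank_ge_positive:
  assumes I: "finite I" and "\<And>v. (\<exists>j\<in>I. v j \<noteq> 0) \<Longrightarrow> Re (hquad I a v) > 0"
  shows "rank_ge I (card I) a"
  unfolding rank_ge_def
proof (intro allI impI)
  fix \<phi> :: "nat \<Rightarrow> nat \<Rightarrow> complex" and s assume s: "s < card I"
  show "\<exists>v. (\<forall>i<s. (\<Sum>j\<in>I. \<phi> i j * v j) = 0) \<and> Re (hquad I a v) > 0"
    using underdetermined_system[OF I s, of \<phi>] assms(2) by blast
qed

lemma shear_one [simp]: "shear j k c one_form = one_form"
  by (rule ext) (auto simp: shear_def tv_def dv_def one_form_def)

lemma wedge_pow_shear: "j \<noteq> k \<Longrightarrow> wedge_pow (shear j k c a) r = shear j k c (wedge_pow a r)"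
  unfolding wedge_pow_def by (induction r) (simp_all add: shear_wedge)

text \<open>Every factor contributes a complete pair with positive entry, and the disjointness built
  into \<open>wedge\<close> forbids repetitions; a nonzero power of exponent \<open>r\<close> thus
  exhibits \<open>r\<close> positive entries.\<close>

lemma wedge_pow_diag_support:
  assumes I: "finite I" and a: "psd I s a" "diag_on I I a"
    and "S \<subseteq> gens I" "wedge_pow a r S \<noteq> 0"
  shows "\<exists>K. K \<subseteq> {j\<in>I. Re (herm_mat a j j) > 0} \<and> card K = r \<and> S = gens K"
  using assms(4,5)
proof (induction r arbitrary: S)
  case 0
  then show ?case by (intro exI[of _ "{}"]) (auto simp: wedge_pow_def one_form_def gens_def split: if_splits)
next
  case (Suc r)
  have "wedge (wedge_pow a r) a S \<noteq> 0" using Suc.prems(2) by (simp add: wedge_pow_def)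
  then obtain A where A: "A \<subseteq> S" "wedge_pow a r A \<noteq> 0" "a (S - A) \<noteq> 0"
    by (rule wedge_nonzeroE)
  then obtain K where K: "K \<subseteq> {j\<in>I. Re (herm_mat a j j) > 0}" "card K = r" "A = gens K"
    using Suc.IH[OF subset_trans[OF A(1) Suc.prems(1)] A(2)] by blast
  have "diag_form I (\<lambda>j. Re (herm_mat a j j)) (S - A) \<noteq> 0"
    using diag_on_form[OF I a subset_trans[OF Diff_subset Suc.prems(1)]] A(3) by simp
  then obtain j where j: "j \<in> I" "S - A = gens {j}" "Re (herm_mat a j j) \<noteq> 0"
    unfolding diag_form_def by (elim sum.not_neutral_contains_not_neutral) (auto split: if_splits)
  have "finite K" using K I finite_subset by fastforce
  moreover have "j \<notin> K"
  proof
    assume "j \<in> K"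
    then have "gens {j} \<subseteq> A" using K by (auto simp: gens_def)
    then show False using j by (auto simp: gens_sing)
  qed
  ultimately have "card (insert j K) = Suc r" using K by simp
  moreover have "S = gens (insert j K)" using A(1) j K gens_Un[of "{j}" K] by auto
  moreover have "Re (herm_mat a j j) > 0" using psd_diag_nonneg(2)[OF I a(1) j(1)] j by simp
  ultimately show ?case using K j by (intro exI[of _ "insert j K"]) auto
qed

text \<open>A nonzero top product forces a nonzero coefficient of the power, which after
  diagonalisation counts positive entries. The cofactor \<open>X\<close> is quantified in the
  induction since a shear transforms it along with \<open>a\<close>.\<close>

lemma rank_ge_if_wedge_pow:
  assumes I: "finite I" and a: "psd I 0 a" and "wedge (wedge_pow a r) X (gens I) \<noteq> 0"
  shows "rank_ge I r a"
proof -
  have "\<forall>X. wedge (wedge_pow a r) X (gens I) \<noteq> 0 \<longrightarrow> rank_ge I r a"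
    using I a
  proof (rule psd_shear_induct; intro allI impI)
    fix a X assume a: "psd I 0 a" "diag_on I I a" and nz: "wedge (wedge_pow a r) X (gens I) \<noteq> 0"
    then obtain A where "A \<subseteq> gens I" "wedge_pow a r A \<noteq> 0"
      using wedge_zero_left_on by metis
    then obtain K where K: "K \<subseteq> {j\<in>I. Re (herm_mat a j j) > 0}" "card K = r"
      using wedge_pow_diag_support[OF I a] by blast
    have "r \<le> card {j\<in>I. Re (herm_mat a j j) > 0}" using card_mono[OF _ K(1)] K(2) I by simp
    then show "rank_ge I r a" using diag_rank[OF I a] by blast
  next
    fix a j k c X
    assume *: "psd I 0 a" "j \<in> I" "k \<in> I" "j \<noteq> k" "wedge (wedge_pow a r) X (gens I) \<noteq> 0"
      "\<forall>X. wedge (wedge_pow (shear j k c a) r) X (gens I) \<noteq> 0 \<longrightarrow> rank_ge I r (shear j k c a)"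
    have t: "has_type 1 1 a" using * by (simp add: psd_def)
    have "wedge (wedge_pow (shear j k c a) r) (shear j k c X) (gens I) = wedge (wedge_pow a r) X (gens I)"
      using * by (simp add: wedge_pow_shear shear_top flip: shear_wedge)
    then have "rank_ge I r (shear j k c a)" using *(5) *(6)[rule_format, of "shear j k c X"] by simp
    then have "rank_ge I r (shear j k (- c) (shear j k c a))"
      by (rule rank_ge_shear[OF I *(2-4) has_type_shear[OF t *(4)]])
    then show "rank_ge I r a" using shear_inverse[OF *(4) has_type_fin[OF t]] by simp
  qed
  then show ?thesis using assms by blast
qed

subsection \<open>The Hodge--Riemann form\<close>

definition wprod :: "cform list \<Rightarrow> cform" where
  "wprod fs = foldr wedge fs one_form"

lemma wprod_simps [simp]: "wprod [] = one_form" "wprod (f # fs) = wedge f (wprod fs)"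
  by (simp_all add: wprod_def)

lemma fin_wprod [simp]: "fin_form (wprod fs)"
  by (cases fs) simp_all

lemma wprod_append: "wprod (xs @ ys) = wedge (wprod xs) (wprod ys)"
  by (induction xs) (simp_all add: wedge_assoc wedge_one_left)

lemma has_type_wprod: "(\<And>f. f \<in> set fs \<Longrightarrow> has_type 1 1 f) \<Longrightarrow> has_type (length fs) (length fs) (wprod fs)"
proof (induction fs)
  case (Cons f fs)
  have "has_type (1 + length fs) (1 + length fs) (wedge f (wprod fs))"
    by (rule has_type_wedge) (use Cons in auto)
  then show ?case by simp
qed (simp add: has_type_one)

lemma conj_wprod: "(\<And>f. f \<in> set fs \<Longrightarrow> conj_form f = f) \<Longrightarrow> conj_form (wprod fs) = wprod fs"
  by (induction fs) (simp_all add: conj_wedge)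

lemma wprod_shear: "j \<noteq> k \<Longrightarrow> wprod (map (shear j k c) fs) = shear j k c (wprod fs)"
  by (induction fs) (simp_all add: shear_wedge)

text \<open>Up to a positive factor, \<open>\<i> ^ card I\<close> is the top coefficient of a
  positive volume form; the denominator thus stands for the division by \<Gamma>.\<close>

definition hr_const :: "nat set \<Rightarrow> nat \<Rightarrow> nat \<Rightarrow> complex" where
  "hr_const I p q = \<i> powi (int q - int p) * (-1) ^ ((p + q) * (p + q + 1) div 2) / \<i> ^ card I"

definition hr_form :: "nat set \<Rightarrow> nat \<Rightarrow> nat \<Rightarrow> cform \<Rightarrow> cform \<Rightarrow> cform \<Rightarrow> complex" where
  "hr_form I p q W \<Phi> \<Psi> = hr_const I p q * wedge (wedge W \<Phi>) (conj_form \<Psi>) (gens I)"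

definition zero_on :: "nat set \<Rightarrow> cform \<Rightarrow> bool" where
  "zero_on I a \<longleftrightarrow> (\<forall>S\<subseteq>gens I. a S = 0)"

lemma zero_on_subset: "zero_on I a \<Longrightarrow> J \<subseteq> I \<Longrightarrow> zero_on J a"
  unfolding zero_on_def by (meson gens_mono subset_trans)

lemma zero_on_wedge_left: "zero_on I a \<Longrightarrow> zero_on I (wedge a b)"
  unfolding zero_on_def by (intro allI impI wedge_zero_left_on) (meson subset_trans)

lemma zero_on_wedge_right: "zero_on I b \<Longrightarrow> zero_on I (wedge a b)"
  unfolding zero_on_def by (intro allI impI wedge_zero_right_on) (meson subset_trans)

lemma cnj_hr_const:
  "cnj (hr_const I p q) = (-1) ^ (card I + p + q) * hr_const I p q"
proof -
  have 1: "cnj (\<i> powi (int q - int p)) = (-1) ^ (p + q) * \<i> powi (int q - int p)"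
    by (simp add: power_int_diff power_add) (simp add: power_minus' field_simps)
  have 2: "cnj (\<i> ^ card I) = (-1) ^ card I * \<i> ^ card I"
    by (simp flip: power_mult_distrib)
  show ?thesis
    unfolding hr_const_def complex_cnj_divide complex_cnj_mult 1 2
    by (simp add: power_add divide_simps)
qed

text \<open>Conjugating the product exchanges \<open>\<Phi>\<close> with its conjugate, at the cost
  of \<open>(-1) ^ (p + q)\<close>; at the top set conjugation costs another
  \<open>(-1) ^ card I\<close>. The constant picks up both signs.\<close>

lemma hr_form_real:
  assumes "conj_form W = W" "has_type p q \<Phi>"
  shows "Im (hr_form I p q W \<Phi> \<Phi>) = 0"
proof -
  define \<Theta> where "\<Theta> = wedge (wedge W \<Phi>) (conj_form \<Phi>)"
  have "conj_form \<Theta> = wedge W (wedge (conj_form \<Phi>) \<Phi>)"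
    by (simp add: \<Theta>_def conj_wedge assms wedge_assoc)
  also have "wedge (conj_form \<Phi>) \<Phi> = (\<lambda>S. (-1) ^ ((q + p) * (p + q)) * wedge \<Phi> (conj_form \<Phi>) S)"
    by (rule wedge_graded_comm) (use assms has_type_conj has_type_deg in blast)+
  also have "wedge W \<dots> = (\<lambda>S. (-1) ^ ((q + p) * (p + q)) * \<Theta> S)"
    by (simp add: wedge_scale_right \<Theta>_def wedge_assoc)
  finally have 1: "conj_form \<Theta> (gens I) = (-1) ^ (p + q) * \<Theta> (gens I)"
    by (cases "even (p + q)") (simp_all add: add.commute)
  have "conj_form \<Theta> (gens I) = (-1) ^ card I * cnj (\<Theta> (gens I))"
    by (simp add: conj_form_altdef npairs_gens)
  with 1 have "(-1) ^ card I * ((-1) ^ card I * cnj (\<Theta> (gens I))) = (-1) ^ card I * ((-1) ^ (p + q) * \<Theta> (gens I))"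
    by simp
  then have "cnj (\<Theta> (gens I)) = (-1) ^ (card I + p + q) * \<Theta> (gens I)"
    by (simp add: power_add flip: mult.assoc power_mult_distrib)
  then have "cnj (hr_form I p q W \<Phi> \<Phi>) = hr_form I p q W \<Phi> \<Phi> * ((-1) ^ (card I + p + q) * (-1) ^ (card I + p + q))"
    unfolding hr_form_def \<Theta>_def[symmetric] by (simp add: cnj_hr_const)
  also have "\<dots> = hr_form I p q W \<Phi> \<Phi>" by (simp flip: power_mult_distrib)
  finally show ?thesis by (metis Reals_cnj_iff complex_is_Real_iff)
qed

text \<open>The factors of \<open>\<Omega>\<close>: \<open>card I - m\<close> of them positive definite, the remaining \<open>m - p - q\<close> of rank at
  least \<open>m\<close>. Restricting to a hyperplane lowers both \<open>card I\<close> and \<open>m\<close> by one.\<close>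

definition hr_data :: "nat set \<Rightarrow> nat \<Rightarrow> nat \<Rightarrow> nat \<Rightarrow> cform list \<Rightarrow> bool" where
  "hr_data I p q m fs \<longleftrightarrow> p + q \<le> m \<and> m \<le> card I \<and>
     (\<exists>ws as. fs = ws @ as \<and> length ws = card I - m \<and> length as = m - p - q \<and>
        (\<forall>w\<in>set ws. psd I (card I) w) \<and> (\<forall>a\<in>set as. psd I m a))"

text \<open>All bidegrees at once: positivity for (p,q) also uses hard Lefschetz for (p-1,q-1),
  which rests on the relations of that bidegree one dimension lower.\<close>

definition hodge_riemann :: "nat set \<Rightarrow> bool" where
  "hodge_riemann I \<longleftrightarrow> (\<forall>p q m fs b \<Phi>. hr_data I p q m fs \<longrightarrow> psd I m b \<longrightarrow> has_type p q \<Phi> \<longrightarrow>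
     zero_on I (wedge (wedge (wprod fs) b) \<Phi>) \<longrightarrow> \<not> zero_on I \<Phi> \<longrightarrow> Re (hr_form I p q (wprod fs) \<Phi> \<Phi>) > 0)"

text \<open>A complete pair is extracted without sign. At the top set this becomes the expansion
  along coordinate hyperplanes.\<close>

lemma wedge_diag_form:
  assumes "finite S" "finite I"
  shows "wedge (diag_form I d) X S = (\<Sum>j\<in>I. if gens {j} \<subseteq> S then \<i> * of_real (d j) * X (S - gens {j}) else 0)"
  unfolding diag_form_def wedge_sum_left
proof (intro sum.cong refl)
  fix j
  have "wedge (\<lambda>S. if S = gens {j} then \<i> * of_real (d j) else 0) X S =
     (\<Sum>A\<in>Pow S. if A = gens {j} then shuffle_sign (gens {j}) (S - gens {j}) * (\<i> * of_real (d j)) * X (S - gens {j}) else 0)"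
    unfolding wedge_def by (intro sum.cong) auto
  also have "\<dots> = (if gens {j} \<subseteq> S then \<i> * of_real (d j) * X (S - gens {j}) else 0)"
    using assms shuffle_sign_gens_left[of "S - gens {j}" j] by simp
  finally show "wedge (\<lambda>S. if S = gens {j} then \<i> * of_real (d j) else 0) X S =
     (if gens {j} \<subseteq> S then \<i> * of_real (d j) * X (S - gens {j}) else 0)" .
qed

section \<open>Hard Lefschetz from the relations on hyperplanes\<close>

lemma hr_const_remove:
  assumes "finite I" "j \<in> I"
  shows "hr_const I p q * \<i> = hr_const (I - {j}) p q"
proof -
  have "card I = Suc (card (I - {j}))" using assms by (metis card_Suc_Diff1)
  then show ?thesis by (simp add: hr_const_def)
qed

text \<open>A set of \<open>p + q\<close> generators meets at most \<open>p + q\<close> indices, so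
  it misses some \<open>j \<in> J\<close>, and its coefficient is already seen on that
  hyperplane.\<close>

lemma zero_on_if_restrictions:
  assumes I: "finite I" and J: "J \<subseteq> I" "p + q < card J" and t: "has_type p q \<Phi>"
    and z: "\<And>j. j \<in> J \<Longrightarrow> zero_on (I - {j}) \<Phi>"
  shows "zero_on I \<Phi>"
  unfolding zero_on_def
proof (intro allI impI)
  fix S assume S: "S \<subseteq> gens I"
  show "\<Phi> S = 0"
  proof (rule ccontr)
    assume nz: "\<Phi> S \<noteq> 0"
    then have c: "card S = p + q" "finite S" using t by (auto simp: has_type_def card_hol_antihol)
    then have "card ((\<lambda>x. x div 2) ` S) < card J" using J(2) card_image_le[of S "\<lambda>x. x div 2"] by simp
    then have "\<not> J \<subseteq> (\<lambda>x. x div 2) ` S" using card_mono[of "(\<lambda>x. x div 2) ` S" J] c(2) by auto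
    then obtain j where j: "j \<in> J" "j \<notin> (\<lambda>x. x div 2) ` S" by auto
    then have "S \<subseteq> gens (I - {j})" using S by (auto simp: gens_def)
    then show False using z[OF j(1)] nz by (auto simp: zero_on_def)
  qed
qed

text \<open>Lowering \<open>card I\<close> and \<open>m\<close> together keeps
  \<open>card I - m\<close>, so all of \<open>ws\<close> stays; \<open>m - p - q\<close> drops by
  one, which is the factor that has been split off.\<close>

lemma hr_data_restrict:
  assumes I: "finite I" "j \<in> I" and d: "length ws = card I - m" "length as = m - p - q - 1" "p + q < m" "m \<le> card I"
    "\<forall>w\<in>set ws. psd I (card I) w" "\<forall>a\<in>set as. psd I m a"
  shows "hr_data (I - {j}) p q (m - 1) (ws @ as)"
proof -
  have c: "card (I - {j}) = card I - 1" using I by simp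
  show ?thesis
    unfolding hr_data_def c using d psd_restrict[OF I]
    by (intro conjI exI[of _ ws] exI[of _ as]) auto
qed

lemma hard_lefschetz_step:
  assumes I: "finite I" and IH: "\<And>j. j \<in> I \<Longrightarrow> hodge_riemann (I - {j})"
    and a: "psd I m a"
    and d: "length ws = card I - m" "length as = m - p - q - 1" "p + q < m" "m \<le> card I"
      "\<forall>w\<in>set ws. psd I (card I) w" "\<forall>a\<in>set as. psd I m a"
    and t: "has_type p q \<Phi>" and z: "zero_on I (wedge (wedge (wprod (ws @ as)) a) \<Phi>)"
  shows "zero_on I \<Phi>"
proof -
  \<comment> \<open>The remaining factors and the form are quantified because each shear applied to
    \<open>a\<close> must be applied to them too.\<close>
  have "\<forall>ws as \<Phi>. length ws = card I - m \<longrightarrow> length as = m - p - q - 1 \<longrightarrow>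
      (\<forall>w\<in>set ws. psd I (card I) w) \<longrightarrow> (\<forall>a\<in>set as. psd I m a) \<longrightarrow> has_type p q \<Phi> \<longrightarrow>
      zero_on I (wedge (wedge (wprod (ws @ as)) a) \<Phi>) \<longrightarrow> zero_on I \<Phi>"
    using I a
  proof (rule psd_shear_induct; intro allI impI)
    fix a ws as \<Phi>
    assume a: "psd I m a" "diag_on I I a" and l: "length ws = card I - m" "length as = m - p - q - 1"
      "\<forall>w\<in>set ws. psd I (card I) w" "\<forall>a\<in>set as. psd I m a"
      and t: "has_type p q \<Phi>" and z: "zero_on I (wedge (wedge (wprod (ws @ as)) a) \<Phi>)"
    define W where "W = wprod (ws @ as)"
    define lam where "lam = (\<lambda>j. Re (herm_mat a j j))"
    define X where "X = wedge (wedge W \<Phi>) (conj_form \<Phi>)"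
    define Q where "Q = (\<lambda>j. hr_form (I - {j}) p q W \<Phi> \<Phi>)"
    have ta: "has_type 1 1 a" using a by (simp add: psd_def)
    have "wedge (wedge (wedge W a) \<Phi>) (conj_form \<Phi>) = wedge a X"
      unfolding X_def by (simp add: wedge_assoc wedge_comm11[OF ta])
    moreover have "wedge (wedge (wedge W a) \<Phi>) (conj_form \<Phi>) (gens I) = 0"
      using zero_on_wedge_left[OF z] by (auto simp: zero_on_def W_def)
    ultimately have "0 = wedge a X (gens I)" by simp
    also have "\<dots> = wedge (diag_form I lam) X (gens I)"
      by (rule wedge_cong) (use diag_on_form[OF I a] in \<open>auto simp: lam_def\<close>)
    also have "\<dots> = (\<Sum>j\<in>I. \<i> * of_real (lam j) * X (gens (I - {j})))"
      using I by (subst wedge_diag_form) (auto intro!: sum.cong simp: gens_Diff gens_subset_iff)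
    finally have "0 = hr_const I p q * (\<Sum>j\<in>I. \<i> * of_real (lam j) * X (gens (I - {j})))" by simp
    also have "\<dots> = (\<Sum>j\<in>I. of_real (lam j) * Q j)"
      unfolding sum_distrib_left
    proof (intro sum.cong refl)
      fix j assume j: "j \<in> I"
      have "hr_const I p q * (\<i> * of_real (lam j) * X (gens (I - {j})))
         = of_real (lam j) * ((hr_const I p q * \<i>) * X (gens (I - {j})))" by (simp add: mult_ac)
      \<comment> \<open>The \<open>\<i>\<close> carried by the extracted pair is exactly the factor
        by which the constants for \<open>I\<close> and \<open>I - {j}\<close> differ.\<close>
      also have "\<dots> = of_real (lam j) * Q j"
        unfolding hr_const_remove[OF I j] Q_def hr_form_def X_def ..
      finally show "hr_const I p q * (\<i> * of_real (lam j) * X (gens (I - {j}))) = of_real (lam j) * Q j" .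
    qed
    finally have "Re (\<Sum>j\<in>I. of_real (lam j) * Q j) = 0" by simp
    then have sum0: "(\<Sum>j\<in>I. lam j * Re (Q j)) = 0" by simp
    have lam_nn: "lam j \<ge> 0" if "j \<in> I" for j using psd_diag_nonneg(2)[OF I a(1) that] by (simp add: lam_def)
    \<comment> \<open>On the hyperplane \<open>j\<close> the vanishing product restricts to a
      primitivity condition, with \<open>a\<close> in the role of the extra form
      \<open>b\<close>.\<close>
    have Qpos: "Re (Q j) > 0" if j: "j \<in> I" "\<not> zero_on (I - {j}) \<Phi>" for j
    proof -
      have "hr_data (I - {j}) p q (m - 1) (ws @ as)" using hr_data_restrict[OF I j(1)] l d by blast
      moreover have "psd (I - {j}) (m - 1) a" by (rule psd_restrict[OF I j(1) a(1)])
      moreover have "zero_on (I - {j}) (wedge (wedge (wprod (ws @ as)) a) \<Phi>)"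
        using z zero_on_subset by blast
      ultimately show ?thesis
        using IH[OF j(1)] t j(2) unfolding hodge_riemann_def Q_def W_def by blast
    qed
    have Q0: "Re (Q j) = 0" if "zero_on (I - {j}) \<Phi>" for j
    proof -
      have "zero_on (I - {j}) (wedge (wedge W \<Phi>) (conj_form \<Phi>))"
        using zero_on_wedge_left[OF zero_on_wedge_right[OF that]] .
      then show ?thesis by (simp add: Q_def hr_form_def zero_on_def)
    qed
    have nn: "lam j * Re (Q j) \<ge> 0" if "j \<in> I" for j
      using lam_nn[OF that] Qpos[OF that] Q0[of j] by (cases "zero_on (I - {j}) \<Phi>") auto
    have zj: "zero_on (I - {j}) \<Phi>" if "j \<in> {j\<in>I. lam j > 0}" for j
    proof (rule ccontr)
      assume "\<not> zero_on (I - {j}) \<Phi>"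
      then have "lam j * Re (Q j) > 0" using that Qpos by simp
      moreover have "lam j * Re (Q j) = 0" using sum_nonneg_0[OF I nn sum0, of j] that by simp
      ultimately show False by simp
    qed
    \<comment> \<open>The rank bound supplies at least \<open>m > p + q\<close> hyperplanes of
      positive weight, enough to detect every coefficient.\<close>
    have "p + q < card {j\<in>I. lam j > 0}" using rank_diag[OF I a] d by (simp add: lam_def)
    moreover have "{j\<in>I. lam j > 0} \<subseteq> I" by blast
    ultimately show "zero_on I \<Phi>" using zero_on_if_restrictions[OF I _ _ t] zj by blast
  next
    fix a j k c ws as \<Phi>
    assume j: "psd I m a" "j \<in> I" "k \<in> I" "j \<noteq> k"
      and IHs: "\<forall>ws as \<Phi>. length ws = card I - m \<longrightarrow> length as = m - p - q - 1 \<longrightarrow>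
      (\<forall>w\<in>set ws. psd I (card I) w) \<longrightarrow> (\<forall>a\<in>set as. psd I m a) \<longrightarrow> has_type p q \<Phi> \<longrightarrow>
      zero_on I (wedge (wedge (wprod (ws @ as)) (shear j k c a)) \<Phi>) \<longrightarrow> zero_on I \<Phi>"
      and l: "length ws = card I - m" "length as = m - p - q - 1"
      "\<forall>w\<in>set ws. psd I (card I) w" "\<forall>a\<in>set as. psd I m a"
      and t: "has_type p q \<Phi>" and z: "zero_on I (wedge (wedge (wprod (ws @ as)) a) \<Phi>)"
    let ?T = "shear j k c"
    have "wedge (wedge (wprod (map ?T ws @ map ?T as)) (?T a)) (?T \<Phi>) = ?T (wedge (wedge (wprod (ws @ as)) a) \<Phi>)"
      using j by (simp add: shear_wedge wprod_append wprod_shear)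
    moreover have "zero_on I (?T (wedge (wedge (wprod (ws @ as)) a) \<Phi>))"
      using z shear_zero_on[OF j(2)] unfolding zero_on_def by blast
    ultimately have "zero_on I (wedge (wedge (wprod (map ?T ws @ map ?T as)) (?T a)) (?T \<Phi>))" by simp
    moreover have "\<forall>w\<in>set (map ?T ws). psd I (card I) w" "\<forall>a\<in>set (map ?T as). psd I m a"
      using l psd_shear[OF I j(2-4)] by auto
    ultimately have "zero_on I (?T \<Phi>)"
      using IHs[THEN spec, THEN spec, THEN spec, of "map ?T ws" "map ?T as" "?T \<Phi>"] l(1,2) has_type_shear[OF t j(4)]
      by simp
    then have "zero_on I (shear j k (- c) (?T \<Phi>))"
      using shear_zero_on[OF j(2)] unfolding zero_on_def by blast
    then show "zero_on I \<Phi>" using shear_inverse[OF j(4) has_type_fin[OF t]] by simp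
  qed
  then show ?thesis using d t z by blast
qed

text \<open>A factor must be split off. If \<open>m = p + q\<close>, none of rank \<open>m\<close>
  is present, and the same data are reread with \<open>card I\<close> in place of \<open>m\<close>,
  all factors then having full rank. With no factors whatever the product is
  \<open>one_form\<close>.\<close>

lemma hard_lefschetz:
  assumes I: "finite I" and IH: "\<And>j. j \<in> I \<Longrightarrow> hodge_riemann (I - {j})"
    and d: "hr_data I p q m fs" and t: "has_type p q \<Phi>" and z: "zero_on I (wedge (wprod fs) \<Phi>)"
  shows "zero_on I \<Phi>"
proof -
  have nonempty: "zero_on I \<Phi>" if pq: "p + q \<le> m" and m: "m \<le> card I" and fs: "fs = ws @ as"
    and l: "length ws = card I - m" "length as = m - p - q" "as \<noteq> []"
    and ps: "\<forall>w\<in>set ws. psd I (card I) w" "\<forall>a\<in>set as. psd I m a" for m ws as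
  proof -
    define bs a where "bs = butlast as" and "a = last as"
    have as: "as = bs @ [a]" using l by (simp add: bs_def a_def)
    have "psd I m a" using ps by (simp add: as)
    moreover have "wprod fs = wedge (wprod (ws @ bs)) a"
      using has_type_fin[of 1 1 a] calculation by (simp add: fs as wprod_append wedge_one_right psd_def wedge_assoc)
    moreover have "length bs = m - p - q - 1" "p + q < m" using l by (auto simp: as)
    ultimately show ?thesis
      using hard_lefschetz_step[OF I IH, of m a ws bs p q \<Phi>] l ps m t z by (auto simp: as)
  qed
  obtain ws as where d': "p + q \<le> m" "m \<le> card I" "fs = ws @ as" "length ws = card I - m" "length as = m - p - q"
      "\<forall>w\<in>set ws. psd I (card I) w" "\<forall>a\<in>set as. psd I m a"
    using d unfolding hr_data_def by blast
  show ?thesis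
  proof (cases "as = []")
    case False
    then show ?thesis using nonempty d' by blast
  next
    case True
    show ?thesis
    proof (cases "ws = []")
      case True
      then show ?thesis using z \<open>as = []\<close> has_type_fin[OF t] by (simp add: d' wedge_one_left)
    next
      case False
      show ?thesis
        by (rule nonempty[of "card I" "[]" ws]) (use d' False True in auto)
    qed
  qed
qed

subsection \<open>The standard Kaehler form\<close>

definition subsets_of_card :: "'a set \<Rightarrow> nat \<Rightarrow> 'a set set" where
  "subsets_of_card P k = {K. K \<subseteq> P \<and> card K = k}"

lemma finite_subsets_of_card [simp]: "finite P \<Longrightarrow> finite (subsets_of_card P k)"
  by (simp add: subsets_of_card_def)

lemma sum_alternating_Pow:
  assumes "finite X"
  shows "(\<Sum>W\<in>Pow X. (-1) ^ card W) = (if X = {} then 1 else (0::complex))"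
proof (cases "X = {}")
  case False
  then obtain x where x: "x \<in> X" by auto
  define R where "R = X - {x}"
  have R: "finite R" "x \<notin> R" "X = insert x R" using assms x by (auto simp: R_def)
  have "(\<Sum>W\<in>Pow X. (-1) ^ card W) = (\<Sum>B\<in>Pow R. (-1) ^ card B + (-1) ^ card (insert x B) :: complex)"
    unfolding R(3) by (rule sum_Pow_insert[OF R(1,2)])
  also have "\<dots> = 0"
  proof (rule sum.neutral, rule ballI)
    fix B assume "B \<in> Pow R"
    then have "finite B" "x \<notin> B" using R finite_subset by auto
    then show "(-1) ^ card B + (-1) ^ card (insert x B) = (0::complex)" by simp
  qed
  finally show ?thesis using False by simp
qed simp

text \<open>Each set of size \<open>Suc k\<close> arises once from each of its elements; this yields
  the factorial in \<open>std_form_power\<close>.\<close>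

lemma sum_subsets_insert:
  assumes "finite P"
  shows "(\<Sum>j\<in>P. \<Sum>K\<in>subsets_of_card (P - {j}) k. F (insert j K)) = of_nat (Suc k) * (\<Sum>L\<in>subsets_of_card P (Suc k). F L :: complex)"
proof -
  have "(\<Sum>j\<in>P. \<Sum>K\<in>subsets_of_card (P - {j}) k. F (insert j K))
     = (\<Sum>(j,K)\<in>Sigma P (\<lambda>j. subsets_of_card (P - {j}) k). F (insert j K))"
    by (rule sum.Sigma) (use assms in auto)
  also have "\<dots> = (\<Sum>(L,j)\<in>Sigma (subsets_of_card P (Suc k)) (\<lambda>L. L). F L)"
  proof (rule sum.reindex_bij_witness[of _ "\<lambda>(L,j). (j, L - {j})" "\<lambda>(j,K). (insert j K, j)"])
    fix z assume "z \<in> Sigma P (\<lambda>j. subsets_of_card (P - {j}) k)"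
    then obtain j K where z: "z = (j,K)" "j \<in> P" "K \<subseteq> P - {j}" "card K = k"
      by (auto simp: subsets_of_card_def)
    then have "finite K" "j \<notin> K" using assms finite_subset[of K P] by auto
    then show "(case z of (j,K) \<Rightarrow> (insert j K, j)) \<in> Sigma (subsets_of_card P (Suc k)) (\<lambda>L. L)"
      using z by (auto simp: subsets_of_card_def)
    show "(case (case z of (j,K) \<Rightarrow> (insert j K, j)) of (L,j) \<Rightarrow> (j, L - {j})) = z"
      using z by auto
    show "(case (case z of (j,K) \<Rightarrow> (insert j K, j)) of (L,j) \<Rightarrow> F L) = (case z of (j,K) \<Rightarrow> F (insert j K))"
      using z by simp
  next
    fix z assume "z \<in> Sigma (subsets_of_card P (Suc k)) (\<lambda>L. L)"
    then obtain L j where z: "z = (L,j)" "L \<subseteq> P" "card L = Suc k" "j \<in> L"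
      by (auto simp: subsets_of_card_def)
    moreover have "finite L" using z assms finite_subset by auto
    ultimately show "(case z of (L,j) \<Rightarrow> (j, L - {j})) \<in> Sigma P (\<lambda>j. subsets_of_card (P - {j}) k)"
      "(case (case z of (L,j) \<Rightarrow> (j, L - {j})) of (j,K) \<Rightarrow> (insert j K, j)) = z"
      by (auto simp: subsets_of_card_def)
  qed
  also have "\<dots> = (\<Sum>L\<in>subsets_of_card P (Suc k). \<Sum>j\<in>L. F L)"
    by (rule sum.Sigma[symmetric]) (use assms in \<open>auto simp: subsets_of_card_def intro: finite_subset\<close>)
  also have "\<dots> = (\<Sum>L\<in>subsets_of_card P (Suc k). of_nat (Suc k) * F L)"
    by (rule sum.cong) (auto simp: subsets_of_card_def)
  finally show ?thesis by (simp only: sum_distrib_left)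
qed

text \<open>A subset of size \<open>k\<close> is missed by exactly \<open>card P - k\<close>
  elements of \<open>P\<close>.\<close>

lemma sum_subsets_avoid:
  assumes "finite P"
  shows "(\<Sum>j\<in>P. \<Sum>K\<in>subsets_of_card (P - {j}) k. F K) = of_nat (card P - k) * (\<Sum>K\<in>subsets_of_card P k. F K :: complex)"
proof -
  have s: "subsets_of_card (P - {j}) k = {K\<in>subsets_of_card P k. j \<notin> K}" for j
    by (auto simp: subsets_of_card_def)
  have "(\<Sum>j\<in>P. \<Sum>K\<in>subsets_of_card (P - {j}) k. F K) = (\<Sum>j\<in>P. \<Sum>K\<in>subsets_of_card P k. if j \<notin> K then F K else 0)"
    unfolding s using assms by (intro sum.cong refl sum.inter_filter) auto
  also have "\<dots> = (\<Sum>K\<in>subsets_of_card P k. \<Sum>j\<in>P. if j \<notin> K then F K else 0)"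
    by (rule sum.swap)
  also have "\<dots> = (\<Sum>K\<in>subsets_of_card P k. of_nat (card P - k) * F K)"
  proof (rule sum.cong[OF refl])
    fix K assume "K \<in> subsets_of_card P k"
    then have K: "K \<subseteq> P" "card K = k" by (auto simp: subsets_of_card_def)
    have "(\<Sum>j\<in>P. if j \<notin> K then F K else 0) = (\<Sum>j\<in>{j\<in>P. j \<notin> K}. F K)"
      by (rule sum.inter_filter[symmetric]) (use assms in auto)
    also have "{j\<in>P. j \<notin> K} = P - K" by auto
    also have "(\<Sum>j\<in>P - K. F K) = of_nat (card P - k) * F K"
      using K assms finite_subset[of K P] by (simp add: card_Diff_subset)
    finally show "(\<Sum>j\<in>P. if j \<notin> K then F K else 0) = of_nat (card P - k) * F K" .
  qed
  finally show ?thesis by (simp only: sum_distrib_left)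
qed

text \<open>Inclusion--exclusion over \<open>U\<close>: by primitivity only the term of \<open>U\<close> itself survives.\<close>

lemma primitive_subset_sum:
  fixes f :: "'a set \<Rightarrow> complex"
  assumes C: "finite C" "2 * s \<le> card C" and U: "U \<subseteq> C" "card U = s"
    and prim: "\<And>T. T \<subseteq> C \<Longrightarrow> card T = card C - s + 1 \<Longrightarrow> (\<Sum>K\<in>subsets_of_card T s. f K) = 0"
  shows "(\<Sum>K\<in>subsets_of_card (C - U) s. f K) = (-1) ^ s * f U"
proof -
  define g where "g = (\<lambda>T. \<Sum>K\<in>subsets_of_card T s. f K)"
  have fin: "finite T" if "T \<subseteq> C" for T using that C finite_subset by blast
  \<comment> \<open>Primitivity speaks of sets of size \<open>card C - s + 1\<close>; averaging over
    deletions of one element carries the vanishing to all larger sets, the factor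
    \<open>card T - s\<close> being nonzero.\<close>
  have g0: "T \<subseteq> C \<Longrightarrow> card C - s + 1 \<le> card T \<Longrightarrow> g T = 0" for T
  proof (induction "card T" arbitrary: T rule: less_induct)
    case less
    show ?case
    proof (cases "card T = card C - s + 1")
      case True
      then show ?thesis using prim less.prems by (simp add: g_def)
    next
      case False
      have fT: "finite T" using fin less.prems by simp
      have "g (T - {j}) = 0" if "j \<in> T" for j
        by (rule less.hyps) (use that fT less.prems False in \<open>auto simp: card_Diff1_less\<close>)
      then have "(\<Sum>j\<in>T. g (T - {j})) = 0" by simp
      then have "of_nat (card T - s) * g T = 0"
        using sum_subsets_avoid[OF fT, where k = s and F = f] by (simp add: g_def)
      moreover have "card T - s \<noteq> 0" using less.prems C by simp
      ultimately show ?thesis by simp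
    qed
  qed
  have fU: "finite U" using fin U by simp
  have "(\<Sum>W\<in>Pow U. (-1) ^ card W * g (C - W)) = (\<Sum>W\<in>Pow U. \<Sum>K\<in>subsets_of_card C s. if K \<inter> W = {} then (-1) ^ card W * f K else 0)"
  proof (rule sum.cong[OF refl])
    fix W assume "W \<in> Pow U"
    have "subsets_of_card (C - W) s = {K\<in>subsets_of_card C s. K \<inter> W = {}}"
      by (auto simp: subsets_of_card_def)
    then have "g (C - W) = (\<Sum>K\<in>subsets_of_card C s. if K \<inter> W = {} then f K else 0)"
      unfolding g_def using C by (simp add: sum.inter_filter)
    then show "(-1) ^ card W * g (C - W) = (\<Sum>K\<in>subsets_of_card C s. if K \<inter> W = {} then (-1) ^ card W * f K else 0)"
      by (simp add: sum_distrib_left if_distrib cong: if_cong)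
  qed
  also have "\<dots> = (\<Sum>K\<in>subsets_of_card C s. \<Sum>W\<in>Pow U. if K \<inter> W = {} then (-1) ^ card W * f K else 0)"
    by (rule sum.swap)
  also have "\<dots> = (\<Sum>K\<in>subsets_of_card C s. if K = U then f K else 0)"
  proof (rule sum.cong[OF refl])
    fix K assume "K \<in> subsets_of_card C s"
    then have K: "K \<subseteq> C" "card K = s" by (auto simp: subsets_of_card_def)
    have "{W\<in>Pow U. K \<inter> W = {}} = Pow (U - K)" by auto
    then have "(\<Sum>W\<in>Pow U. if K \<inter> W = {} then (-1) ^ card W * f K else 0) = (\<Sum>W\<in>Pow (U - K). (-1) ^ card W * f K)"
      using fU by (simp flip: sum.inter_filter)
    also have "\<dots> = (if U - K = {} then 1 else 0) * f K"
      using sum_alternating_Pow[of "U - K"] fU by (simp flip: sum_distrib_right)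
    also have "U - K = {} \<longleftrightarrow> K = U"
      using K U fin[of K] card_subset_eq[of K U] by auto
    finally show "(\<Sum>W\<in>Pow U. if K \<inter> W = {} then (-1) ^ card W * f K else 0) = (if K = U then f K else 0)" by simp
  qed
  also have "\<dots> = f U" using C U by (simp add: subsets_of_card_def)
  finally have "f U = (\<Sum>W\<in>Pow U. (-1) ^ card W * g (C - W))" by simp
  \<comment> \<open>For a proper subset \<open>W\<close> of \<open>U\<close> the set
    \<open>C - W\<close> has at least \<open>card C - s + 1\<close> elements, so \<open>g\<close>
    vanishes there.\<close>
  also have "\<dots> = (\<Sum>W\<in>Pow U. if W = U then (-1) ^ s * g (C - U) else 0)"
  proof (rule sum.cong[OF refl])
    fix W assume "W \<in> Pow U"
    then have W: "W \<subseteq> U" by simp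
    show "(-1) ^ card W * g (C - W) = (if W = U then (-1) ^ s * g (C - U) else 0)"
    proof (cases "W = U")
      case False
      then have "card W < s" using W U fU by (metis psubsetI psubset_card_mono)
      moreover have "card (C - W) = card C - card W" using W U fin by (intro card_Diff_subset) auto
      ultimately have "g (C - W) = 0" using C by (intro g0) auto
      then show ?thesis using False by simp
    qed (use U in simp)
  qed
  also have "\<dots> = (-1) ^ s * g (C - U)" using fU by simp
  finally have "(-1) ^ s * f U = ((-1) ^ s * (-1) ^ s) * g (C - U)" by simp
  also have "(-1) ^ s * (-1) ^ s = (1::complex)" by (simp flip: power_mult_distrib)
  finally show ?thesis by (simp add: g_def)
qed

section \<open>Powers of the standard form\<close>

definition std_form :: "nat set \<Rightarrow> cform" where
  "std_form I = diag_form I (\<lambda>_. 1)"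

definition pair_set :: "nat set \<Rightarrow> nat set" where
  "pair_set S = {j. gens {j} \<subseteq> S}"

lemma pair_set_remove: "pair_set (S - gens {j}) = pair_set S - {j}"
proof (intro equalityI subsetI)
  fix i assume "i \<in> pair_set (S - gens {j})"
  then have i: "gens {i} \<subseteq> S - gens {j}" by (simp add: pair_set_def)
  moreover have "2 * i \<in> gens {i}" by (simp add: gens_def)
  ultimately have "2 * i \<notin> gens {j}" by blast
  then show "i \<in> pair_set S - {j}" using i by (auto simp: pair_set_def gens_def)
qed (auto simp: pair_set_def gens_def)

lemma pair_set_subset: "S \<subseteq> gens I \<Longrightarrow> pair_set S \<subseteq> I"
  unfolding pair_set_def using gens_subset_iff[of "{_}" I] by blast

text \<open>The power removes \<open>k\<close> complete pairs from \<open>S\<close>, in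
  \<open>fact k\<close> orders; each removal contributes \<open>\<i>\<close> and no sign.\<close>

lemma std_form_power:
  assumes I: "finite I" and f: "fin_form \<Phi>" and "S \<subseteq> gens I"
  shows "wedge (wprod (replicate k (std_form I))) \<Phi> S =
    \<i> ^ k * fact k * (\<Sum>K\<in>subsets_of_card (pair_set S) k. \<Phi> (S - gens K))"
  using assms(3)
proof (induction k arbitrary: S)
  case 0
  have "finite S" using 0 I finite_gens finite_subset by blast
  then have "pair_set S \<subseteq> I" "finite (pair_set S)" using pair_set_subset[OF 0] I finite_subset by auto
  then have "subsets_of_card (pair_set S) 0 = {{}}" 
    by (auto simp: subsets_of_card_def dest: finite_subset)
  then show ?case using f by (simp add: wedge_one_left gens_def)
next
  case (Suc k)
  define P where "P = pair_set S"
  have fS: "finite S" using Suc.prems I finite_gens finite_subset by blast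
  have P: "P \<subseteq> I" "finite P" using pair_set_subset[OF Suc.prems] I finite_subset by (auto simp: P_def)
  define Y where "Y = wedge (wprod (replicate k (std_form I))) \<Phi>"
  have "wedge (wprod (replicate (Suc k) (std_form I))) \<Phi> S = wedge (diag_form I (\<lambda>_. 1)) Y S"
    by (simp add: Y_def wedge_assoc std_form_def)
  also have "\<dots> = (\<Sum>j\<in>I. if gens {j} \<subseteq> S then \<i> * Y (S - gens {j}) else 0)"
    using wedge_diag_form[OF fS I, of "\<lambda>_. 1" Y] by (simp only: of_real_1 mult_1_right)
  also have "\<dots> = (\<Sum>j\<in>{j\<in>I. gens {j} \<subseteq> S}. \<i> * Y (S - gens {j}))"
    using I by (simp add: sum.inter_filter)
  also have "{j\<in>I. gens {j} \<subseteq> S} = P" using P by (auto simp: P_def pair_set_def)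
  also have "(\<Sum>j\<in>P. \<i> * Y (S - gens {j})) = (\<Sum>j\<in>P. \<i> ^ Suc k * fact k * (\<Sum>K\<in>subsets_of_card (P - {j}) k. \<Phi> (S - gens (insert j K))))"
  proof (rule sum.cong[OF refl])
    fix j assume "j \<in> P"
    have "S - gens {j} \<subseteq> gens I" using Suc.prems by blast
    then have "Y (S - gens {j}) = \<i> ^ k * fact k * (\<Sum>K\<in>subsets_of_card (P - {j}) k. \<Phi> (S - gens {j} - gens K))"
      using Suc.IH[of "S - gens {j}"] by (simp add: Y_def pair_set_remove P_def)
    moreover have "S - gens {j} - gens K = S - gens (insert j K)" for K by (auto simp: gens_def)
    ultimately show "\<i> * Y (S - gens {j}) = \<i> ^ Suc k * fact k * (\<Sum>K\<in>subsets_of_card (P - {j}) k. \<Phi> (S - gens (insert j K)))"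
      by simp
  qed
  also have "\<dots> = \<i> ^ Suc k * fact k * (\<Sum>j\<in>P. \<Sum>K\<in>subsets_of_card (P - {j}) k. \<Phi> (S - gens (insert j K)))"
    by (simp only: sum_distrib_left)
  also have "\<dots> = \<i> ^ Suc k * fact k * (of_nat (Suc k) * (\<Sum>L\<in>subsets_of_card P (Suc k). \<Phi> (S - gens L)))"
    using sum_subsets_insert[OF P(2), where k = k and F = "\<lambda>L. \<Phi> (S - gens L)"] by simp
  also have "\<dots> = \<i> ^ Suc k * fact (Suc k) * (\<Sum>L\<in>subsets_of_card P (Suc k). \<Phi> (S - gens L))"
    by (simp only: fact_Suc of_nat_mult mult_ac)
  finally show ?case by (simp only: P_def)
qed

text \<open>The classical identity of Weil in coordinates: on primitive forms this Lefschetz power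
  is the Hodge star up to constants. The unpaired part \<open>Z\<close> of \<open>S\<close> is kept
  fixed; what varies is the set of complete pairs inside the free indices \<open>C\<close>, and the
  claim becomes \<open>primitive_subset_sum\<close>.\<close>

lemma std_form_power_compl:
  assumes I: "finite I" and t: "has_type p q \<Phi>" and pq: "p + q \<le> card I"
    and prim: "zero_on I (wedge (wprod (replicate (card I - p - q + 1) (std_form I))) \<Phi>)"
    and S: "S \<subseteq> gens I" "\<Phi> S \<noteq> 0"
  shows "wedge (wprod (replicate (card I - p - q) (std_form I))) \<Phi> (gens I - gswap ` S)
    = \<i> ^ (card I - p - q) * fact (card I - p - q) * (-1) ^ npairs S * \<Phi> S"
proof -
  define r where "r = card I - p - q"
  define Z where "Z = {x\<in>S. gswap x \<notin> S}"
  define D where "D = (\<lambda>x. x div 2) ` Z"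
  define C where "C = I - D"
  define U where "U = pair_set S"
  have f: "fin_form \<Phi>" using t has_type_fin by blast
  have fS: "finite S" and cS: "card S = p + q"
    using S t by (auto simp: has_type_def card_hol_antihol)
  have ZI: "Z \<subseteq> gens I" using S by (auto simp: Z_def)
  have DI: "D \<subseteq> I" using ZI by (auto simp: D_def gens_def)
  have same: "y = x \<or> y = gswap x" if "x div 2 = y div 2" for x y :: nat
    using that by (auto simp: gswap_def elim!: evenE oddE)
  have cD: "card D = card Z"
    unfolding D_def
  proof (rule card_image, rule inj_onI)
    fix x y assume "x \<in> Z" "y \<in> Z" "x div 2 = y div 2"
    then show "x = y" using same[of x y] by (auto simp: Z_def)
  qed
  have gens2: "gens {x div 2} = {x, gswap x}" for x
  proof (intro equalityI subsetI)
    fix y assume "y \<in> gens {x div 2}"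
    then show "y \<in> {x, gswap x}" using same[of x y] by (auto simp: gens_def)
  qed (auto simp: gens_def)
  have UC: "U \<subseteq> C"
  proof
    fix j assume j: "j \<in> U"
    have "j \<in> I" using j pair_set_subset[OF S(1)] by (auto simp: U_def)
    moreover have "j \<notin> D"
    proof
      assume "j \<in> D"
      then obtain x where x: "x \<in> Z" "j = x div 2" by (auto simp: D_def)
      then have "gswap x \<in> S" using j gens2[of x] by (auto simp: U_def pair_set_def)
      then show False using x by (simp add: Z_def)
    qed
    ultimately show "j \<in> C" by (simp add: C_def)
  qed
  have SZU: "S = Z \<union> gens U"
  proof (intro equalityI subsetI)
    fix x assume x: "x \<in> S"
    show "x \<in> Z \<union> gens U"
    proof (cases "gswap x \<in> S")
      case True
      then have "gens {x div 2} \<subseteq> S" using x gens2 by auto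
      then show ?thesis by (simp add: gens_def U_def pair_set_def)
    qed (use x in \<open>simp add: Z_def\<close>)
  next
    fix x assume "x \<in> Z \<union> gens U"
    then show "x \<in> S" using gens2[of x] by (auto simp: Z_def gens_def U_def pair_set_def)
  qed
  have dis: "Z \<inter> gens C = {}" by (auto simp: C_def D_def gens_def)
  have ps: "pair_set (Z \<union> gens T) = T" if "T \<subseteq> C" for T
  proof (intro equalityI subsetI)
    fix j assume "j \<in> pair_set (Z \<union> gens T)"
    then have j: "gens {j} \<subseteq> Z \<union> gens T" by (simp add: pair_set_def)
    show "j \<in> T"
    proof (rule ccontr)
      assume "j \<notin> T"
      then have "2 * j \<in> Z" "2 * j + 1 \<in> Z" using j by (auto simp: gens_sing, auto simp: gens_def)
      then show False by (auto simp: Z_def gswap_def)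
    qed
  next
    fix j assume "j \<in> T"
    then show "j \<in> pair_set (Z \<union> gens T)" by (auto simp: pair_set_def gens_def)
  qed
  have fC: "finite C" using I by (simp add: C_def)
  have cU: "npairs S = card U"
    unfolding npairs_def
  proof (rule bij_betw_same_card[of "\<lambda>x. x div 2"], rule bij_betw_byWitness[of _ "\<lambda>j. 2 * j"])
    show "(\<lambda>x. x div 2) ` {x\<in>S. even x \<and> gswap x \<in> S} \<subseteq> U"
      using gens2 by (auto simp: U_def pair_set_def)
    show "(\<lambda>j. 2 * j) ` U \<subseteq> {x\<in>S. even x \<and> gswap x \<in> S}"
      by (auto simp: U_def pair_set_def gens_sing gswap_def)
  qed auto
  have cg: "card (gens U) = 2 * card U"
    using card_hol_antihol[of "gens U"] finite_subset[OF UC fC] by (simp add: hol_deg_gens antihol_deg_gens)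
  have "card S = card Z + 2 * card U"
    using SZU cg card_Un_disjoint[of Z "gens U"] fS dis gens_mono[OF UC] by (metis disjoint_iff finite_Un subsetD)
  \<comment> \<open>Consequently \<open>card C - card U + 1 = (r + 1) + card U\<close>: the power
    \<open>r + 1\<close> vanishing by primitivity gives exactly the sums required in
    \<open>primitive_subset_sum\<close>.\<close>
  then have cC: "card C = r + 2 * card U"
    using card_Diff_subset[OF finite_subset[OF DI I] DI] cD cS pq by (simp add: C_def r_def)
  define F where "F = (\<lambda>K. \<Phi> (Z \<union> gens K))"
  \<comment> \<open>Removing \<open>k\<close> of \<open>k + s\<close> pairs leaves \<open>s\<close>;
    passing to complements in \<open>T\<close> turns a sum over removed pairs into one over
    remaining pairs.\<close>
  have pw: "wedge (wprod (replicate k (std_form I))) \<Phi> (Z \<union> gens T) = \<i> ^ k * fact k * (\<Sum>K\<in>subsets_of_card T s. F K)"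
    if T: "T \<subseteq> C" "card T = k + s" for T k s
  proof -
    have fT: "finite T" using T fC finite_subset by blast
    have "Z \<union> gens T \<subseteq> gens I" using ZI gens_mono[of T I] T by (auto simp: C_def)
    then have "wedge (wprod (replicate k (std_form I))) \<Phi> (Z \<union> gens T) =
       \<i> ^ k * fact k * (\<Sum>K\<in>subsets_of_card T k. \<Phi> (Z \<union> gens T - gens K))"
      using std_form_power[OF I f, of "Z \<union> gens T" k] ps[OF T(1)] by simp
    also have "(\<Sum>K\<in>subsets_of_card T k. \<Phi> (Z \<union> gens T - gens K)) = (\<Sum>K\<in>subsets_of_card T s. F K)"
    proof (rule sum.reindex_bij_witness[of _ "\<lambda>K. T - K" "\<lambda>K. T - K"])
      fix K assume "K \<in> subsets_of_card T k"
      then have K: "K \<subseteq> T" "card K = k" by (auto simp: subsets_of_card_def)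
      show "T - (T - K) = K" using K by auto
      show "T - K \<in> subsets_of_card T s"
        using K T card_Diff_subset[OF finite_subset[OF K(1) fT] K(1)] by (auto simp: subsets_of_card_def)
      have "Z \<inter> gens K = {}" using dis gens_mono[of K C] K T by blast
      then have "Z \<union> gens T - gens K = Z \<union> gens (T - K)" by (auto simp: gens_Diff)
      then show "F (T - K) = \<Phi> (Z \<union> gens T - gens K)" by (simp add: F_def)
    next
      fix K assume "K \<in> subsets_of_card T s"
      then have K: "K \<subseteq> T" "card K = s" by (auto simp: subsets_of_card_def)
      show "T - (T - K) = K" using K by auto
      show "T - K \<in> subsets_of_card T k"
        using K T card_Diff_subset[OF finite_subset[OF K(1) fT] K(1)] by (auto simp: subsets_of_card_def)
    qed
    finally show ?thesis .
  qed
  have "(\<Sum>K\<in>subsets_of_card (C - U) (card U). F K) = (-1) ^ card U * F U"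
  proof (rule primitive_subset_sum[OF fC _ UC refl])
    show "2 * card U \<le> card C" using cC by simp
    fix T assume T: "T \<subseteq> C" "card T = card C - card U + 1"
    have "Z \<union> gens T \<subseteq> gens I" using ZI gens_mono[of T I] T by (auto simp: C_def)
    then have "wedge (wprod (replicate (r + 1) (std_form I))) \<Phi> (Z \<union> gens T) = 0"
      using prim unfolding zero_on_def r_def by blast
    moreover have "card T = (r + 1) + card U" using T cC by simp
    ultimately have "\<i> ^ (r + 1) * fact (r + 1) * (\<Sum>K\<in>subsets_of_card T (card U). F K) = 0"
      using pw[OF T(1), of "r + 1" "card U"] by metis
    moreover have "\<i> ^ (r + 1) * fact (r + 1) \<noteq> 0" by (simp del: fact_Suc)
    ultimately show "(\<Sum>K\<in>subsets_of_card T (card U). F K) = 0" by (metis mult_eq_0_iff)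
  qed
  moreover have "card (C - U) = r + card U"
    using cC card_Diff_subset[OF finite_subset[OF UC fC] UC] by simp
  ultimately have "wedge (wprod (replicate r (std_form I))) \<Phi> (Z \<union> gens (C - U)) = \<i> ^ r * fact r * ((-1) ^ card U * F U)"
    using pw[of "C - U" r "card U"] by simp
  \<comment> \<open>Conjugation followed by complement fixes the unpaired part and replaces the
    complete pairs \<open>U\<close> by \<open>C - U\<close>.\<close>
  moreover have "gens I - gswap ` S = Z \<union> gens (C - U)"
  proof (intro equalityI subsetI)
    fix x assume x: "x \<in> gens I - gswap ` S"
    then have gx: "gswap x \<notin> S" and xI: "x div 2 \<in> I" by (auto simp: mem_gswap_image gens_def)
    show "x \<in> Z \<union> gens (C - U)"
    proof (cases "x \<in> S")
      case False
      have "x div 2 \<notin> D"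
      proof
        assume "x div 2 \<in> D"
        then obtain y where "y \<in> Z" "y div 2 = x div 2" by (auto simp: D_def)
        then show False using same[of y x] False gx by (auto simp: Z_def)
      qed
      moreover have "x div 2 \<notin> U" using gens2[of x] False by (auto simp: U_def pair_set_def)
      ultimately show ?thesis using xI by (simp add: gens_def C_def)
    qed (use gx in \<open>simp add: Z_def\<close>)
  next
    fix x assume "x \<in> Z \<union> gens (C - U)"
    then consider "x \<in> Z" | "x div 2 \<in> C" "x div 2 \<notin> U" by (auto simp: gens_def)
    then show "x \<in> gens I - gswap ` S"
    proof cases
      case 1
      then show ?thesis using ZI by (auto simp: Z_def mem_gswap_image)
    next
      case 2
      have "gswap x \<notin> S"
      proof
        assume g: "gswap x \<in> S"
        have "x \<notin> S" using 2 g gens2[of x] by (auto simp: U_def pair_set_def)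
        then have "gswap x \<in> Z" using g by (simp add: Z_def)
        then have "x div 2 \<in> D" unfolding D_def by (metis gswap_div2 imageI)
        then show False using 2 by (simp add: C_def)
      qed
      then show ?thesis using 2 by (simp add: gens_def C_def mem_gswap_image)
    qed
  qed
  ultimately show ?thesis by (simp add: F_def SZU[symmetric] cU r_def)
qed

text \<open>This explains the normalisation: the constant is inverse to the complement sign of
  \<open>shuffle_sign_compl\<close> times the power of \<open>\<i>\<close> from
  \<open>std_form_power_compl\<close>, leaving a plain sum of squares.\<close>

lemma hr_const_std:
  assumes "p + q \<le> card I"
  shows "hr_const I p q * ((-1) ^ (q + ((p + q) choose 2)) * \<i> ^ (card I - p - q)) = 1"
proof -
  define k r where "k = p + q" and "r = card I - p - q"
  have n: "card I = r + q + p" using assms by (simp add: r_def)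
  have e: "k * (k + 1) div 2 = (k choose 2) + k"
    by (induction k) (auto simp: choose_two algebra_simps)
  have sq: "(-1) ^ (x + x) = (1::complex)" for x :: nat by (simp add: mult_2[symmetric])
  have "(-1) ^ (k * (k + 1) div 2) * (-1) ^ (q + (k choose 2)) = ((-1) ^ p :: complex)"
  proof -
    have "(-1) ^ (k * (k + 1) div 2) * (-1) ^ (q + (k choose 2)) = ((-1) ^ (p + ((k choose 2) + (k choose 2)) + (q + q)) :: complex)"
      unfolding e by (simp only: power_add k_def mult_ac)
    also have "\<dots> = ((-1) ^ p :: complex)" by (simp only: power_add[of _ _ "q + q"] power_add[of _ p] sq mult_1_right)
    finally show ?thesis .
  qed
  moreover have "\<i> powi (int q - int p) * \<i> ^ r / \<i> ^ card I = (-1) ^ p"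
  proof -
    have "\<i> powi (int q - int p) * \<i> ^ r / \<i> ^ card I = 1 / (\<i> ^ p * \<i> ^ p)"
      unfolding n by (simp add: power_int_diff power_add)
    also have "\<i> ^ p * \<i> ^ p = (-1) ^ p" by (simp flip: power_mult_distrib)
    also have "1 / (-1) ^ p = ((-1) ^ p :: complex)" by (cases "even p") auto
    finally show ?thesis .
  qed
  moreover have "hr_const I p q * ((-1) ^ (q + ((p + q) choose 2)) * \<i> ^ (card I - p - q))
     = ((-1) ^ (k * (k + 1) div 2) * (-1) ^ (q + (k choose 2))) * (\<i> powi (int q - int p) * \<i> ^ r / \<i> ^ card I)"
    unfolding hr_const_def k_def r_def by simp
  ultimately show ?thesis by (simp flip: power_mult_distrib)
qed

lemma hodge_riemann_std:
  assumes I: "finite I" and t: "has_type p q \<Phi>" and pq: "p + q \<le> card I"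
    and prim: "zero_on I (wedge (wprod (replicate (card I - p - q + 1) (std_form I))) \<Phi>)"
    and nz: "\<not> zero_on I \<Phi>"
  shows "Re (hr_form I p q (wprod (replicate (card I - p - q) (std_form I))) \<Phi> \<Phi>) > 0"
proof -
  define r where "r = card I - p - q"
  define X where "X = wedge (wprod (replicate r (std_form I))) \<Phi>"
  have "wedge X (conj_form \<Phi>) (gens I) =
     (\<Sum>S\<in>Pow (gens I). shuffle_sign (gens I - gswap ` S) (gswap ` S) * X (gens I - gswap ` S) * conj_form \<Phi> (gswap ` S))"
    unfolding wedge_def
  proof (rule sum.reindex_bij_witness[of _ "\<lambda>S. gens I - gswap ` S" "\<lambda>A. gswap ` (gens I - A)"])
    fix A assume "A \<in> Pow (gens I)"
    then have A: "A \<subseteq> gens I" by simp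
    then have e: "gens I - (gens I - A) = A" by auto
    show "gens I - gswap ` gswap ` (gens I - A) = A" using e by simp
    show "gswap ` (gens I - A) \<in> Pow (gens I)"
      using image_mono[of "gens I - A" "gens I" gswap] by auto
    show "shuffle_sign (gens I - gswap ` gswap ` (gens I - A)) (gswap ` gswap ` (gens I - A)) *
        X (gens I - gswap ` gswap ` (gens I - A)) * conj_form \<Phi> (gswap ` gswap ` (gens I - A)) =
        shuffle_sign A (gens I - A) * X A * conj_form \<Phi> (gens I - A)" using e by simp
  next
    fix S assume "S \<in> Pow (gens I)"
    then have "gswap ` S \<subseteq> gens I" using image_mono[of S "gens I" gswap] by simp
    then have "gens I - (gens I - gswap ` S) = gswap ` S" by auto
    then show "gswap ` (gens I - (gens I - gswap ` S)) = S" by simp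
  qed auto
  also have "\<dots> = (\<Sum>S\<in>Pow (gens I). (-1) ^ (q + ((p + q) choose 2)) * \<i> ^ r * of_real (fact r * (cmod (\<Phi> S))\<^sup>2))"
  proof (rule sum.cong[OF refl])
    fix S assume "S \<in> Pow (gens I)"
    then have S: "S \<subseteq> gens I" by simp
    then have gS: "gswap ` S \<subseteq> gens I" using image_mono[of S "gens I" gswap] by simp
    show "shuffle_sign (gens I - gswap ` S) (gswap ` S) * X (gens I - gswap ` S) * conj_form \<Phi> (gswap ` S)
      = (-1) ^ (q + ((p + q) choose 2)) * \<i> ^ r * of_real (fact r * (cmod (\<Phi> S))\<^sup>2)"
    proof (cases "\<Phi> S = 0")
      case True
      then show ?thesis by (simp add: conj_form_altdef)
    next
      case False
      have "antihol_deg S = q" "card (gswap ` S) = p + q"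
        using False t by (auto simp: has_type_def card_hol_antihol card_image)
      then have "shuffle_sign (gens I - gswap ` S) (gswap ` S) = (-1) ^ (q + ((p + q) choose 2))"
        using shuffle_sign_compl[OF I gS] by simp
      moreover have "X (gens I - gswap ` S) = \<i> ^ r * fact r * (-1) ^ npairs S * \<Phi> S"
        unfolding X_def r_def by (rule std_form_power_compl[OF I t pq prim S False])
      moreover have "conj_form \<Phi> (gswap ` S) = (-1) ^ npairs S * cnj (\<Phi> S)"
        by (simp add: conj_form_altdef)
      moreover have "((-1) ^ npairs S * (-1) ^ npairs S) = (1::complex)" by (simp flip: power_mult_distrib)
      moreover have "of_real (fact r * (cmod (\<Phi> S))\<^sup>2) = fact r * (\<Phi> S * cnj (\<Phi> S))"
        by (simp only: complex_norm_square of_real_mult of_real_fact)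
      ultimately show ?thesis by (simp add: algebra_simps)
    qed
  qed
  also have "\<dots> = (-1) ^ (q + ((p + q) choose 2)) * \<i> ^ r * of_real (\<Sum>S\<in>Pow (gens I). fact r * (cmod (\<Phi> S))\<^sup>2)"
    by (simp only: of_real_sum sum_distrib_left)
  finally have "hr_form I p q (wprod (replicate r (std_form I))) \<Phi> \<Phi> =
     (hr_const I p q * ((-1) ^ (q + ((p + q) choose 2)) * \<i> ^ r)) * of_real (\<Sum>S\<in>Pow (gens I). fact r * (cmod (\<Phi> S))\<^sup>2)"
    unfolding hr_form_def X_def by (simp only: mult.assoc)
  also have "\<dots> = of_real (\<Sum>S\<in>Pow (gens I). fact r * (cmod (\<Phi> S))\<^sup>2)"
    using hr_const_std[OF pq] by (simp add: r_def)
  finally have "Re (hr_form I p q (wprod (replicate r (std_form I))) \<Phi> \<Phi>) = (\<Sum>S\<in>Pow (gens I). fact r * (cmod (\<Phi> S))\<^sup>2)"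
    by simp
  moreover obtain S where S: "S \<subseteq> gens I" "\<Phi> S \<noteq> 0" using nz by (auto simp: zero_on_def)
  have "(\<Sum>S\<in>Pow (gens I). fact r * (cmod (\<Phi> S))\<^sup>2) > 0"
    by (rule sum_pos2[of _ S]) (use I S in auto)
  ultimately show ?thesis by (simp add: r_def)
qed

subsection \<open>Deformation to the standard form\<close>

definition mix :: "nat set \<Rightarrow> real \<Rightarrow> cform \<Rightarrow> cform" where
  "mix I t f = (\<lambda>S. of_real (1 - t) * f S + of_real t * std_form I S)"

lemma std_form_eq: "finite I \<Longrightarrow> std_form I S = (if \<exists>j\<in>I. S = gens {j} then \<i> else 0)"
proof -
  assume I: "finite I"
  have "std_form I S = (\<Sum>j\<in>{j\<in>I. S = gens {j}}. \<i>)"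
    unfolding std_form_def diag_form_def of_real_1 mult_1_right
    by (rule sum.inter_filter[symmetric, OF I])
  moreover have "{j\<in>I. S = gens {j}} = {j}" if "j \<in> I" "S = gens {j}" for j
    using that by auto
  moreover have "(\<Sum>j\<in>{j\<in>I. S = gens {j}}. \<i>) = 0" if "\<not> (\<exists>j\<in>I. S = gens {j})"
    by (rule sum.neutral) (use that in auto)
  ultimately show ?thesis by (cases "\<exists>j\<in>I. S = gens {j}") auto
qed

lemma psd_std_form:
  assumes I: "finite I"
  shows "psd I (card I) (std_form I)"
proof -
  have t: "has_type 1 1 (std_form I)"
    unfolding has_type_def by (auto simp: std_form_eq[OF I] hol_deg_gens antihol_deg_gens split: if_splits)
  have c: "conj_form (std_form I) = std_form I"
  proof
    fix S
    have "gswap ` S = gens {j} \<longleftrightarrow> S = gens {j}" for j by (metis gswap_gens gswap_image_image)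
    then show "conj_form (std_form I) S = std_form I S"
      by (auto simp: conj_form_altdef std_form_eq[OF I] npairs_gens)
  qed
  have h: "herm_mat (std_form I) j k = (if j = k then 1 else 0)" if "j \<in> I" for j k
  proof (cases "j = k")
    case True
    then show ?thesis using that std_form_eq[OF I, of "gens {j}"] by (auto simp: herm_mat_altdef gens_sing sg_def)
  next
    case False
    have "{2*j, 2*k+1} \<noteq> gens {i}" for i using False by (auto simp: gens_sing doubleton_eq_iff) presburger+
    then show ?thesis using False by (simp add: herm_mat_altdef std_form_eq[OF I])
  qed
  have q: "hquad I (std_form I) v = of_real (\<Sum>j\<in>I. (cmod (v j))\<^sup>2)" for v
  proof -
    have "hquad I (std_form I) v = (\<Sum>j\<in>I. \<Sum>k\<in>I. if k = j then v j * cnj (v j) else 0)"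
      unfolding hquad_def by (intro sum.cong refl) (auto simp: h)
    also have "\<dots> = (\<Sum>j\<in>I. v j * cnj (v j))" using I by simp
    also have "\<dots> = of_real (\<Sum>j\<in>I. (cmod (v j))\<^sup>2)" by (simp only: complex_norm_square of_real_sum)
    finally show ?thesis .
  qed
  have "rank_ge I (card I) (std_form I)"
  proof (rule rank_ge_positive[OF I])
    fix v :: "nat \<Rightarrow> complex" assume "\<exists>j\<in>I. v j \<noteq> 0"
    then obtain j where "j \<in> I" "v j \<noteq> 0" by blast
    then have "(\<Sum>j\<in>I. (cmod (v j))\<^sup>2) > 0" by (intro sum_pos2[of _ j]) (use I in auto)
    then show "Re (hquad I (std_form I) v) > 0" by (simp add: q)
  qed
  then show ?thesis using t c by (simp add: psd_def q sum_nonneg)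
qed

lemma hquad_lin:
  "hquad I (\<lambda>S. x * a S + y * b S) v = x * hquad I a v + y * hquad I b v"
proof -
  have "herm_mat (\<lambda>S. x * a S + y * b S) j k = x * herm_mat a j k + y * herm_mat b j k" for j k
    by (simp add: herm_mat_altdef algebra_simps)
  then have "hquad I (\<lambda>S. x * a S + y * b S) v = (\<Sum>j\<in>I. \<Sum>k\<in>I.
      x * (herm_mat a j k * v j * cnj (v k)) + y * (herm_mat b j k * v j * cnj (v k)))"
    by (simp add: hquad_def algebra_simps)
  then show ?thesis by (simp only: hquad_def sum.distrib sum_distrib_left)
qed

text \<open>Before time 1 a vector witnessing the rank of \<open>f\<close> still works, as the
  standard form adds something nonnegative; at time 1 the full rank of the standard form takes
  over.\<close>

lemma psd_mix:
  assumes I: "finite I" and f: "psd I r f" and r: "r \<le> card I" and t: "0 \<le> t" "t \<le> 1"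
  shows "psd I r (mix I t f)"
proof -
  have s: "psd I (card I) (std_form I)" by (rule psd_std_form[OF I])
  have q: "hquad I (mix I t f) v = of_real (1 - t) * hquad I f v + of_real t * hquad I (std_form I) v" for v
    unfolding mix_def by (rule hquad_lin)
  have nn: "Re (hquad I f v) \<ge> 0" "Re (hquad I (std_form I) v) \<ge> 0" for v
    using f s by (auto simp: psd_def)
  have "rank_ge I r (mix I t f)"
  proof (cases "t = 1")
    case True
    then have "mix I t f = std_form I" by (simp add: mix_def)
    then show ?thesis using psd_mono[OF s r] by (simp add: psd_def)
  next
    case False
    show ?thesis unfolding rank_ge_def
    proof (intro allI impI)
      fix \<phi> :: "nat \<Rightarrow> nat \<Rightarrow> complex" and i assume "i < r"
      then obtain v where v: "\<forall>k<i. (\<Sum>j\<in>I. \<phi> k j * v j) = 0" "Re (hquad I f v) > 0"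
        using rank_geD[of I r f i \<phi>] f by (auto simp: psd_def)
      have "Re (hquad I (mix I t f) v) > 0"
        unfolding q using v(2) False t nn[of v] by (simp add: add_pos_nonneg)
      then show "\<exists>v. (\<forall>k<i. (\<Sum>j\<in>I. \<phi> k j * v j) = 0) \<and> Re (hquad I (mix I t f) v) > 0"
        using v(1) by blast
    qed
  qed
  moreover have "has_type 1 1 (mix I t f)" using f s has_type_lin by (auto simp: psd_def mix_def)
  moreover have "conj_form (mix I t f) = mix I t f"
    using f s by (simp add: psd_def mix_def conj_lin)
  moreover have "Im (hquad I (mix I t f) v) = 0" "Re (hquad I (mix I t f) v) \<ge> 0" for v
    unfolding q using nn[of v] f s t by (auto simp: psd_def)
  ultimately show ?thesis by (simp add: psd_def)
qed

lemma hr_data_mix: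
  assumes I: "finite I" and d: "hr_data I p q m fs" and t: "0 \<le> t" "t \<le> 1"
  shows "hr_data I p q m (map (mix I t) fs)"
proof -
  obtain ws as where w: "p + q \<le> m" "m \<le> card I" "fs = ws @ as" "length ws = card I - m" "length as = m - p - q"
    "\<forall>w\<in>set ws. psd I (card I) w" "\<forall>a\<in>set as. psd I m a"
    using d unfolding hr_data_def by blast
  show ?thesis unfolding hr_data_def
    by (intro conjI exI[of _ "map (mix I t) ws"] exI[of _ "map (mix I t) as"])
       (use w psd_mix[OF I _ _ t] in auto)
qed

section \<open>Coefficientwise limits and compactness\<close>

definition ptendsto :: "(nat \<Rightarrow> cform) \<Rightarrow> cform \<Rightarrow> bool" where
  "ptendsto X L \<longleftrightarrow> (\<forall>S. (\<lambda>k. X k S) \<longlonglongrightarrow> L S)"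

lemma ptendsto_const [simp]: "ptendsto (\<lambda>k. a) a"
  by (simp add: ptendsto_def)

lemma ptendsto_wedge: "ptendsto X a \<Longrightarrow> ptendsto Y b \<Longrightarrow> ptendsto (\<lambda>k. wedge (X k) (Y k)) (wedge a b)"
  unfolding ptendsto_def wedge_def by (intro allI tendsto_sum tendsto_mult tendsto_const) auto

lemma ptendsto_conj: "ptendsto X a \<Longrightarrow> ptendsto (\<lambda>k. conj_form (X k)) (conj_form a)"
  unfolding ptendsto_def conj_form_altdef by (intro allI tendsto_mult tendsto_cnj tendsto_const) auto

lemma ptendsto_mix: "t \<longlonglongrightarrow> s \<Longrightarrow> ptendsto (\<lambda>k. mix I (t k) f) (mix I s f)"
  unfolding ptendsto_def mix_def
  by (intro allI tendsto_add tendsto_mult tendsto_of_real tendsto_diff tendsto_const)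

lemma ptendsto_wprod_mix:
  "t \<longlonglongrightarrow> s \<Longrightarrow> ptendsto (\<lambda>k. wprod (map (mix I (t k)) fs)) (wprod (map (mix I s) fs))"
  by (induction fs) (simp_all add: ptendsto_wedge ptendsto_mix)

lemma ptendsto_diff: "ptendsto X a \<Longrightarrow> ptendsto Y b \<Longrightarrow> ptendsto (\<lambda>k S. X k S - Y k S) (\<lambda>S. a S - b S)"
  unfolding ptendsto_def by (intro allI tendsto_diff) auto

lemma ptendsto_zero_on:
  assumes "ptendsto X a" "\<And>k. zero_on I (X k)"
  shows "zero_on I a"
  unfolding zero_on_def
proof (intro allI impI)
  fix S assume "S \<subseteq> gens I"
  then have "(\<lambda>k. X k S) = (\<lambda>k. 0)" using assms(2) by (auto simp: zero_on_def)
  moreover have "(\<lambda>k. X k S) \<longlonglongrightarrow> a S" using assms(1) by (simp add: ptendsto_def)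
  ultimately show "a S = 0" by (simp add: LIMSEQ_const_iff)
qed

lemma ptendsto_vanish:
  assumes "ptendsto X a" "\<And>k. X k S = 0"
  shows "a S = 0"
proof -
  have "(\<lambda>k. X k S) \<longlonglongrightarrow> a S" using assms(1) by (simp add: ptendsto_def)
  then show ?thesis using assms(2) by (simp add: LIMSEQ_const_iff)
qed

text \<open>Bolzano--Weierstrass for one coefficient at a time, over the finitely many sets in
  \<open>B\<close>.\<close>

lemma bounded_forms_subseq:
  fixes X :: "nat \<Rightarrow> cform"
  assumes "finite B" "\<And>k S. S \<in> B \<Longrightarrow> cmod (X k S) \<le> M" "\<And>k S. S \<notin> B \<Longrightarrow> X k S = 0"
  shows "\<exists>r a. strict_mono r \<and> ptendsto (\<lambda>k. X (r k)) a"
proof -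
  have "\<exists>r. strict_mono (r :: nat \<Rightarrow> nat) \<and> (\<forall>S\<in>B. convergent (\<lambda>k. X (r k) S))"
    using assms(1,2)
  proof (induction B rule: finite_induct)
    case empty
    show ?case by (intro exI[of _ id]) (auto simp: strict_mono_def)
  next
    case (insert T B)
    then obtain r where r: "strict_mono r" "\<forall>S\<in>B. convergent (\<lambda>k. X (r k) S)" by auto
    have "bounded (range (\<lambda>k. X (r k) T))"
      unfolding bounded_iff using insert.prems by auto
    then obtain l r' where r': "strict_mono r'" "((\<lambda>k. X (r k) T) \<circ> r') \<longlonglongrightarrow> l"
      using bounded_imp_convergent_subsequence by blast
    have "convergent (\<lambda>k. X (r (r' k)) S)" if "S \<in> B" for S
      using r(2) that r'(1) convergent_subseq_convergent[of "\<lambda>k. X (r k) S" r'] by (simp add: o_def)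
    moreover have "convergent (\<lambda>k. X (r (r' k)) T)" using r'(2) by (auto simp: convergent_def o_def)
    moreover have "strict_mono (\<lambda>k. r (r' k))" using strict_mono_o[OF r(1) r'(1)] by (simp add: o_def)
    ultimately show ?case by (intro exI[of _ "\<lambda>k. r (r' k)"] conjI) auto
  qed
  then obtain r where r: "strict_mono (r :: nat \<Rightarrow> nat)" "\<And>S. S \<in> B \<Longrightarrow> convergent (\<lambda>k. X (r k) S)" by blast
  have "convergent (\<lambda>k. X (r k) S)" for S
    using r(2)[of S] assms(3)[of S] by (cases "S \<in> B") (auto simp: convergent_const)
  then have "ptendsto (\<lambda>k. X (r k)) (\<lambda>S. lim (\<lambda>k. X (r k) S))"
    by (simp add: ptendsto_def convergent_LIMSEQ_iff)
  then show ?thesis using r(1) by blast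
qed

text \<open>\<open>nrm\<close> sees only coefficients inside \<open>gens I\<close>; extracting
  convergent subsequences requires the others to be zero.\<close>

definition supp_on :: "nat set \<Rightarrow> cform \<Rightarrow> bool" where
  "supp_on I a \<longleftrightarrow> (\<forall>S. \<not> S \<subseteq> gens I \<longrightarrow> a S = 0)"

definition nrm :: "nat set \<Rightarrow> cform \<Rightarrow> real" where
  "nrm I a = (\<Sum>S\<in>Pow (gens I). (cmod (a S))\<^sup>2)"

lemma nrm_nonneg: "nrm I a \<ge> 0" by (simp add: nrm_def sum_nonneg)

lemma nrm_bound:
  assumes "finite I" "S \<subseteq> gens I"
  shows "(cmod (a S))\<^sup>2 \<le> nrm I a"
  unfolding nrm_def by (rule member_le_sum[where f = "\<lambda>S. (cmod (a S))\<^sup>2"]) (use assms in auto)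

lemma nrm_zero_iff: "finite I \<Longrightarrow> nrm I a = 0 \<longleftrightarrow> zero_on I a"
  by (auto simp: nrm_def zero_on_def sum_nonneg_eq_0_iff)

lemma nrm_scale: "nrm I (\<lambda>S. z * a S) = (cmod z)\<^sup>2 * nrm I a"
  by (simp add: nrm_def norm_mult power_mult_distrib sum_distrib_left)

lemma nrm_tendsto: "ptendsto X a \<Longrightarrow> (\<lambda>k. nrm I (X k)) \<longlonglongrightarrow> nrm I a"
  unfolding nrm_def ptendsto_def by (intro tendsto_sum tendsto_power tendsto_norm) auto

lemma unit_forms_subseq:
  fixes X :: "nat \<Rightarrow> cform"
  assumes I: "finite I" and X: "\<And>k. supp_on I (X k)" "\<And>k. nrm I (X k) \<le> 1"
  shows "\<exists>r a. strict_mono r \<and> ptendsto (\<lambda>k. X (r k)) a"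
proof (rule bounded_forms_subseq[of "Pow (gens I)" X 1])
  fix k S assume "S \<in> Pow (gens I)"
  then have "(cmod (X k S))\<^sup>2 \<le> 1" using nrm_bound[OF I, of S "X k"] X(2)[of k] by simp
  then show "cmod (X k S) \<le> 1" by (simp add: power_le_one_iff abs_square_le_1)
qed (use I X in \<open>auto simp: supp_on_def\<close>)

lemma has_type_ptendsto:
  assumes "ptendsto X a" "\<And>k. has_type p q (X k)"
  shows "has_type p q a"
  unfolding has_type_def
proof (intro allI impI, rule ccontr)
  fix S assume "a S \<noteq> 0" "\<not> (finite S \<and> hol_deg S = p \<and> antihol_deg S = q)"
  then show False using ptendsto_vanish[OF assms(1), of S] assms(2) by (auto simp: has_type_def)
qed

lemma supp_on_ptendsto:
  assumes "ptendsto X a" "\<And>k. supp_on I (X k)"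
  shows "supp_on I a"
  using ptendsto_vanish[OF assms(1)] assms(2) by (auto simp: supp_on_def)

lemma has_type_scale: "has_type p q a \<Longrightarrow> has_type p q (\<lambda>S. z * a S)"
  by (auto simp: has_type_def)

lemma has_type_diff: "has_type p q a \<Longrightarrow> has_type p q b \<Longrightarrow> has_type p q (\<lambda>S. a S - b S)"
  using has_type_lin[of p q a b 1 "-1"] by simp

subsection \<open>Duality\<close>

lemma degrees_compl:
  assumes "finite I" "S \<subseteq> gens I"
  shows "hol_deg (gens I - S) = card I - hol_deg S" "antihol_deg (gens I - S) = card I - antihol_deg S"
    "hol_deg S \<le> card I" "antihol_deg S \<le> card I"
  using hol_deg_Diff[of "gens I" S] antihol_deg_Diff[of "gens I" S] assms
  by (simp_all add: hol_deg_gens antihol_deg_gens)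

lemma zero_on_excess:
  assumes "finite I" "has_type p q a" "p > card I \<or> q > card I"
  shows "zero_on I a"
  unfolding zero_on_def
proof (intro allI impI, rule ccontr)
  fix S assume "S \<subseteq> gens I" "a S \<noteq> 0"
  then show False using degrees_compl(3,4)[OF assms(1), of S] assms(2,3) by (auto simp: has_type_def)
qed

lemma wedge_basis_right:
  assumes "finite S"
  shows "wedge a (\<lambda>U. if U = T then z else 0) S = (if T \<subseteq> S then shuffle_sign (S - T) T * a (S - T) * z else 0)"
proof -
  have "wedge a (\<lambda>U. if U = T then z else 0) S
     = (\<Sum>A\<in>Pow S. if A = S - T then (if T \<subseteq> S then shuffle_sign (S - T) T * a (S - T) * z else 0) else 0)"
    unfolding wedge_def
  proof (intro sum.cong refl)
    fix A assume "A \<in> Pow S"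
    then have "S - A = T \<longleftrightarrow> T \<subseteq> S \<and> A = S - T" by auto
    moreover have "S - (S - T) = T" if "T \<subseteq> S" using that by auto
    ultimately show "shuffle_sign A (S - A) * a A * (if S - A = T then z else 0) =
        (if A = S - T then (if T \<subseteq> S then shuffle_sign (S - T) T * a (S - T) * z else 0) else 0)"
      by auto
  qed
  then show ?thesis using assms by simp
qed

text \<open>The coefficient of \<open>Z\<close> at \<open>S\<close> is isolated, up to sign, by
  pairing with the basis form of the complement of \<open>S\<close>, which is itself the conjugate
  of an admissible test form.\<close>

lemma zero_on_if_pairing:
  assumes I: "finite I" and Z: "has_type (card I - q) (card I - p) Z" and pq: "p \<le> card I" "q \<le> card I"
    and pair: "\<And>x. has_type p q x \<Longrightarrow> supp_on I x \<Longrightarrow> wedge Z (conj_form x) (gens I) = 0"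
  shows "zero_on I Z"
  unfolding zero_on_def
proof (intro allI impI, rule ccontr)
  fix S assume S: "S \<subseteq> gens I" and nz: "Z S \<noteq> 0"
  define T where "T = gens I - S"
  define x where "x = conj_form (\<lambda>U. if U = T then 1 else 0)"
  have T: "T \<subseteq> gens I" "gens I - T = S" "finite T" using S I finite_gens by (auto simp: T_def)
  have "hol_deg S = card I - q" "antihol_deg S = card I - p" using nz Z by (auto simp: has_type_def)
  then have "hol_deg T = q" "antihol_deg T = p"
    using degrees_compl[OF I S] pq by (auto simp: T_def)
  then have "has_type q p (\<lambda>U. if U = T then 1 else 0)" using T by (auto simp: has_type_def)
  then have "has_type p q x" unfolding x_def by (rule has_type_conj)
  moreover have "supp_on I x"
    unfolding supp_on_def x_def conj_form_altdef
  proof (intro allI impI)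
    fix U assume "\<not> U \<subseteq> gens I"
    then have "gswap ` U \<noteq> T" using T(1) by (metis gswap_gens gswap_image_image image_mono)
    then show "(-1) ^ npairs U * cnj (if gswap ` U = T then 1 else 0) = 0" by simp
  qed
  ultimately have "wedge Z (\<lambda>U. if U = T then 1 else 0) (gens I) = 0"
    using pair[of x] by (simp add: x_def)
  then have "shuffle_sign S T * Z S = 0"
    using wedge_basis_right[of "gens I" Z T 1] I T by simp
  then show False using nz by (simp add: shuffle_sign_def)
qed

text \<open>An injective map between coefficient spaces of equal dimension is onto.\<close>

lemma lefschetz_solve:
  assumes I: "finite I" and V: "has_type c c V" and c: "c + p + q = card I"
    and inj: "\<And>\<Psi>. has_type p q \<Psi> \<Longrightarrow> zero_on I (wedge V \<Psi>) \<Longrightarrow> zero_on I \<Psi>"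
    and Y: "has_type (c + p) (c + q) Y"
  shows "\<exists>\<Psi>. has_type p q \<Psi> \<and> supp_on I \<Psi> \<and> (\<forall>S\<subseteq>gens I. wedge V \<Psi> S = Y S)"
proof -
  define B where "B = {S. S \<subseteq> gens I \<and> hol_deg S = p \<and> antihol_deg S = q}"
  define E where "E = {S. S \<subseteq> gens I \<and> hol_deg S = c + p \<and> antihol_deg S = c + q}"
  have fin: "finite B" "finite E" using I by (auto simp: B_def E_def)
  \<comment> \<open>The index map of the Hodge star, \<open>S\<close> to the complement of its
    conjugate, matches the two bidegrees because \<open>c + p + q = card I\<close>.\<close>
  have cBE: "card B = card E"
  proof (rule bij_betw_same_card[of "\<lambda>S. gens I - gswap ` S"],
      rule bij_betw_byWitness[of _ "\<lambda>S. gswap ` (gens I - S)"])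
    have gs: "gswap ` S \<subseteq> gens I" if "S \<subseteq> gens I" for S using image_mono[OF that, of gswap] by simp
    show "\<forall>S\<in>B. gswap ` (gens I - (gens I - gswap ` S)) = S"
    proof
      fix S assume "S \<in> B"
      then have "gens I - (gens I - gswap ` S) = gswap ` S" using gs by (auto simp: B_def)
      then show "gswap ` (gens I - (gens I - gswap ` S)) = S" by simp
    qed
    show "\<forall>S\<in>E. gens I - gswap ` gswap ` (gens I - S) = S" by (auto simp: E_def)
    show "(\<lambda>S. gens I - gswap ` S) ` B \<subseteq> E"
      using degrees_compl[OF I gs] c by (auto simp: B_def E_def)
    show "(\<lambda>S. gswap ` (gens I - S)) ` E \<subseteq> B"
    proof
      fix T assume "T \<in> (\<lambda>S. gswap ` (gens I - S)) ` E"
      then obtain S where S: "S \<subseteq> gens I" "hol_deg S = c + p" "antihol_deg S = c + q" "T = gswap ` (gens I - S)"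
        by (auto simp: E_def)
      then show "T \<in> B" using degrees_compl[OF I S(1)] c gs[of "gens I - S"] by (auto simp: B_def)
    qed
  qed
  obtain f where f: "bij_betw f {..<card E} E" using fin(2) by (metis bij_betw_from_nat_into_finite)
  \<comment> \<open>The unknowns are the coefficients of \<open>\<Psi>\<close> and one more,
    \<open>None\<close>, multiplying \<open>Y\<close>. That extra unknown guarantees a nontrivial
    solution, and injectivity will show that it is nonzero and can be divided out.\<close>
  define J where "J = insert None (Some ` B)"
  define e where "e = (\<lambda>(T::nat set) U. if U = T then 1 else 0 :: complex)"
  define \<phi> where "\<phi> = (\<lambda>i x. case x of None \<Rightarrow> - Y (f i) | Some T \<Rightarrow> wedge V (e T) (f i))"
  have J: "finite J" "card E < card J" using fin cBE by (auto simp: J_def card_image)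
  obtain v where v: "\<forall>i<card E. (\<Sum>x\<in>J. \<phi> i x * v x) = 0" "\<exists>x\<in>J. v x \<noteq> 0"
    using underdetermined_system[OF J, of \<phi>] by blast
  define \<Psi> where "\<Psi> = (\<lambda>S. if S \<in> B then v (Some S) else 0)"
  have t\<Psi>: "has_type p q \<Psi>" using finite_subset[OF _ finite_gens[OF I]] by (auto simp: has_type_def \<Psi>_def B_def)
  have s\<Psi>: "supp_on I \<Psi>" by (auto simp: supp_on_def \<Psi>_def B_def)
  have exp: "wedge V \<Psi> S = (\<Sum>T\<in>B. wedge V (e T) S * v (Some T))" for S
  proof -
    have "\<Psi> U = (\<Sum>T\<in>B. e T U * v (Some T))" for U
    proof -
      have "(\<Sum>T\<in>B. e T U * v (Some T)) = (\<Sum>T\<in>B. if T = U then v (Some T) else 0)"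
        by (intro sum.cong) (auto simp: e_def)
      then show ?thesis using fin by (simp add: \<Psi>_def)
    qed
    then show ?thesis
      unfolding wedge_def by (simp add: sum_distrib_left sum_distrib_right mult.assoc sum.swap[of _ B])
  qed
  have eqE: "wedge V \<Psi> S = v None * Y S" if "S \<in> E" for S
  proof -
    have "S \<in> f ` {..<card E}" using bij_betw_imp_surj_on[OF f] that by simp
    then obtain i where i: "i < card E" "f i = S" by auto
    have "(\<Sum>x\<in>J. \<phi> i x * v x) = - Y S * v None + (\<Sum>T\<in>B. wedge V (e T) S * v (Some T))"
      unfolding J_def using fin i by (simp add: \<phi>_def sum.reindex)
    then show ?thesis using v(1)[rule_format, OF i(1)] exp[of S] by (simp add: algebra_simps)
  qed
  have tV: "has_type (c + p) (c + q) (wedge V \<Psi>)" by (rule has_type_wedge[OF V t\<Psi>])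
  have eq: "wedge V \<Psi> S = v None * Y S" if "S \<subseteq> gens I" for S
  proof (cases "S \<in> E")
    case False
    then have "wedge V \<Psi> S = 0" "Y S = 0" using that tV Y by (auto simp: E_def has_type_def)
    then show ?thesis by simp
  qed (rule eqE)
  have "v None \<noteq> 0"
  proof
    assume v0: "v None = 0"
    then have "zero_on I (wedge V \<Psi>)" using eq by (simp add: zero_on_def)
    then have "zero_on I \<Psi>" using inj t\<Psi> by blast
    then have "v (Some T) = 0" if "T \<in> B" for T using that by (auto simp: zero_on_def \<Psi>_def B_def)
    then show False using v(2) v0 by (auto simp: J_def)
  qed
  define \<Psi>' where "\<Psi>' = (\<lambda>S. inverse (v None) * \<Psi> S)"
  have "has_type p q \<Psi>'" unfolding \<Psi>'_def by (rule has_type_scale[OF t\<Psi>])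
  moreover have "supp_on I \<Psi>'" using s\<Psi> by (auto simp: supp_on_def \<Psi>'_def)
  moreover have "wedge V \<Psi>' S = Y S" if "S \<subseteq> gens I" for S
    using eq[OF that] \<open>v None \<noteq> 0\<close> by (simp add: \<Psi>'_def wedge_scale_right)
  ultimately show ?thesis by blast
qed

lemma hr_data_psd:
  assumes "hr_data I p q m fs" "f \<in> set fs"
  shows "psd I 0 f"
proof -
  obtain ws as where "fs = ws @ as" "\<forall>w\<in>set ws. psd I (card I) w" "\<forall>a\<in>set as. psd I m a"
    using assms(1) unfolding hr_data_def by blast
  then have "psd I (card I) f \<or> psd I m f" using assms(2) by auto
  then show ?thesis using psd_mono by blast
qed

section \<open>Positivity along the deformation\<close>

locale hr_deformation =
  fixes I :: "nat set" and p q m :: nat and fs :: "cform list" and b :: cform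
  assumes I: "finite I" and IH: "\<And>j. j \<in> I \<Longrightarrow> hodge_riemann (I - {j})"
    and data: "hr_data I p q m fs" and psd_b: "psd I m b"
begin

definition W :: "real \<Rightarrow> cform" where "W t = wprod (map (mix I t) fs)"
definition bt :: "real \<Rightarrow> cform" where "bt t = mix I t b"
text \<open>The kernel of multiplication by \<open>R t\<close> in bidegree (p,q) is the space of
  primitive forms at time \<open>t\<close>; one more factor \<open>bt t\<close>, as in
  \<open>V t\<close>, tests products \<open>bt t \<and> \<Psi>\<close> for primitivity.\<close>

definition R :: "real \<Rightarrow> cform" where "R t = wedge (W t) (bt t)"
definition V :: "real \<Rightarrow> cform" where "V t = wedge (R t) (bt t)"

abbreviation Q :: "real \<Rightarrow> cform \<Rightarrow> cform \<Rightarrow> complex" where "Q t \<equiv> hr_form I p q (W t)"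

lemma pq: "p + q \<le> card I" and mI: "m \<le> card I" and len: "length fs = card I - p - q"
  using data unfolding hr_data_def by auto

lemma data_t: "0 \<le> t \<Longrightarrow> t \<le> 1 \<Longrightarrow> hr_data I p q m (map (mix I t) fs)"
  by (rule hr_data_mix[OF I data])

lemma psd_bt: "0 \<le> t \<Longrightarrow> t \<le> 1 \<Longrightarrow> psd I m (bt t)"
  unfolding bt_def by (rule psd_mix[OF I psd_b mI])

lemma psd_ft:
  assumes "0 \<le> t" "t \<le> 1" "f \<in> set (map (mix I t) fs)"
  shows "has_type 1 1 f" "conj_form f = f"
  using hr_data_psd[OF data_t[OF assms(1,2)] assms(3)] by (auto simp: psd_def)

lemma type_W: "0 \<le> t \<Longrightarrow> t \<le> 1 \<Longrightarrow> has_type (card I - p - q) (card I - p - q) (W t)"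
  using has_type_wprod[of "map (mix I t) fs"] psd_ft(1) by (simp add: W_def len)

lemma conj_W: "0 \<le> t \<Longrightarrow> t \<le> 1 \<Longrightarrow> conj_form (W t) = W t"
  unfolding W_def by (rule conj_wprod) (rule psd_ft(2))

lemma type_bt: "0 \<le> t \<Longrightarrow> t \<le> 1 \<Longrightarrow> has_type 1 1 (bt t)"
  using psd_bt by (simp add: psd_def)

lemma type_R: "0 \<le> t \<Longrightarrow> t \<le> 1 \<Longrightarrow> has_type (card I - p - q + 1) (card I - p - q + 1) (R t)"
  unfolding R_def by (intro has_type_wedge type_W type_bt)

lemma type_V: "0 \<le> t \<Longrightarrow> t \<le> 1 \<Longrightarrow> has_type (card I - p - q + 2) (card I - p - q + 2) (V t)"
  using has_type_wedge[OF type_R type_bt, of t t] by (simp add: V_def)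

lemma lefschetz_W:
  assumes "0 \<le> t" "t \<le> 1" "has_type p q \<Phi>" "zero_on I (wedge (W t) \<Phi>)"
  shows "zero_on I \<Phi>"
  using hard_lefschetz[OF I IH data_t[OF assms(1,2)] assms(3)] assms(4) by (simp add: W_def)

text \<open>\<open>m - (p - 1) - (q - 1) = m - p - q + 2\<close>, so in bidegree (p-1,q-1) the two
  copies of \<open>bt t\<close> are just the additional factors of rank \<open>m\<close> that
  \<open>hr_data\<close> demands.\<close>

lemma lefschetz_V:
  assumes t: "0 \<le> t" "t \<le> 1" and pq1: "p \<ge> 1" "q \<ge> 1"
    and \<Psi>: "has_type (p - 1) (q - 1) \<Psi>" "zero_on I (wedge (V t) \<Psi>)"
  shows "zero_on I \<Psi>"
proof -
  obtain ws as where w: "p + q \<le> m" "m \<le> card I" "map (mix I t) fs = ws @ as" "length ws = card I - m"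
    "length as = m - p - q" "\<forall>w\<in>set ws. psd I (card I) w" "\<forall>a\<in>set as. psd I m a"
    using data_t[OF t] unfolding hr_data_def by blast
  have "hr_data I (p - 1) (q - 1) m (map (mix I t) fs @ [bt t, bt t])"
    unfolding hr_data_def
    by (intro conjI exI[of _ ws] exI[of _ "as @ [bt t, bt t]"]) (use w pq1 psd_bt[OF t] in auto)
  moreover have "wprod (map (mix I t) fs @ [bt t, bt t]) = V t"
    using has_type_fin[OF type_bt[OF t]]
    by (simp add: wprod_append V_def R_def W_def wedge_assoc wedge_one_right)
  ultimately show ?thesis using hard_lefschetz[OF I IH, of "p - 1" "q - 1" m] \<Psi> by metis
qed

text \<open>The complement of the primitive forms consists of the products \<open>bt t \<and> \<Psi>\<close>; for \<open>p = 0\<close> or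
  \<open>q = 0\<close> it is trivial.\<close>

definition cofactor :: "cform \<Rightarrow> bool" where
  "cofactor \<Psi> \<longleftrightarrow> supp_on I \<Psi> \<and> (if p \<ge> 1 \<and> q \<ge> 1 then has_type (p - 1) (q - 1) \<Psi> else \<Psi> = (\<lambda>_. 0))"

lemma cofactor_scale: "cofactor \<Psi> \<Longrightarrow> cofactor (\<lambda>S. z * \<Psi> S)"
  unfolding cofactor_def by (auto simp: supp_on_def has_type_scale split: if_splits)

lemma cofactor_ptendsto:
  assumes "ptendsto X \<Psi>" "\<And>k. cofactor (X k)"
  shows "cofactor \<Psi>"
proof (cases "p \<ge> 1 \<and> q \<ge> 1")
  case True
  then have X: "supp_on I (X k)" "has_type (p - 1) (q - 1) (X k)" for k using assms(2)[of k] by (auto simp: cofactor_def)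
  show ?thesis
    unfolding cofactor_def using True supp_on_ptendsto[OF assms(1) X(1)] has_type_ptendsto[OF assms(1) X(2)] by simp
next
  case False
  then have X: "X k = (\<lambda>_. 0)" for k using assms(2)[of k] unfolding cofactor_def by (simp split: if_splits)
  have "\<Psi> S = 0" for S using ptendsto_vanish[OF assms(1), of S] X by simp
  then show ?thesis using False unfolding cofactor_def by (auto simp: supp_on_def)
qed

lemma lefschetz_cofactor:
  assumes "0 \<le> t" "t \<le> 1" "cofactor \<Psi>" "zero_on I (wedge (V t) \<Psi>)"
  shows "zero_on I \<Psi>"
  using lefschetz_V[OF assms(1,2)] assms(3,4) unfolding cofactor_def
  by (auto simp: zero_on_def split: if_splits)

lemma type_bt_cofactor:
  assumes t: "0 \<le> t" "t \<le> 1" and c: "cofactor \<Psi>"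
  shows "has_type p q (wedge (bt t) \<Psi>)"
proof (cases "p \<ge> 1 \<and> q \<ge> 1")
  case True
  then have "has_type (1 + (p - 1)) (1 + (q - 1)) (wedge (bt t) \<Psi>)"
    using c by (intro has_type_wedge type_bt[OF t]) (simp add: cofactor_def)
  then show ?thesis using True by simp
next
  case False
  then have "\<Psi> = (\<lambda>_. 0)" using c unfolding cofactor_def by (simp split: if_splits)
  then show ?thesis by (simp add: wedge_def has_type_def)
qed

text \<open>The Lefschetz decomposition: \<open>V t \<and> \<Psi> = R t \<and> x\<close> is solvable
  by \<open>lefschetz_solve\<close>. If \<open>p\<close> or \<open>q\<close> is zero,
  \<open>R t \<and> x\<close> exceeds the dimension in one of its degrees, and every form is
  primitive.\<close>

lemma cofactor_exists:
  assumes t: "0 \<le> t" "t \<le> 1" and x: "has_type p q x"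
  shows "\<exists>\<Psi>. cofactor \<Psi> \<and> zero_on I (wedge (R t) (\<lambda>S. x S - wedge (bt t) \<Psi> S))"
proof -
  have Rx: "has_type (card I - p - q + 1 + p) (card I - p - q + 1 + q) (wedge (R t) x)"
    by (rule has_type_wedge[OF type_R[OF t] x])
  show ?thesis
  proof (cases "p \<ge> 1 \<and> q \<ge> 1")
    case True
    have "\<exists>\<Psi>. has_type (p - 1) (q - 1) \<Psi> \<and> supp_on I \<Psi> \<and> (\<forall>S\<subseteq>gens I. wedge (V t) \<Psi> S = wedge (R t) x S)"
    proof (rule lefschetz_solve[OF I type_V[OF t]])
      show "card I - p - q + 2 + (p - 1) + (q - 1) = card I" using True pq by linarith
      show "has_type (card I - p - q + 2 + (p - 1)) (card I - p - q + 2 + (q - 1)) (wedge (R t) x)"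
      proof -
        have "card I - p - q + 2 + (p - 1) = card I - p - q + 1 + p"
          "card I - p - q + 2 + (q - 1) = card I - p - q + 1 + q" using True by linarith+
        then show ?thesis using Rx by simp
      qed
      show "zero_on I \<Psi>" if "has_type (p - 1) (q - 1) \<Psi>" "zero_on I (wedge (V t) \<Psi>)" for \<Psi>
        using lefschetz_V[OF t _ _ that] True by blast
    qed
    then obtain \<Psi> where \<Psi>: "has_type (p - 1) (q - 1) \<Psi>" "supp_on I \<Psi>" "\<forall>S\<subseteq>gens I. wedge (V t) \<Psi> S = wedge (R t) x S"
      by blast
    have "zero_on I (wedge (R t) (\<lambda>S. x S - wedge (bt t) \<Psi> S))"
      using \<Psi>(3) unfolding wedge_diff_right by (simp add: zero_on_def V_def wedge_assoc)
    then show ?thesis using \<Psi> True by (auto simp: cofactor_def)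
  next
    case False
    have "zero_on I (wedge (R t) x)"
      by (rule zero_on_excess[OF I Rx]) (use False pq in auto)
    then have "zero_on I (wedge (R t) (\<lambda>S. x S - wedge (bt t) (\<lambda>_. 0) S))"
      by (simp add: wedge_def[of "bt t"])
    moreover have "cofactor (\<lambda>_. 0)" using False unfolding cofactor_def by (auto simp: supp_on_def)
    ultimately show ?thesis by blast
  qed
qed

text \<open>Shaped for limits: the support condition gives convergent subsequences, unit norm keeps
  the limit nonzero, and the sign condition is closed.\<close>

definition bad :: "real \<Rightarrow> bool" where
  "bad t \<longleftrightarrow> (\<exists>\<Phi>. has_type p q \<Phi> \<and> supp_on I \<Phi> \<and> nrm I \<Phi> = 1 \<and> zero_on I (wedge (R t) \<Phi>) \<and> Re (Q t \<Phi> \<Phi>) \<le> 0)"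

lemma Q_cong:
  assumes "\<And>S. S \<subseteq> gens I \<Longrightarrow> x S = x' S"
  shows "Q t x x = Q t x' x'"
proof -
  have "conj_form x S = conj_form x' S" if "S \<subseteq> gens I" for S
    using assms[of "gswap ` S"] image_mono[OF that, of gswap] by (simp add: conj_form_altdef)
  moreover have "wedge (W t) x S = wedge (W t) x' S" if "S \<subseteq> gens I" for S
    by (rule wedge_cong) (use assms that in auto)
  ultimately have "wedge (wedge (W t) x) (conj_form x) (gens I) = wedge (wedge (W t) x') (conj_form x') (gens I)"
    by - (rule wedge_cong)
  then show ?thesis by (simp add: hr_form_def)
qed

lemma Q_lin_left: "Q t (\<lambda>S. u * x S + v * y S) z = u * Q t x z + v * Q t y z"
  unfolding hr_form_def
  by (simp add: wedge_add_right wedge_add_left wedge_scale_right wedge_scale_left algebra_simps)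

lemma Q_lin_right: "Q t z (\<lambda>S. u * x S + v * y S) = cnj u * Q t z x + cnj v * Q t z y"
  unfolding hr_form_def conj_lin
  by (simp add: wedge_add_right wedge_scale_right algebra_simps)

lemma not_bad_pos:
  assumes nb: "\<not> bad t" and t: "has_type p q \<Phi>" "zero_on I (wedge (R t) \<Phi>)" "\<not> zero_on I \<Phi>"
  shows "Re (Q t \<Phi> \<Phi>) > 0"
proof (rule ccontr)
  assume neg: "\<not> ?thesis"
  define N where "N = nrm I \<Phi>"
  have N: "N > 0" using nrm_nonneg[of I \<Phi>] nrm_zero_iff[OF I, of \<Phi>] t(3) by (simp add: N_def less_le)
  define c where "c = complex_of_real (1 / sqrt N)"
  define \<Phi>' where "\<Phi>' = (\<lambda>S. if S \<subseteq> gens I then \<Phi> S else 0)"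
  define \<Phi>'' where "\<Phi>'' = (\<lambda>S. c * \<Phi>' S)"
  have cc: "(cmod c)\<^sup>2 = 1 / N" using N by (simp add: c_def norm_divide power_divide)
  have "has_type p q \<Phi>'" using t(1) by (auto simp: has_type_def \<Phi>'_def)
  then have 1: "has_type p q \<Phi>''" unfolding \<Phi>''_def by (rule has_type_scale)
  have 2: "supp_on I \<Phi>''" by (auto simp: supp_on_def \<Phi>''_def \<Phi>'_def)
  have "nrm I \<Phi>' = N" unfolding N_def nrm_def by (rule sum.cong) (auto simp: \<Phi>'_def)
  then have 3: "nrm I \<Phi>'' = 1" unfolding \<Phi>''_def nrm_scale cc using N by simp
  have "wedge (R t) \<Phi>' S = wedge (R t) \<Phi> S" if "S \<subseteq> gens I" for S
    by (rule wedge_cong) (use that in \<open>auto simp: \<Phi>'_def\<close>)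
  then have 4: "zero_on I (wedge (R t) \<Phi>'')"
    using t(2) by (simp add: \<Phi>''_def wedge_scale_right zero_on_def)
  have "Q t \<Phi>'' \<Phi>'' = (c * cnj c) * Q t \<Phi>' \<Phi>'"
    using Q_lin_left[of t c \<Phi>' 0 \<Phi>' "\<lambda>S. c * \<Phi>' S"] Q_lin_right[of t \<Phi>' c \<Phi>' 0 \<Phi>'] by (simp add: \<Phi>''_def)
  also have "Q t \<Phi>' \<Phi>' = Q t \<Phi> \<Phi>" by (rule Q_cong) (simp add: \<Phi>'_def)
  also have "c * cnj c = of_real (1 / N)" using cc by (metis complex_norm_square)
  finally have "Re (Q t \<Phi>'' \<Phi>'') = 1 / N * Re (Q t \<Phi> \<Phi>)" by simp
  then have "Re (Q t \<Phi>'' \<Phi>'') \<le> 0" using neg N by (simp add: mult_nonneg_nonpos divide_nonpos_pos)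
  then show False using nb 1 2 3 4 unfolding bad_def by blast
qed

lemma R_tendsto: "t \<longlonglongrightarrow> s \<Longrightarrow> ptendsto (\<lambda>k. R (t k)) (R s)"
  unfolding R_def W_def bt_def by (intro ptendsto_wedge ptendsto_wprod_mix ptendsto_mix)

lemma V_tendsto: "t \<longlonglongrightarrow> s \<Longrightarrow> ptendsto (\<lambda>k. V (t k)) (V s)"
  unfolding V_def bt_def by (intro ptendsto_wedge R_tendsto ptendsto_mix)

lemma Q_tendsto:
  assumes "t \<longlonglongrightarrow> s" "ptendsto X x"
  shows "(\<lambda>k. Re (Q (t k) (X k) (X k))) \<longlonglongrightarrow> Re (Q s x x)"
proof -
  have "ptendsto (\<lambda>k. wedge (wedge (W (t k)) (X k)) (conj_form (X k))) (wedge (wedge (W s) x) (conj_form x))"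
    unfolding W_def using assms by (intro ptendsto_wedge ptendsto_wprod_mix ptendsto_conj)
  then show ?thesis
    unfolding hr_form_def ptendsto_def by (intro tendsto_Re tendsto_mult tendsto_const) blast
qed

lemma bad_closed:
  assumes "t \<longlonglongrightarrow> s" "\<And>k. bad (t k)"
  shows "bad s"
proof -
  obtain X where X: "\<And>k. has_type p q (X k)" "\<And>k. supp_on I (X k)" "\<And>k. nrm I (X k) = 1"
    "\<And>k. zero_on I (wedge (R (t k)) (X k))" "\<And>k. Re (Q (t k) (X k) (X k)) \<le> 0"
    using assms(2) unfolding bad_def by metis
  obtain r a where r: "strict_mono r" and a: "ptendsto (\<lambda>k. X (r k)) a"
    using unit_forms_subseq[OF I, of X] X(2,3) by auto
  have tr: "(\<lambda>k. t (r k)) \<longlonglongrightarrow> s" using LIMSEQ_subseq_LIMSEQ[OF assms(1) r] by (simp add: o_def)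
  have "(\<lambda>k. nrm I (X (r k))) \<longlonglongrightarrow> nrm I a" by (rule nrm_tendsto[OF a])
  then have "nrm I a = 1" using X(3) by (simp add: LIMSEQ_const_iff)
  moreover have "zero_on I (wedge (R s) a)"
    by (rule ptendsto_zero_on[OF ptendsto_wedge[OF R_tendsto[OF tr] a]]) (rule X(4))
  moreover have "Re (Q s a a) \<le> 0"
    by (rule LIMSEQ_le_const2[OF Q_tendsto[OF tr a]]) (use X(5) in auto)
  moreover have "has_type p q a" by (rule has_type_ptendsto[OF a X(1)])
  moreover have "supp_on I a" by (rule supp_on_ptendsto[OF a X(2)])
  ultimately show ?thesis unfolding bad_def by blast
qed

text \<open>No bound on the corrections is known beforehand, so they are rescaled into the unit
  ball. A limit of the rescaled forms is annihilated by \<open>V s\<close>, because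
  \<open>R (t k) \<and> y\<close> tends to zero; by hard Lefschetz it is zero, and then the original
  corrections tend to zero too.\<close>

lemma cofactor_limit:
  assumes t: "\<And>k. 0 \<le> t k" "\<And>k. t k \<le> 1" and lim: "t \<longlonglongrightarrow> s" and s: "0 \<le> s" "s \<le> 1"
    and y: "zero_on I (wedge (R s) y)"
    and \<Psi>: "\<And>k. cofactor (\<Psi> k)" "\<And>k. zero_on I (wedge (R (t k)) (\<lambda>S. y S - wedge (bt (t k)) (\<Psi> k) S))"
  shows "\<exists>r. strict_mono r \<and> ptendsto (\<lambda>k. \<Psi> (r k)) (\<lambda>_. 0)"
proof -
  define c where "c = (\<lambda>k. 1 / (1 + sqrt (nrm I (\<Psi> k))))"
  define X where "X = (\<lambda>k S. complex_of_real (c k) * \<Psi> k S)"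
  have sq: "0 \<le> sqrt (nrm I (\<Psi> k))" "0 < 1 + sqrt (nrm I (\<Psi> k))" for k
    using nrm_nonneg[of I "\<Psi> k"] by (auto intro: add_pos_nonneg)
  have c: "0 \<le> c k" "c k \<le> 1" for k using sq[of k] by (simp_all add: c_def)
  have cX: "cofactor (X k)" for k unfolding X_def by (rule cofactor_scale[OF \<Psi>(1)])
  have nX: "nrm I (X k) = (sqrt (nrm I (\<Psi> k)) / (1 + sqrt (nrm I (\<Psi> k))))\<^sup>2" for k
    using nrm_nonneg[of I "\<Psi> k"] c(1)[of k] unfolding X_def nrm_scale
    by (simp add: power_divide) (simp add: c_def power_divide)
  have "nrm I (X k) \<le> 1" for k
    unfolding nX using sq[of k] by (intro power_le_one) auto
  moreover have "supp_on I (X k)" for k using cX by (simp add: cofactor_def)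
  ultimately obtain r a where r: "strict_mono r" and a: "ptendsto (\<lambda>k. X (r k)) a"
    using unit_forms_subseq[OF I, of X] by auto
  have tr: "(\<lambda>k. t (r k)) \<longlonglongrightarrow> s" using LIMSEQ_subseq_LIMSEQ[OF lim r] by (simp add: o_def)
  \<comment> \<open>\<open>R (t k)\<close> annihilates the corrected form, so \<open>V (t k)\<close>
    applied to the correction equals \<open>R (t k)\<close> applied to \<open>y\<close>.\<close>
  have VX: "wedge (V (t k)) (X k) S = of_real (c k) * wedge (R (t k)) y S" if "S \<subseteq> gens I" for k S
    using \<Psi>(2)[of k] that unfolding wedge_diff_right X_def wedge_scale_right
    by (simp add: zero_on_def V_def wedge_assoc)
  have "zero_on I (wedge (V s) a)"
    unfolding zero_on_def
  proof (intro allI impI)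
    fix S assume S: "S \<subseteq> gens I"
    have "(\<lambda>k. wedge (R (t (r k))) y S) \<longlonglongrightarrow> wedge (R s) y S"
      using ptendsto_wedge[OF R_tendsto[OF tr] ptendsto_const] by (auto simp: ptendsto_def)
    then have R0: "(\<lambda>k. wedge (R (t (r k))) y S) \<longlonglongrightarrow> 0" using y S by (simp add: zero_on_def)
    have "(\<lambda>k. of_real (c (r k)) * wedge (R (t (r k))) y S) \<longlonglongrightarrow> 0"
    proof (rule Lim_null_comparison[OF _ tendsto_norm_zero[OF R0]], intro always_eventually allI)
      fix k
      show "norm (complex_of_real (c (r k)) * wedge (R (t (r k))) y S) \<le> norm (wedge (R (t (r k))) y S)"
        using c[of "r k"] by (simp add: norm_mult mult_left_le_one_le)
    qed
    moreover have "(\<lambda>k. wedge (V (t (r k))) (X (r k)) S) \<longlonglongrightarrow> wedge (V s) a S"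
      using ptendsto_wedge[OF V_tendsto[OF tr] a] by (simp add: ptendsto_def)
    ultimately show "wedge (V s) a S = 0" using VX[OF S] LIMSEQ_unique by auto
  qed
  then have "zero_on I a"
    by (rule lefschetz_cofactor[OF s cofactor_ptendsto[OF a cX]])
  then have "nrm I a = 0" using nrm_zero_iff[OF I] by simp
  then have lim0: "(\<lambda>k. nrm I (X (r k))) \<longlonglongrightarrow> 0" using nrm_tendsto[OF a, of I] by simp
  define d where "d = (\<lambda>k. sqrt (nrm I (\<Psi> (r k))))"
  have d0: "d k \<ge> 0" for k by (simp add: d_def nrm_nonneg)
  have "(\<lambda>k. sqrt (nrm I (X (r k)))) \<longlonglongrightarrow> 0" using tendsto_real_sqrt[OF lim0] by simp
  moreover have "sqrt (nrm I (X (r k))) = d k / (1 + d k)" for k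
    unfolding nX using d0[of k] by (simp add: d_def)
  ultimately have u: "(\<lambda>k. d k / (1 + d k)) \<longlonglongrightarrow> 0" by simp
  \<comment> \<open>The map \<open>u / (1 - u)\<close> inverts \<open>d / (1 + d)\<close> and is
    continuous at zero, which recovers convergence of the unscaled norms.\<close>
  have "(\<lambda>k. (d k / (1 + d k)) / (1 - d k / (1 + d k))) \<longlonglongrightarrow> 0 / (1 - 0)"
    by (intro tendsto_divide tendsto_diff tendsto_const u) simp
  moreover have "(d k / (1 + d k)) / (1 - d k / (1 + d k)) = d k" for k
    using d0[of k] by (simp add: field_simps)
  ultimately have dl: "d \<longlonglongrightarrow> 0" by simp
  have "(\<lambda>k. \<Psi> (r k) S) \<longlonglongrightarrow> 0" for S
  proof (rule Lim_null_comparison[OF _ dl], intro always_eventually allI)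
    fix k
    show "norm (\<Psi> (r k) S) \<le> d k"
    proof (cases "S \<subseteq> gens I")
      case True
      then show ?thesis using nrm_bound[OF I True, of "\<Psi> (r k)"] by (simp add: d_def real_le_rsqrt)
    next
      case False
      then show ?thesis using \<Psi>(1)[of "r k"] d0[of k] by (simp add: cofactor_def supp_on_def)
    qed
  qed
  then show ?thesis using r by (auto simp: ptendsto_def)
qed

text \<open>A form primitive at \<open>s\<close> is corrected to forms \<open>Y k\<close> primitive
  at later, good times; the corrections tend to zero, so nonnegativity survives in the
  limit.\<close>

lemma semidefinite_at_limit:
  assumes s: "0 \<le> s" "s < 1" and nb: "\<And>t. s < t \<Longrightarrow> t \<le> 1 \<Longrightarrow> \<not> bad t"
    and y: "has_type p q y" "zero_on I (wedge (R s) y)"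
  shows "Re (Q s y y) \<ge> 0"
proof -
  define t where "t = (\<lambda>k::nat. s + (1 - s) * inverse (real (Suc k)))"
  have tk: "s < t k" "t k \<le> 1" for k
  proof -
    have "inverse (real (Suc k)) \<le> 1" "inverse (real (Suc k)) > 0" by (auto simp: inverse_le_1_iff)
    then have "(1 - s) * inverse (real (Suc k)) \<le> (1 - s) * 1" "(1 - s) * inverse (real (Suc k)) > 0"
      using s by (intro mult_left_mono mult_pos_pos; simp)+
    then show "s < t k" "t k \<le> 1" by (simp_all add: t_def)
  qed
  have lim: "t \<longlonglongrightarrow> s"
  proof -
    have "t \<longlonglongrightarrow> s + (1 - s) * 0"
      unfolding t_def by (intro tendsto_add tendsto_mult tendsto_const LIMSEQ_inverse_real_of_nat)
    then show ?thesis by simp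
  qed
  have t01: "0 \<le> t k" for k using tk(1)[of k] s by simp
  obtain \<Psi> where \<Psi>: "\<And>k. cofactor (\<Psi> k)" "\<And>k. zero_on I (wedge (R (t k)) (\<lambda>S. y S - wedge (bt (t k)) (\<Psi> k) S))"
    using cofactor_exists[OF t01 tk(2) y(1)] by metis
  obtain r where r: "strict_mono r" "ptendsto (\<lambda>k. \<Psi> (r k)) (\<lambda>_. 0)"
    using cofactor_limit[OF t01 tk(2) lim s(1) _ y(2) \<Psi>] s by auto
  have tr: "(\<lambda>k. t (r k)) \<longlonglongrightarrow> s" using LIMSEQ_subseq_LIMSEQ[OF lim r(1)] by (simp add: o_def)
  define Y where "Y = (\<lambda>k S. y S - wedge (bt (t (r k))) (\<Psi> (r k)) S)"
  have "ptendsto Y (\<lambda>S. y S - wedge (bt s) (\<lambda>_. 0) S)"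
    unfolding Y_def bt_def by (intro ptendsto_diff ptendsto_const ptendsto_wedge ptendsto_mix tr r(2))
  then have Ylim: "ptendsto Y y" by (simp add: wedge_def)
  have "Re (Q (t (r k)) (Y k) (Y k)) \<ge> 0" for k
  proof (cases "zero_on I (Y k)")
    case True
    then have "zero_on I (wedge (wedge (W (t (r k))) (Y k)) (conj_form (Y k)))"
      using zero_on_wedge_left[OF zero_on_wedge_right] by blast
    then show ?thesis by (simp add: hr_form_def zero_on_def)
  next
    case False
    have "has_type p q (Y k)"
      unfolding Y_def by (intro has_type_diff y(1) type_bt_cofactor t01 tk(2) \<Psi>(1))
    then have "Re (Q (t (r k)) (Y k) (Y k)) > 0"
      using not_bad_pos[OF nb[OF tk] _ _ False] \<Psi>(2)[of "r k"] by (simp add: Y_def)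
    then show ?thesis by simp
  qed
  then show ?thesis by (intro LIMSEQ_le_const[OF Q_tendsto[OF tr Ylim]]) auto
qed

text \<open>The Cauchy--Schwarz argument: if \<open>A\<close> were nonzero, moving from the null
  vector \<open>\<Phi>\<close> a little in direction \<open>- A * y\<close> would make the
  semidefinite form negative.\<close>

lemma null_vector:
  assumes s: "0 \<le> s" "s \<le> 1"
    and semi: "\<And>y. has_type p q y \<Longrightarrow> zero_on I (wedge (R s) y) \<Longrightarrow> Re (Q s y y) \<ge> 0"
    and \<Phi>: "has_type p q \<Phi>" "zero_on I (wedge (R s) \<Phi>)" "Re (Q s \<Phi> \<Phi>) \<le> 0"
    and y: "has_type p q y" "zero_on I (wedge (R s) y)"
  shows "Q s \<Phi> y = 0"
proof -
  define A A' where "A = Q s \<Phi> y" and "A' = Q s y \<Phi>"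
  have real: "Im (Q s x x) = 0" if "has_type p q x" for x by (rule hr_form_real[OF conj_W[OF s] that])
  have \<Phi>0: "Q s \<Phi> \<Phi> = 0" using semi[OF \<Phi>(1,2)] \<Phi>(3) real[OF \<Phi>(1)] by (simp add: complex_eq_iff)
  have expand: "Q s (\<lambda>S. 1 * \<Phi> S + z * y S) (\<lambda>S. 1 * \<Phi> S + z * y S) = cnj z * A + z * A' + z * cnj z * Q s y y" for z
    unfolding Q_lin_left Q_lin_right \<Phi>0 A_def A'_def by (simp add: algebra_simps)
  have ty: "has_type p q (\<lambda>S. 1 * \<Phi> S + z * y S)" for z by (rule has_type_lin[OF \<Phi>(1) y(1)])
  have zr: "zero_on I (wedge (R s) (\<lambda>S. 1 * \<Phi> S + z * y S))" for z
    using \<Phi>(2) y(2) by (simp add: wedge_add_right wedge_scale_right zero_on_def)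
  have im: "Im (cnj z * A + z * A' + z * cnj z * Q s y y) = 0" for z
    using real[OF ty, of z] unfolding expand .
  have re: "Re (cnj z * A + z * A' + z * cnj z * Q s y y) \<ge> 0" for z
    using semi[OF ty zr, of z] unfolding expand .
  \<comment> \<open>Hermitian symmetry by polarisation: the form is real at
    \<open>\<Phi> + y\<close> and at \<open>\<Phi> + \<i> y\<close>.\<close>
  have A': "A' = cnj A"
    using im[of 1] im[of \<i>] real[OF y(1)] by (simp add: complex_eq_iff)
  define c where "c = Re (Q s y y)"
  have Qc: "Q s y y = of_real c" using real[OF y(1)] by (simp add: c_def complex_eq_iff)
  \<comment> \<open>Small enough that \<open>e * c < 2\<close>, so the linear term
    \<open>- 2 * e\<close> outweighs the quadratic one.\<close>
  define e where "e = 1 / (1 + \<bar>c\<bar>)"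
  have e: "e > 0" "e * c < 2"
    using abs_ge_self[of c] by (auto simp: e_def divide_simps abs_if split: if_splits)
  have "cnj (- of_real e * A) * A + (- of_real e * A) * A' + (- of_real e * A) * cnj (- of_real e * A) * Q s y y
     = of_real (e * (e * c - 2)) * (A * cnj A)"
    unfolding A' Qc by (simp add: algebra_simps)
  also have "\<dots> = of_real (e * (e * c - 2) * (cmod A)\<^sup>2)" by (simp only: complex_norm_square of_real_mult)
  finally have "e * (e * c - 2) * (cmod A)\<^sup>2 \<ge> 0" using re[of "- of_real e * A"] by simp
  moreover have "e * (e * c - 2) < 0" using e by (simp add: mult_pos_neg)
  ultimately have "(cmod A)\<^sup>2 \<le> 0" using e by (auto simp: zero_le_mult_iff)
  then show ?thesis by (simp add: A_def)
qed

text \<open>A bad vector at \<open>s\<close> is orthogonal to the primitive part of any (p,q)-form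
  by \<open>null_vector\<close> and to the part \<open>bt s \<and> \<Psi>\<close> by primitivity. By
  duality \<open>W s\<close> annihilates it, which hard Lefschetz forbids.\<close>

lemma not_bad_step:
  assumes s: "0 \<le> s" "s < 1" and nb: "\<And>t. s < t \<Longrightarrow> t \<le> 1 \<Longrightarrow> \<not> bad t"
  shows "\<not> bad s"
proof
  assume "bad s"
  then obtain \<Phi> where \<Phi>: "has_type p q \<Phi>" "nrm I \<Phi> = 1" "zero_on I (wedge (R s) \<Phi>)" "Re (Q s \<Phi> \<Phi>) \<le> 0"
    unfolding bad_def by blast
  have s1: "s \<le> 1" using s by simp
  note semi = semidefinite_at_limit[OF s nb]
  have orth: "Q s \<Phi> x = 0" if x: "has_type p q x" for x
  proof -
    obtain \<Psi> where \<Psi>: "cofactor \<Psi>" "zero_on I (wedge (R s) (\<lambda>S. x S - wedge (bt s) \<Psi> S))"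
      using cofactor_exists[OF s(1) s1 x] by blast
    have ty: "has_type p q (\<lambda>S. x S - wedge (bt s) \<Psi> S)"
      by (intro has_type_diff x type_bt_cofactor[OF s(1) s1 \<Psi>(1)])
    have 1: "Q s \<Phi> (\<lambda>S. x S - wedge (bt s) \<Psi> S) = 0"
      by (rule null_vector[OF s(1) s1 semi \<Phi>(1,3,4) ty \<Psi>(2)])
    have cb: "conj_form (bt s) = bt s" using psd_bt[OF s(1) s1] by (simp add: psd_def)
    \<comment> \<open>The real (1,1)-form \<open>bt s\<close> is moved from the second argument next
      to \<open>W s\<close>, where it completes \<open>R s\<close>.\<close>
    have "wedge (wedge (W s) \<Phi>) (conj_form (wedge (bt s) \<Psi>)) = wedge (wedge (R s) \<Phi>) (conj_form \<Psi>)"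
    proof -
      have "wedge (wedge (W s) \<Phi>) (wedge (bt s) (conj_form \<Psi>)) = wedge (wedge (W s) (wedge \<Phi> (bt s))) (conj_form \<Psi>)"
        by (simp only: wedge_assoc)
      also have "wedge \<Phi> (bt s) = wedge (bt s) \<Phi>" by (rule wedge_comm11[OF type_bt[OF s(1) s1], symmetric])
      finally show ?thesis by (simp only: conj_wedge cb R_def wedge_assoc)
    qed
    moreover have "zero_on I (wedge (wedge (R s) \<Phi>) (conj_form \<Psi>))" by (rule zero_on_wedge_left[OF \<Phi>(3)])
    ultimately have 2: "Q s \<Phi> (wedge (bt s) \<Psi>) = 0" by (simp add: hr_form_def zero_on_def)
    have "Q s \<Phi> (\<lambda>S. 1 * (x S - wedge (bt s) \<Psi> S) + 1 * wedge (bt s) \<Psi> S) = 0"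
      unfolding Q_lin_right 1 2 by simp
    then show ?thesis by simp
  qed
  have "zero_on I (wedge (W s) \<Phi>)"
  proof (rule zero_on_if_pairing[OF I])
    have "has_type (card I - p - q + p) (card I - p - q + q) (wedge (W s) \<Phi>)"
      by (rule has_type_wedge[OF type_W[OF s(1) s1] \<Phi>(1)])
    moreover have "card I - p - q + p = card I - q" "card I - p - q + q = card I - p" using pq by auto
    ultimately show "has_type (card I - q) (card I - p) (wedge (W s) \<Phi>)" by simp
    show "p \<le> card I" "q \<le> card I" using pq by auto
    fix x assume "has_type p q x"
    then have "hr_const I p q * wedge (wedge (W s) \<Phi>) (conj_form x) (gens I) = 0"
      using orth[of x] by (simp add: hr_form_def)
    moreover have "hr_const I p q \<noteq> 0" by (simp add: hr_const_def)
    ultimately show "wedge (wedge (W s) \<Phi>) (conj_form x) (gens I) = 0" by simp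
  qed
  then have "zero_on I \<Phi>" by (rule lefschetz_W[OF s(1) s1 \<Phi>(1)])
  then show False using \<Phi>(2) nrm_zero_iff[OF I, of \<Phi>] by simp
qed

lemma not_bad_1: "\<not> bad 1"
proof
  assume "bad 1"
  then obtain \<Phi> where \<Phi>: "has_type p q \<Phi>" "nrm I \<Phi> = 1" "zero_on I (wedge (R 1) \<Phi>)" "Re (Q 1 \<Phi> \<Phi>) \<le> 0"
    unfolding bad_def by blast
  have mix1: "mix I 1 = (\<lambda>f. std_form I)" by (simp add: mix_def fun_eq_iff)
  have W1: "W 1 = wprod (replicate (card I - p - q) (std_form I))"
    by (simp add: W_def mix1 len map_replicate_const)
  have ts: "has_type 1 1 (std_form I)" using psd_std_form[OF I] by (simp add: psd_def)
  have "R 1 = wprod (replicate (card I - p - q + 1) (std_form I))"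
    using wedge_comm11[OF ts, of "W 1"] by (simp add: R_def W1 bt_def mix1)
  then have "zero_on I (wedge (wprod (replicate (card I - p - q + 1) (std_form I))) \<Phi>)" using \<Phi>(3) by simp
  moreover have "\<not> zero_on I \<Phi>" using \<Phi>(2) nrm_zero_iff[OF I, of \<Phi>] by auto
  ultimately have "Re (Q 1 \<Phi> \<Phi>) > 0" unfolding W1 using hodge_riemann_std[OF I \<Phi>(1) pq] by blast
  then show False using \<Phi>(4) by simp
qed

text \<open>The bad times in the unit interval form a compact set. A largest one would lie below 1
  with only good times after it, contrary to \<open>not_bad_step\<close>.\<close>

lemma not_bad_0: "\<not> bad 0"
proof
  assume b0: "bad 0"
  define A where "A = {t\<in>{0..1}. bad t}"
  have "closed A"
    unfolding closed_sequential_limits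
  proof (intro allI impI)
    fix t l assume "(\<forall>k. t k \<in> A) \<and> t \<longlonglongrightarrow> l"
    then have t: "\<And>k. t k \<in> {0..1}" "\<And>k. bad (t k)" "t \<longlonglongrightarrow> l" by (auto simp: A_def)
    then have "bad l" using bad_closed by blast
    moreover have "l \<in> {0..1}" using closed_sequentially[OF closed_atLeastAtMost t(1) t(3)] .
    ultimately show "l \<in> A" by (simp add: A_def)
  qed
  moreover have "bounded A" by (rule bounded_subset[OF compact_imp_bounded[OF compact_Icc[of 0 1]]]) (auto simp: A_def)
  ultimately have "compact A" by (simp add: compact_eq_bounded_closed)
  moreover have "0 \<in> A" using b0 by (simp add: A_def)
  then have "A \<noteq> {}" by blast
  ultimately obtain s where s: "s \<in> A" "\<forall>t\<in>A. t \<le> s" using compact_attains_sup by blast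
  have s': "0 \<le> s" "s \<le> 1" "bad s" using s(1) by (auto simp: A_def)
  then have "s < 1" using not_bad_1 by (metis less_le)
  moreover have "\<not> bad t" if "s < t" "t \<le> 1" for t
  proof
    assume "bad t"
    then have "t \<in> A" using that s' by (simp add: A_def)
    then show False using s(2) that by auto
  qed
  ultimately show False using not_bad_step[of s] s' by blast
qed

lemma positive_definite:
  assumes "has_type p q \<Phi>" "zero_on I (wedge (wedge (wprod fs) b) \<Phi>)" "\<not> zero_on I \<Phi>"
  shows "Re (hr_form I p q (wprod fs) \<Phi> \<Phi>) > 0"
proof -
  have "mix I 0 = (\<lambda>f. f)" by (simp add: mix_def fun_eq_iff)
  then have "W 0 = wprod fs" "R 0 = wedge (wprod fs) b" by (simp_all add: W_def R_def bt_def)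
  then show ?thesis using not_bad_pos[OF not_bad_0 assms(1)] assms by simp
qed

end

text \<open>There is no separate base case: over the empty index set the induction hypothesis
  concerns no hyperplane.\<close>

theorem hodge_riemann: "finite I \<Longrightarrow> hodge_riemann I"
proof (induction "card I" arbitrary: I rule: less_induct)
  case less
  have IH: "hodge_riemann (I - {j})" if "j \<in> I" for j
    by (rule less.hyps[OF card_Diff1_less]) (use less.prems that in auto)
  show ?case
    unfolding hodge_riemann_def
  proof (intro allI impI)
    fix p q m fs b \<Phi>
    assume *: "hr_data I p q m fs" "psd I m b" "has_type p q \<Phi>"
      "zero_on I (wedge (wedge (wprod fs) b) \<Phi>)" "\<not> zero_on I \<Phi>"
    interpret hr_deformation I p q m fs b
      by unfold_locales (use less.prems IH * in auto)
    show "Re (hr_form I p q (wprod fs) \<Phi> \<Phi>) > 0" using positive_definite * by blast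
  qed
qed

subsection \<open>From positivity to rank\<close>

lemma gens_lessThan: "gens {..<n} = {..<2*n}"
  by (auto simp: gens_def)

lemma hquad_lessThan: "hquad {..<n} a v = herm_quad n a v"
  by (simp add: hquad_def herm_quad_def)

lemma is_pq_form_has_type: "is_pq_form n p q a \<Longrightarrow> has_type p q a"
  unfolding is_pq_form_def is_form_def has_type_def using finite_subset by blast

lemma wedge_seq_wprod:
  "(\<And>i. i \<in> {1..k} \<Longrightarrow> fin_form (a i)) \<Longrightarrow> wedge_seq a k = wprod (map a [1..<Suc k])"
  by (induction k) (simp_all add: wprod_append wedge_one_right)

lemma wedge_pow_wprod: "fin_form a \<Longrightarrow> wedge_pow a k = wprod (replicate k a)"
  using wedge_seq_wprod[of k "\<lambda>_. a"] by (simp add: wedge_pow_def map_replicate_const del: upt_Suc)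

lemma top_positive_value:
  assumes "top_positive n \<Gamma>"
  obtains c :: real where "c > 0" "\<Gamma> {..<2*n} = of_real c * \<i> ^ n"
proof -
  define z where "z = top_ratio n \<Gamma> (std_vol n)"
  have z: "z = of_real (Re z)" "Re z > 0"
    using assms by (auto simp: top_positive_def z_def complex_eq_iff)
  have "\<Gamma> {..<2*n} = z * (\<i> / 2) ^ n" by (simp add: z_def top_ratio_def std_vol_def)
  also have "\<dots> = of_real (Re z / 2 ^ n) * \<i> ^ n"
    by (subst z(1)) (simp add: power_divide)
  finally show ?thesis using that[of "Re z / 2 ^ n"] z(2) by simp
qed

lemma kaehler_psd:
  assumes "kaehler_form n \<omega>"
  shows "psd {..<n} n \<omega>"
proof -
  have pos: "Re (hquad {..<n} \<omega> v) > 0" if "\<exists>j\<in>{..<n}. v j \<noteq> 0" for v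
    using assms that unfolding kaehler_form_def hquad_lessThan by blast
  have "Re (hquad {..<n} \<omega> v) \<ge> 0" for v
  proof (cases "\<exists>j\<in>{..<n}. v j \<noteq> 0")
    case False
    then have "hquad {..<n} \<omega> v = 0" by (simp add: hquad_def)
    then show ?thesis by simp
  qed (use pos[of v] in simp)
  moreover have "rank_ge {..<n} n \<omega>" using rank_ge_positive[of "{..<n}" \<omega>] pos by simp
  moreover have "Im (hquad {..<n} \<omega> v) = 0" for v
    using assms unfolding kaehler_form_def hquad_lessThan by blast
  ultimately show ?thesis
    using assms is_pq_form_has_type unfolding psd_def kaehler_form_def real_11_form_def by blast
qed

text \<open>The product with exponent \<open>m\<close> is nonzero at the top set, and
  \<open>rank_ge_if_wedge_pow\<close> converts this into rank.\<close>

lemma m_positive_psd: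
  assumes "real_11_form n \<alpha>" "semipositive n \<alpha>" "m_positive n m \<omega> \<alpha>"
  shows "psd {..<n} m \<alpha>"
proof -
  have p0: "psd {..<n} 0 \<alpha>"
    using assms(1,2) is_pq_form_has_type
    by (auto simp: psd_def real_11_form_def semipositive_def rank_ge_def hquad_lessThan)
  have "rank_ge {..<n} m \<alpha>"
  \<comment> \<open>Exponent zero lies outside the range of \<open>m_positive\<close>, but rank at
    least zero is an empty condition.\<close>
  proof (cases "m = 0")
    case False
    then have "top_positive n (wedge (wedge_pow \<alpha> m) (wedge_pow \<omega> (n - m)))"
      using assms(3) by (simp add: m_positive_def)
    then have "wedge (wedge_pow \<alpha> m) (wedge_pow \<omega> (n - m)) (gens {..<n}) \<noteq> 0"
      unfolding gens_lessThan by (elim top_positive_value) simp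
    then show ?thesis using rank_ge_if_wedge_pow p0 by blast
  qed (simp add: rank_ge_def)
  then show ?thesis using p0 by (simp add: psd_def)
qed

theorem theorem3p1:
  fixes n m p q :: nat and \<omega> \<Gamma> :: cform and \<alpha> :: "nat \<Rightarrow> cform"
  assumes "p + q \<le> m" and "m \<le> n"
    and "kaehler_form n \<omega>"
    and "\<And>k. k \<in> {1..m-p-q+1} \<Longrightarrow>
           real_11_form n (\<alpha> k) \<and> semipositive n (\<alpha> k) \<and> m_positive n m \<omega> (\<alpha> k)"
    and "top_positive n \<Gamma>"
  shows "\<forall>\<Phi>. is_pq_form n p q \<Phi> \<and> \<Phi> \<noteq> zero_form \<and>
            wedge (wedge (wedge (wedge_pow \<omega> (n - m)) (wedge_seq \<alpha> (m - p - q)))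
                         (\<alpha> (m - p - q + 1))) \<Phi> = zero_form
          \<longrightarrow> (let Q = \<i> powi (int q - int p) * (-1) ^ ((p + q) * (p + q + 1) div 2) *
                     top_ratio n (wedge (wedge (wedge (wedge_pow \<omega> (n - m)) (wedge_seq \<alpha> (m - p - q))) \<Phi>)
                                        (conj_form \<Phi>)) \<Gamma>
               in Im Q = 0 \<and> Re Q > 0)"
proof (intro allI impI, elim conjE)
  fix \<Phi>
  assume \<Phi>: "is_pq_form n p q \<Phi>" "\<Phi> \<noteq> zero_form"
    "wedge (wedge (wedge (wedge_pow \<omega> (n - m)) (wedge_seq \<alpha> (m - p - q))) (\<alpha> (m - p - q + 1))) \<Phi> = zero_form"
  define I where "I = {..<n}"
  define \<Omega> where "\<Omega> = wedge (wedge_pow \<omega> (n - m)) (wedge_seq \<alpha> (m - p - q))"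
  define fs where "fs = replicate (n - m) \<omega> @ map \<alpha> [1..<Suc (m - p - q)]"
  have I: "finite I" "card I = n" by (simp_all add: I_def)
  have \<omega>: "psd I n \<omega>" unfolding I_def by (rule kaehler_psd[OF assms(3)])
  have \<alpha>: "psd I m (\<alpha> k)" if "k \<in> {1..m-p-q+1}" for k
    unfolding I_def using m_positive_psd assms(4)[OF that] by blast
  have fin: "fin_form \<omega>" "\<And>k. k \<in> {1..m-p-q+1} \<Longrightarrow> fin_form (\<alpha> k)"
    using \<omega> \<alpha> has_type_fin unfolding psd_def by blast+
  have \<Omega>: "\<Omega> = wprod fs"
    using wedge_pow_wprod[OF fin(1), of "n - m"] wedge_seq_wprod[of "m - p - q" \<alpha>] fin(2)
    by (simp add: \<Omega>_def fs_def wprod_append)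
  have data: "hr_data I p q m fs"
    unfolding hr_data_def fs_def I(2)
    by (intro conjI exI[of _ "replicate (n - m) \<omega>"] exI[of _ "map \<alpha> [1..<Suc (m - p - q)]"])
       (use assms(1,2) \<omega> \<alpha> in auto)
  have t: "has_type p q \<Phi>" by (rule is_pq_form_has_type[OF \<Phi>(1)])
  \<comment> \<open>A form on C^n has no coefficients outside \<open>gens I\<close>, so being
    nonzero is detected there.\<close>
  have nz: "\<not> zero_on I \<Phi>"
    using \<Phi>(1,2) unfolding is_pq_form_def is_form_def zero_on_def zero_form_def I_def gens_lessThan by blast
  have "zero_on I (wedge (wedge (wprod fs) (\<alpha> (m - p - q + 1))) \<Phi>)"
    using \<Phi>(3) unfolding \<Omega>_def[symmetric] \<Omega> by (simp add: zero_on_def zero_form_def)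
  then have pos: "Re (hr_form I p q \<Omega> \<Phi> \<Phi>) > 0"
    using hodge_riemann[OF I(1)] data \<alpha>[of "m - p - q + 1"] t nz
    unfolding hodge_riemann_def \<Omega> by auto
  have "conj_form \<Omega> = \<Omega>"
    unfolding \<Omega> by (rule conj_wprod) (use hr_data_psd[OF data] in \<open>auto simp: psd_def\<close>)
  then have real: "Im (hr_form I p q \<Omega> \<Phi> \<Phi>) = 0" by (rule hr_form_real[OF _ t])
  obtain c where c: "c > 0" "\<Gamma> {..<2*n} = of_real c * \<i> ^ n"
    using top_positive_value[OF assms(5)] .
  \<comment> \<open>The factor \<open>\<i> ^ n\<close> in the top coefficient of
    \<open>\<Gamma>\<close> is the denominator of \<open>hr_const\<close>; the remaining factor
    \<open>c\<close> is positive and does not affect the sign.\<close>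
  have "\<i> powi (int q - int p) * (-1) ^ ((p + q) * (p + q + 1) div 2) *
      top_ratio n (wedge (wedge \<Omega> \<Phi>) (conj_form \<Phi>)) \<Gamma> = hr_form I p q \<Omega> \<Phi> \<Phi> / of_real c"
    using c by (simp add: top_ratio_def hr_form_def hr_const_def I_def gens_lessThan)
  then show "let Q = \<i> powi (int q - int p) * (-1) ^ ((p + q) * (p + q + 1) div 2) *
       top_ratio n (wedge (wedge (wedge (wedge_pow \<omega> (n - m)) (wedge_seq \<alpha> (m - p - q))) \<Phi>) (conj_form \<Phi>)) \<Gamma>
     in Im Q = 0 \<and> Re Q > 0"
    using pos real c(1) unfolding \<Omega>_def[symmetric] Let_def by (simp add: Im_divide_of_real Re_divide_of_real)
qed

end
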